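(* Let $X$, $Y$, and $B$ be rearrangement invariant Banach function spaces on $\mathbb R^n$. (i) Let $k\in\mathbb N$, $s\in(0,1)$, and $q\in[1,\infty)$. If there exists a positive constant $C$ such that $$\left\|\mathfrak D^{s,k}_q(f)\right\|_B\le C\|f\|_X^{1-s}\left\|\nabla^kf\right\|_Y^s$$ holds for any $f\in X\cap\dot W^{k,Y}$, then $X^{1-s}Y^s\hookrightarrow B$. (ii) Let $j,k\in\mathbb N$ with $1\le j<k$. If there exists a positive constant $C$ such that $$\left\|\nabla^jf\right\|_B\le C\|f\|_X^{1-\frac jk}\left\|\nabla^kf\right\|_Y^{\frac jk}$$ holds for any $f\in X\cap\dot W^{k,Y}$, then $X^{1-\frac jk}Y^{\frac jk}\hookrightarrow B$.
   Context: All functions are real-valued measurable functions on $\mathbb R^n$; $L^0$ is the set of all of them. $\Delta_h^kf(x):=\sum_{j=0}^k(-1)^{k-j}\binom kj f(x+jh)$ and $\mathfrak D^{s,k}_q(f)(x):=[\int_{\mathbb R^n}\frac{|\Delta_h^kf(x)|^q}{|h|^{n+skq}}\,dh]^{1/q}$. A Banach function space is a Banach space $X\subset L^0$ with norm $\|\cdot\|_X$ defined (with values in $[0,\infty]$) on all of $L^0$ such that: (a) $\|f\|_X=0$ implies $f=0$ a.e.; (b) $|g|\le|f|$ a.e. implies $\|g\|_X\le\|f\|_X$; (c) $0\le f_m\uparrow f$ a.e. implies $\|f_m\|_X\uparrow\|f\|_X$; (d) $\mathbf 1_E\in X$ for every measurable $E$ with $|E|<\infty$; (e) for every measurable $E$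 with $|E|<\infty$ there is $C_{(E)}>0$ with $\int_E|f|\le C_{(E)}\|f\|_X$ for all $f\in X$. It is rearrangement invariant if, whenever $f\in L^0$ and $g\in X$ satisfy $|\{|f|>\alpha\}|=|\{|g|>\alpha\}|$ for all $\alpha>0$, one has $f\in X$ and $\|f\|_X=\|g\|_X$. For $s\in(0,1)$, the Calderón–Lozanovskiĭ space $X^{1-s}Y^s$ is the set of $h\in L^0$ with $|h|\le|f|^{1-s}|g|^s$ for some $f\in X$, $g\in Y$, with norm $\|h\|_{X^{1-s}Y^s}:=\inf\{\|f\|_X^{1-s}\|g\|_Y^s:|h|\le|f|^{1-s}|g|^s\}$. $\hookrightarrow$ denotes continuous embedding. $\dot W^{k,Y}$ is the set of all $f\in L^1_{\rm loc}$ whose weak derivatives $\partial^\alpha f$ exist and belong to $Y$ for all $|\alpha|=k$; $\|\nabla^kf\|_Y:=\||\nabla^kf|\|_Y$. *)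

theory Defs
  imports "HOL-Analysis.Analysis"
begin

section \<open>Rearrangement invariant Banach function spaces\<close>

definition L0 :: "(real^'n \<Rightarrow> real) set"
  where "L0 = borel_measurable lebesgue"

text \<open>
  A function space is given by its norm functional, which is defined on all of \<^const>\<open>L0\<close> with
  values in $[0,\infty]$ (its values outside \<^const>\<open>L0\<close> are irrelevant); the space itself consists
  of the functions of finite norm. Functions are not quotiented by equality almost everywhere.
\<close>

definition fspace :: "((real^'n \<Rightarrow> real) \<Rightarrow> ennreal) \<Rightarrow> (real^'n \<Rightarrow> real) set"
  where "fspace N = {f \<in> L0. N f < \<infinity>}"

locale banach_function_space =
  fixes N :: "(real^'n \<Rightarrow> real) \<Rightarrow> ennreal"
  assumes norm_scale: "f \<in> L0 \<Longrightarrow> N (\<lambda>x. c * f x) = ennreal \<bar>c\<bar> * N f"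
    and norm_triangle: "f \<in> L0 \<Longrightarrow> g \<in> L0 \<Longrightarrow> N (\<lambda>x. f x + g x) \<le> N f + N g"
    and complete: "(\<And>m. F m \<in> fspace N) \<Longrightarrow>
          (\<forall>e>0. \<exists>M. \<forall>m\<ge>M. \<forall>l\<ge>M. N (\<lambda>x. F m x - F l x) < ennreal e) \<Longrightarrow>
          \<exists>f\<in>fspace N. (\<lambda>m. N (\<lambda>x. F m x - f x)) \<longlonglongrightarrow> 0"
    and norm_eq_0_imp: "f \<in> L0 \<Longrightarrow> N f = 0 \<Longrightarrow> AE x in lebesgue. f x = 0"
    and norm_mono: "f \<in> L0 \<Longrightarrow> g \<in> L0 \<Longrightarrow> AE x in lebesgue. \<bar>g x\<bar> \<le> \<bar>f x\<bar> \<Longrightarrow> N g \<le> N f"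
    and norm_Fatou: "(\<And>m. F m \<in> L0) \<Longrightarrow> f \<in> L0 \<Longrightarrow>
          AE x in lebesgue. (\<forall>m. 0 \<le> F m x) \<and> incseq (\<lambda>m. F m x) \<and> (\<lambda>m. F m x) \<longlonglongrightarrow> f x \<Longrightarrow>
          incseq (\<lambda>m. N (F m)) \<and> (\<lambda>m. N (F m)) \<longlonglongrightarrow> N f"
    and indicator_in_space: "E \<in> sets lebesgue \<Longrightarrow> emeasure lebesgue E < \<infinity> \<Longrightarrow>
          indicator E \<in> fspace N"
    and integral_bound: "E \<in> sets lebesgue \<Longrightarrow> emeasure lebesgue E < \<infinity> \<Longrightarrow>
          \<exists>C>0. \<forall>f\<in>fspace N. (\<integral>\<^sup>+x\<in>E. ennreal \<bar>f x\<bar> \<partial>lebesgue) \<le> ennreal C * N f"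

locale ri_banach_function_space = banach_function_space N
  for N :: "(real^'n \<Rightarrow> real) \<Rightarrow> ennreal" +
  assumes rearrangement_invariant: "f \<in> L0 \<Longrightarrow> g \<in> fspace N \<Longrightarrow>
          (\<forall>\<alpha>>0. emeasure lebesgue {x. \<alpha> < \<bar>f x\<bar>} = emeasure lebesgue {x. \<alpha> < \<bar>g x\<bar>}) \<Longrightarrow>
          f \<in> fspace N \<and> N f = N g"

text \<open>
  The norm of a $[0,\infty]$-valued function: it is infinite if the function is infinite on a set of
  positive measure, as forced by monotonicity and the Fatou property.
\<close>

definition ext_norm :: "((real^'n \<Rightarrow> real) \<Rightarrow> ennreal) \<Rightarrow> (real^'n \<Rightarrow> ennreal) \<Rightarrow> ennreal"
  where "ext_norm N g = (if AE x in lebesgue. g x < \<infinity> then N (\<lambda>x. enn2real (g x)) else \<infinity>)"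

text \<open>Only used for positive exponents.\<close>

definition ennpowr :: "ennreal \<Rightarrow> real \<Rightarrow> ennreal"
  where "ennpowr a p = (if a = \<infinity> then \<infinity> else ennreal (enn2real a powr p))"


section \<open>The Calderon-Lozanovskii construction and continuous embeddings\<close>

definition CL_pairs ::
  "((real^'n \<Rightarrow> real) \<Rightarrow> ennreal) \<Rightarrow> ((real^'n \<Rightarrow> real) \<Rightarrow> ennreal) \<Rightarrow> real \<Rightarrow> (real^'n \<Rightarrow> real) \<Rightarrow>
     ((real^'n \<Rightarrow> real) \<times> (real^'n \<Rightarrow> real)) set"
  where "CL_pairs X Y s h = {(f, g). f \<in> fspace X \<and> g \<in> fspace Y \<and>
           (AE x in lebesgue. \<bar>h x\<bar> \<le> \<bar>f x\<bar> powr (1 - s) * \<bar>g x\<bar> powr s)}"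

definition CL_space ::
  "((real^'n \<Rightarrow> real) \<Rightarrow> ennreal) \<Rightarrow> ((real^'n \<Rightarrow> real) \<Rightarrow> ennreal) \<Rightarrow> real \<Rightarrow> (real^'n \<Rightarrow> real) set"
  where "CL_space X Y s = {h \<in> L0. CL_pairs X Y s h \<noteq> {}}"

definition CL_norm ::
  "((real^'n \<Rightarrow> real) \<Rightarrow> ennreal) \<Rightarrow> ((real^'n \<Rightarrow> real) \<Rightarrow> ennreal) \<Rightarrow> real \<Rightarrow> (real^'n \<Rightarrow> real) \<Rightarrow> ennreal"
  where "CL_norm X Y s h = (INF (f, g)\<in>CL_pairs X Y s h. ennpowr (X f) (1 - s) * ennpowr (Y g) s)"

definition continuously_embedded ::
  "'f set \<Rightarrow> ('f \<Rightarrow> ennreal) \<Rightarrow> 'f set \<Rightarrow> ('f \<Rightarrow> ennreal) \<Rightarrow> bool"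
  where "continuously_embedded A NA B NB \<longleftrightarrow>
           A \<subseteq> B \<and> (\<exists>C>0. \<forall>h\<in>A. NB h \<le> ennreal C * NA h)"


section \<open>Weak derivatives and homogeneous Sobolev spaces\<close>

definition partial_deriv :: "'n \<Rightarrow> (real^'n \<Rightarrow> real) \<Rightarrow> real^'n \<Rightarrow> real"
  where "partial_deriv i f = (\<lambda>x. frechet_derivative f (at x) (axis i 1))"

text \<open>The test functions $C_c^\infty$; the list is a sequence of directions of differentiation.\<close>

definition test_function :: "(real^'n \<Rightarrow> real) \<Rightarrow> bool"
  where "test_function \<phi> \<longleftrightarrow>
           (\<forall>is. foldr partial_deriv is \<phi> differentiable_on UNIV) \<and> compact (closure {x. \<phi> x \<noteq> 0})"

definition coord_list :: "'n::finite list"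
  where "coord_list = (SOME is. distinct is \<and> set is = UNIV)"

definition multi_deriv :: "nat^'n \<Rightarrow> (real^'n \<Rightarrow> real) \<Rightarrow> real^'n \<Rightarrow> real"
  where "multi_deriv \<alpha> f = foldr (\<lambda>i. partial_deriv i ^^ (\<alpha> $ i)) coord_list f"

definition mi_order :: "nat^'n \<Rightarrow> nat"
  where "mi_order \<alpha> = (\<Sum>i\<in>UNIV. \<alpha> $ i)"

definition locally_integrable :: "(real^'n \<Rightarrow> real) \<Rightarrow> bool"
  where "locally_integrable f \<longleftrightarrow> (\<forall>K. compact K \<longrightarrow> f absolutely_integrable_on K)"

definition has_weak_deriv :: "nat^'n \<Rightarrow> (real^'n \<Rightarrow> real) \<Rightarrow> (real^'n \<Rightarrow> real) \<Rightarrow> bool"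
  where "has_weak_deriv \<alpha> f g \<longleftrightarrow> locally_integrable f \<and> locally_integrable g \<and>
           (\<forall>\<phi>. test_function \<phi> \<longrightarrow>
              (LINT x|lebesgue. f x * multi_deriv \<alpha> \<phi> x) =
              (-1) ^ mi_order \<alpha> * (LINT x|lebesgue. g x * \<phi> x))"

text \<open>
  A representative; weak derivatives are unique up to equality almost everywhere. If all weak
  derivatives of order $k$ exist, then so do those of each order $j < k$.
\<close>

definition weak_deriv :: "nat^'n \<Rightarrow> (real^'n \<Rightarrow> real) \<Rightarrow> real^'n \<Rightarrow> real"
  where "weak_deriv \<alpha> f = (SOME g. has_weak_deriv \<alpha> f g)"

definition abs_grad :: "nat \<Rightarrow> (real^'n \<Rightarrow> real) \<Rightarrow> real^'n \<Rightarrow> real"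
  where "abs_grad k f = (\<lambda>x. sqrt (\<Sum>\<alpha> | mi_order \<alpha> = k. (weak_deriv \<alpha> f x)\<^sup>2))"

definition hom_sobolev :: "nat \<Rightarrow> ((real^'n \<Rightarrow> real) \<Rightarrow> ennreal) \<Rightarrow> (real^'n \<Rightarrow> real) set"
  where "hom_sobolev k Y = {f. locally_integrable f \<and>
           (\<forall>\<alpha>. mi_order \<alpha> = k \<longrightarrow> (\<exists>g\<in>fspace Y. has_weak_deriv \<alpha> f g))}"


section \<open>Finite differences\<close>

definition fin_diff :: "nat \<Rightarrow> real^'n \<Rightarrow> (real^'n \<Rightarrow> real) \<Rightarrow> real^'n \<Rightarrow> real"
  where "fin_diff k h f x = (\<Sum>j\<le>k. (-1) ^ (k - j) * real (k choose j) * f (x + real j *\<^sub>R h))"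

definition diff_functional :: "real \<Rightarrow> nat \<Rightarrow> real \<Rightarrow> (real^'n \<Rightarrow> real) \<Rightarrow> real^'n \<Rightarrow> ennreal"
  where "diff_functional s k q f x =
           ennpowr (\<integral>\<^sup>+h. ennreal (\<bar>fin_diff k h f x\<bar> powr q /
                        norm h powr (real CARD('n) + s * real k * q)) \<partial>lebesgue) (1 / q)"

end

theory Submission
  imports Defs "HOL-Computational_Algebra.Polynomial"
begin

text \<open>
  Let \<open>h \<le> f\<^sup>1\<^sup>-\<^sup>\<theta> g\<^sup>\<theta>\<close>. By the Fatou property, up to constants \<open>f\<close> and \<open>g\<close> may be taken to be step functions
  with values \<open>a\<^sub>i, b\<^sub>i\<close> on common disjoint sets \<open>E\<^sub>i\<close>. On small cubes of side \<open>r\<^sub>i = (\<delta> a\<^sub>i / b\<^sub>i)\<^sup>1\<^sup>/\<^sup>k\<close>,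
  placed far apart, put copies of a fixed bump of height \<open>a\<^sub>i\<close>, with as many cubes of each kind as fit
  into the measure of \<open>E\<^sub>i\<close>. The resulting smooth function is bounded by \<open>a\<^sub>i\<close>, its \<open>k\<close>-th derivatives by
  a multiple of \<open>b\<^sub>i / \<delta>\<close>, while on a fixed proportion of each cube the left-hand side of the inequality
  is at least a multiple of \<open>\<delta>\<^sup>-\<^sup>\<theta> a\<^sub>i\<^sup>1\<^sup>-\<^sup>\<theta> b\<^sub>i\<^sup>\<theta>\<close>. The powers of \<open>\<delta>\<close> cancel, and rearrangement invariance
  transports the estimate back from the cubes to the sets \<open>E\<^sub>i\<close>.
\<close>

section \<open>Smooth cutoff functions on the line\<close>

text \<open>The choice of heights and sides comes from scaling: a bump of height \<open>A\<close> on
  a cube of side \<open>r\<close> has k-th derivatives of size \<open>A / r ^ k\<close>, while on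
  part of the cube its j-th gradient or its difference functional is at least a multiple of
  \<open>A * r powr (- (\<theta> * k))\<close>, with \<theta> = j / k or \<theta> = s. Both
  assertions therefore reduce to one inequality between step functions on cells, isolated in the
  locale \<open>cell_inequality\<close>; only the pointwise lower bound on the left-hand side
  differs. The obstacle is that a side dictated by \<open>a / b\<close> alone may exceed what the
  set \<open>E i\<close> can hold. The parameter \<delta> shrinks all cubes at once and also leaves
  the room around each cube that finite differences need. Since the lower bound holds only on a
  piece of each cube, sets of comparable measure are compared through the triangle inequality. As
  \<open>weak_deriv\<close> is a choice of representative, its uniqueness almost everywhere has to
  be proved. Smooth functions are carried as explicit sequences of derivatives, so that every
  iterated partial derivative of a tensor product keeps the same form.\<close>

definition deriv_seq :: "(nat \<Rightarrow> real \<Rightarrow> real) \<Rightarrow> bool"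
  where "deriv_seq F \<longleftrightarrow> (\<forall>m t. (F m has_real_derivative F (Suc m) t) (at t))"

lemma deriv_seqD: "deriv_seq F \<Longrightarrow> (F m has_real_derivative F (Suc m) t) (at t)"
  by (simp add: deriv_seq_def)

lemma deriv_seq_continuous: "deriv_seq F \<Longrightarrow> continuous_on UNIV (F m)"
  by (meson deriv_seqD DERIV_continuous_on has_field_derivative_at_within)

lemma deriv_seq_affine:
  assumes "deriv_seq F"
  shows "deriv_seq (\<lambda>m t. c ^ m * F m (c * t + d))"
  unfolding deriv_seq_def
proof (intro allI)
  fix m t
  have "((\<lambda>t. F m (c * t + d)) has_real_derivative F (Suc m) (c * t + d) * c) (at t)"
    by (rule DERIV_chain2[OF deriv_seqD[OF assms]]) (auto intro!: derivative_eq_intros)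
  then show "((\<lambda>t. c ^ m * F m (c * t + d)) has_real_derivative c ^ Suc m * F (Suc m) (c * t + d)) (at t)"
    by (auto intro!: derivative_eq_intros)
qed

definition leibniz :: "(nat \<Rightarrow> real \<Rightarrow> real) \<Rightarrow> (nat \<Rightarrow> real \<Rightarrow> real) \<Rightarrow> nat \<Rightarrow> real \<Rightarrow> real"
  where "leibniz F G m t = (\<Sum>i\<le>m. real (m choose i) * F i t * G (m - i) t)"

lemma deriv_seq_leibniz:
  assumes "deriv_seq F" "deriv_seq G"
  shows "deriv_seq (leibniz F G)"
  unfolding deriv_seq_def
proof (intro allI)
  fix m t
  have sumeq: "(\<Sum>i\<le>m. real (m choose i) * (F (Suc i) t * G (m - i) t + F i t * G (Suc (m - i)) t)) =
               (\<Sum>i\<le>Suc m. real (Suc m choose i) * F i t * G (Suc m - i) t)"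
  proof -
    have bb: "real (Suc m choose Suc i) = real (m choose Suc i) + real (m choose i)" for i
      by simp
    have ss: "(\<Sum>i\<le>m. real (m choose i) * (F i t * G (Suc (m - i)) t))
      = F 0 t * G (Suc m) t + (\<Sum>i\<le>m. real (m choose Suc i) * (F (Suc i) t * G (m - i) t))"
    proof -
      \<comment> \<open>The added term \<open>i = Suc m\<close> is zero because
        \<open>m choose Suc m = 0\<close>; after the shift, Pascal's rule merges the two
        sums.\<close>
      have "(\<Sum>i\<le>m. real (m choose i) * (F i t * G (Suc (m - i)) t))
         = (\<Sum>i\<le>Suc m. real (m choose i) * (F i t * G (Suc m - i) t))"
        by (simp add: Suc_diff_le)
      also have "\<dots> = F 0 t * G (Suc m) t + (\<Sum>i\<le>m. real (m choose Suc i) * (F (Suc i) t * G (m - i) t))"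
        by (subst sum.atMost_Suc_shift) simp
      finally show ?thesis .
    qed
    show ?thesis
      unfolding distrib_left sum.distrib ss
      by (subst sum.atMost_Suc_shift, simp only: bb) (simp add: sum.distrib algebra_simps)
  qed
  show "(leibniz F G m has_real_derivative leibniz F G (Suc m) t) (at t)"
    unfolding leibniz_def sumeq[symmetric]
    by (auto intro!: derivative_eq_intros sum.cong deriv_seqD[OF assms(1)] deriv_seqD[OF assms(2)]
          simp: algebra_simps)
qed

text \<open>With \<open>u = 1 / t\<close>, the m-th derivative of exp(-u) in t is
  \<open>P m u * exp (- u)\<close>. Since du/dt is minus the square of u, \<open>P (Suc m)\<close>
  is that square times \<open>P m\<close> minus its derivative.\<close>

fun flat_poly :: "nat \<Rightarrow> real poly" where
  "flat_poly 0 = 1"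
| "flat_poly (Suc m) = [:0, 0, 1:] * (flat_poly m - pderiv (flat_poly m))"

definition flat :: "nat \<Rightarrow> real \<Rightarrow> real"
  where "flat m t = (if t \<le> 0 then 0 else poly (flat_poly m) (1 / t) * exp (- 1 / t))"

text \<open>The power \<open>y ^ k\<close> serves the induction on the polynomial:
  \<open>pCons\<close> splits off a monomial and raises \<open>k\<close> by one. With
  \<open>y = 1 / t\<close> this gives differentiability of \<open>flat\<close> at 0.\<close>

lemma poly_div_exp_tendsto_0: "((\<lambda>y. y ^ k * poly p y / exp y) \<longlongrightarrow> 0) (at_top :: real filter)"
proof (induction p arbitrary: k)
  case (pCons a p)
  have "((\<lambda>y. a * (y ^ k / exp y) + y ^ Suc k * poly p y / exp y) \<longlongrightarrow> a * 0 + 0) at_top"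
    by (intro tendsto_intros tendsto_power_div_exp_0 pCons.IH)
  then show ?case by (simp add: field_simps)
qed simp

lemma deriv_seq_flat: "deriv_seq flat"
  unfolding deriv_seq_def
proof (intro allI)
  fix m and t :: real
  consider "t < 0" | "t = 0" | "t > 0" by linarith
  then show "(flat m has_real_derivative flat (Suc m) t) (at t)"
  proof cases
    case 1
    have "((\<lambda>_. 0) has_real_derivative flat (Suc m) t) (at t)"
      using 1 by (simp add: flat_def)
    then show ?thesis
      by (rule has_field_derivative_transform_within_open[where S="{..<0}"])
         (use 1 in \<open>auto simp: flat_def\<close>)
  next
    case 3
    have "((\<lambda>t. poly (flat_poly m) (1 / t) * exp (- 1 / t)) has_real_derivative
        poly (pderiv (flat_poly m)) (1 / t) * (- 1 / t\<^sup>2) * exp (- 1 / t)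
         + poly (flat_poly m) (1 / t) * (exp (- 1 / t) * (1 / t\<^sup>2))) (at t)"
      using 3 by (auto intro!: derivative_eq_intros DERIV_chain2[OF poly_DERIV]
         simp: power2_eq_square)
    moreover have "poly (pderiv (flat_poly m)) (1 / t) * (- 1 / t\<^sup>2) * exp (- 1 / t)
         + poly (flat_poly m) (1 / t) * (exp (- 1 / t) * (1 / t\<^sup>2)) = flat (Suc m) t"
      using 3 by (simp add: flat_def field_simps power2_eq_square)
    ultimately have "((\<lambda>t. poly (flat_poly m) (1 / t) * exp (- 1 / t)) has_real_derivative flat (Suc m) t) (at t)"
      by simp
    then show ?thesis
      by (rule has_field_derivative_transform_within_open[where S="{0<..}"])
         (use 3 in \<open>auto simp: flat_def\<close>)
  next
    case 2
    have "((\<lambda>h. flat m h / h) \<longlongrightarrow> 0) (at_left 0)"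
      by (rule tendsto_eventually) (auto simp: eventually_at_left_field flat_def intro: exI[of _ "-1"])
    moreover have "((\<lambda>h. flat m h / h) \<longlongrightarrow> 0) (at_right 0)"
    proof -
      \<comment> \<open>Here \<open>y = 1 / h\<close>, and the single power of \<open>y\<close> is
        the division by \<open>h\<close> in the difference quotient.\<close>
      have "((\<lambda>h. (inverse h) ^ 1 * poly (flat_poly m) (inverse h) / exp (inverse h)) \<longlongrightarrow> 0) (at_right (0::real))"
        by (rule filterlim_compose[OF poly_div_exp_tendsto_0 filterlim_inverse_at_top_right])
      then show ?thesis
        by (rule Lim_transform_eventually)
           (auto simp: eventually_at_right_field flat_def exp_minus field_simps intro!: exI[of _ 1])
    qed
    ultimately have "((\<lambda>h. flat m h / h) \<longlongrightarrow> 0) (at 0)"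
      by (simp add: filterlim_at_split)
    then show ?thesis
      using 2 by (simp add: DERIV_def flat_def)
  qed
qed

lemma flat_0: "flat 0 t = (if t \<le> 0 then 0 else exp (- 1 / t))"
  by (simp add: flat_def)

text \<open>The product of \<open>flat 0 (c * (t - a))\<close> and
  \<open>flat 0 (c * (b - t))\<close> together with all its derivatives. For \<open>c > 0\<close> it
  is positive exactly on the open interval from \<open>a\<close> to \<open>b\<close>. Large
  \<open>c\<close> makes it steep, as needed to approximate indicators; \<open>c = 1\<close> on the
  unit interval is the profile of the bump.\<close>

definition cutoff :: "real \<Rightarrow> real \<Rightarrow> real \<Rightarrow> nat \<Rightarrow> real \<Rightarrow> real"
  where "cutoff c a b = leibniz (\<lambda>m t. c ^ m * flat m (c * t + - c * a))
           (\<lambda>m t. (- c) ^ m * flat m ((- c) * t + c * b))"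

lemma deriv_seq_cutoff: "deriv_seq (cutoff c a b)"
  unfolding cutoff_def by (intro deriv_seq_leibniz deriv_seq_affine deriv_seq_flat)

lemma cutoff_0: "cutoff c a b 0 t = flat 0 (c * (t - a)) * flat 0 (c * (b - t))"
  by (simp add: cutoff_def leibniz_def algebra_simps)

text \<open>At such a point one of the two factors is evaluated at an argument \<le> 0, where
  \<open>flat\<close> vanishes with all its derivatives, so every term of the Leibniz sum is
  zero.\<close>

lemma cutoff_outside:
  assumes "c > 0" "t \<notin> {a<..<b}"
  shows "cutoff c a b m t = 0"
proof -
  have "c * t + - c * a \<le> 0 \<or> - c * t + c * b \<le> 0"
    using assms by (auto simp: not_less)
  then have "(\<forall>i. flat i (c * t + - c * a) = 0) \<or> (\<forall>i. flat i (- c * t + c * b) = 0)"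
    unfolding flat_def by auto
  then show ?thesis
    unfolding cutoff_def leibniz_def by (elim disjE) (simp_all del: mult_minus_left)
qed

lemma cutoff_0_bounds: "0 \<le> cutoff c a b 0 t \<and> cutoff c a b 0 t \<le> 1"
  by (auto simp: cutoff_0 flat_0 intro!: mult_le_one)

text \<open>Source of the test functions that approximate indicators of boxes in the uniqueness
  proof for weak derivatives.\<close>

lemma cutoff_0_tendsto:
  "(\<lambda>m. cutoff (real (Suc m)) a b 0 t) \<longlonglongrightarrow> indicator {a<..<b} t"
proof (cases "t \<in> {a<..<b}")
  case True
  have *: "(\<lambda>m. exp (- 1 / (real (Suc m) * u))) \<longlonglongrightarrow> 1" if "u > 0" for u
  proof -
    have "(\<lambda>m. exp ((- 1 / u) * inverse (real (Suc m)))) \<longlonglongrightarrow> exp ((- 1 / u) * 0)"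
      by (intro tendsto_intros LIMSEQ_inverse_real_of_nat)
    then show ?thesis using that by (simp add: field_simps)
  qed
  have "(\<lambda>m. exp (- 1 / (real (Suc m) * (t - a))) * exp (- 1 / (real (Suc m) * (b - t)))) \<longlonglongrightarrow> 1 * 1"
    by (intro tendsto_mult *) (use True in auto)
  moreover have "cutoff (real (Suc m)) a b 0 t
     = exp (- 1 / (real (Suc m) * (t - a))) * exp (- 1 / (real (Suc m) * (b - t)))" for m
  proof -
    have "\<not> real (Suc m) * (t - a) \<le> 0" "\<not> real (Suc m) * (b - t) \<le> 0"
      using True by (simp_all add: not_le)
    then show ?thesis by (simp add: cutoff_0 flat_0)
  qed
  ultimately show ?thesis using True by simp
next
  case False
  then show ?thesis by (simp add: cutoff_outside)
qed

text \<open>If the next derivative vanished identically, the current one would be constant, hence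
  equal to its value 0 at the point 2. The lower bound on the j-th gradient rests on this.\<close>

lemma cutoff_deriv_nonzero: "\<exists>t. cutoff 1 0 1 m t \<noteq> 0"
proof (induction m)
  case 0
  show ?case by (intro exI[of _ "1/2"]) (simp add: cutoff_0 flat_0)
next
  case (Suc m)
  show ?case
  proof (rule ccontr)
    assume "\<nexists>t. cutoff 1 0 1 (Suc m) t \<noteq> 0"
    then have "(cutoff 1 0 1 m has_real_derivative 0) (at t)" for t
      using deriv_seqD[OF deriv_seq_cutoff, of 1 0 1 m t] by simp
    then have "cutoff 1 0 1 m t = cutoff 1 0 1 m 2" for t
      using DERIV_isconst_all by blast
    moreover have "cutoff 1 0 1 m 2 = 0" by (simp add: cutoff_outside)
    ultimately show False using Suc by auto
  qed
qed

lemma cutoff_bounded: obtains K where "K \<ge> 1" "\<And>m t. m \<le> k \<Longrightarrow> \<bar>cutoff 1 0 1 m t\<bar> \<le> K"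
proof -
  have "\<exists>K. \<forall>t. \<bar>cutoff 1 0 1 m t\<bar> \<le> K" for m
  proof -
    have "compact (cutoff 1 0 1 m ` {0..1})"
      by (intro compact_continuous_image continuous_on_subset[OF deriv_seq_continuous[OF deriv_seq_cutoff]]) auto
    then have "bounded (cutoff 1 0 1 m ` {0..1})" by (rule compact_imp_bounded)
    then obtain K where "\<forall>x\<in>cutoff 1 0 1 m ` {0..1}. \<bar>x\<bar> \<le> K" unfolding bounded_real ..
    then have K: "\<bar>cutoff 1 0 1 m t\<bar> \<le> K" if "t \<in> {0..1}" for t
      using that by (simp only: ball_simps)
    have "\<bar>cutoff 1 0 1 m t\<bar> \<le> max K 0" for t
      using K[of t] cutoff_outside[of 1 t 0 1 m] by (cases "t \<in> {0..1}") auto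
    then show ?thesis by blast
  qed
  then obtain K where K: "\<And>m t. \<bar>cutoff 1 0 1 m t\<bar> \<le> K m" by metis
  show thesis
  proof
    fix m t assume "m \<le> k"
    then have "K m \<le> Max (insert 1 (K ` {..k}))" by (intro Max_ge) auto
    with K[of m t] show "\<bar>cutoff 1 0 1 m t\<bar> \<le> Max (insert 1 (K ` {..k}))" by linarith
  qed auto
qed

section \<open>Tensor products and integration by parts\<close>

text \<open>The exponent \<open>\<mu> i\<close> counts the differentiations in coordinate
  \<open>i\<close>. For derivative sequences \<open>F i\<close>, \<open>tens F \<mu>\<close> is thus
  a mixed partial derivative of \<open>tens F (\<lambda>_. 0)\<close>, and differentiating only
  changes \<mu>.\<close>

definition tens :: "('n::finite \<Rightarrow> nat \<Rightarrow> real \<Rightarrow> real) \<Rightarrow> ('n \<Rightarrow> nat) \<Rightarrow> real^'n \<Rightarrow> real"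
  where "tens F \<mu> x = (\<Prod>i\<in>UNIV. F i (\<mu> i) (x $ i))"

lemma tens_has_derivative:
  fixes F :: "'n::finite \<Rightarrow> nat \<Rightarrow> real \<Rightarrow> real"
  assumes "\<And>i. deriv_seq (F i)"
  shows "(tens F \<mu> has_derivative (\<lambda>v. \<Sum>i\<in>UNIV. v $ i * tens F (\<mu>(i := Suc (\<mu> i))) x)) (at x)"
proof -
  have "((\<lambda>x. F i (\<mu> i) (x $ i)) has_derivative (\<lambda>v. F i (Suc (\<mu> i)) (x $ i) * v $ i)) (at x)" for i
    using has_derivative_compose[OF bounded_linear.has_derivative[OF bounded_linear_vec_nth[of i] has_derivative_ident]
        deriv_seqD[OF assms[of i], of "\<mu> i", unfolded has_field_derivative_def]]
    by simp
  then have "((\<lambda>x. \<Prod>i\<in>UNIV. F i (\<mu> i) (x $ i)) has_derivative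
      (\<lambda>v. \<Sum>i\<in>UNIV. (F i (Suc (\<mu> i)) (x $ i) * v $ i) * (\<Prod>j\<in>UNIV - {i}. F j (\<mu> j) (x $ j)))) (at x)"
    by (rule has_derivative_prod)
  moreover have "(F i (Suc (\<mu> i)) (x $ i) * v $ i) * (\<Prod>j\<in>UNIV - {i}. F j (\<mu> j) (x $ j))
      = v $ i * tens F (\<mu>(i := Suc (\<mu> i))) x" for i and v :: "real^'n"
  proof -
    have "tens F (\<mu>(i := Suc (\<mu> i))) x
        = F i (Suc (\<mu> i)) (x $ i) * (\<Prod>j\<in>UNIV - {i}. F j ((\<mu>(i := Suc (\<mu> i))) j) (x $ j))"
      unfolding tens_def by (subst prod.remove[of UNIV i]) auto
    also have "(\<Prod>j\<in>UNIV - {i}. F j ((\<mu>(i := Suc (\<mu> i))) j) (x $ j)) = (\<Prod>j\<in>UNIV - {i}. F j (\<mu> j) (x $ j))"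
      by (rule prod.cong) auto
    finally show ?thesis by (simp del: fun_upd_apply)
  qed
  ultimately show ?thesis unfolding tens_def[abs_def] by (simp del: fun_upd_apply)
qed

lemma tens_differentiable: "(\<And>i. deriv_seq (F i)) \<Longrightarrow> tens F \<mu> differentiable (at x)"
  using tens_has_derivative differentiable_def by blast

lemma tens_continuous: "(\<And>i. deriv_seq (F i)) \<Longrightarrow> continuous_on S (tens F \<mu>)"
  by (simp add: differentiable_imp_continuous_within tens_differentiable continuous_at_imp_continuous_on)

lemma partial_deriv_eq: "(f has_derivative f') (at x) \<Longrightarrow> partial_deriv i f x = f' (axis i 1)"
  unfolding partial_deriv_def by (metis frechet_derivative_at)

lemma partial_deriv_tens:
  fixes F :: "'n::finite \<Rightarrow> nat \<Rightarrow> real \<Rightarrow> real"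
  assumes "\<And>i. deriv_seq (F i)"
  shows "partial_deriv i (tens F \<mu>) = tens F (\<mu>(i := Suc (\<mu> i)))"
proof
  fix x :: "real^'n"
  have "partial_deriv i (tens F \<mu>) x = (\<Sum>j\<in>UNIV. axis i 1 $ j * tens F (\<mu>(j := Suc (\<mu> j))) x)"
    by (rule partial_deriv_eq[OF tens_has_derivative[OF assms]])
  also have "\<dots> = (\<Sum>j\<in>UNIV. if i = j then tens F (\<mu>(j := Suc (\<mu> j))) x else 0)"
    by (rule sum.cong) (auto simp: axis_def)
  finally show "partial_deriv i (tens F \<mu>) x = tens F (\<mu>(i := Suc (\<mu> i))) x"
    by simp
qed

lemma foldr_partial_deriv_tens:
  fixes F :: "'n::finite \<Rightarrow> nat \<Rightarrow> real \<Rightarrow> real"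
  assumes "\<And>i. deriv_seq (F i)"
  shows "\<exists>\<nu>. foldr partial_deriv is (tens F \<mu>) = tens F \<nu>"
proof (induction "is")
  case (Cons i "is")
  then obtain \<nu> where "foldr partial_deriv is (tens F \<mu>) = tens F \<nu>" by blast
  then show ?case by (auto simp: partial_deriv_tens[OF assms])
qed auto

lemma test_function_tens:
  fixes F :: "'n::finite \<Rightarrow> nat \<Rightarrow> real \<Rightarrow> real"
  assumes "\<And>i. deriv_seq (F i)" and "\<And>i t. t \<notin> {a $ i<..<b $ i} \<Longrightarrow> F i (\<mu> i) t = 0"
  shows "test_function (tens F \<mu>)"
  unfolding test_function_def
proof (intro conjI allI)
  fix "is" :: "'n list"
  obtain \<nu> where "foldr partial_deriv is (tens F \<mu>) = tens F \<nu>"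
    using foldr_partial_deriv_tens[of F "is" \<mu>] assms(1) by blast
  then show "foldr partial_deriv is (tens F \<mu>) differentiable_on UNIV"
    by (simp add: differentiable_on_def tens_differentiable[OF assms(1)])
next
  have "tens F \<mu> x = 0" if "x \<notin> cbox a b" for x
  proof -
    from that have "\<exists>i. x $ i \<notin> {a $ i..b $ i}" by (auto simp: mem_box_cart)
    then obtain i where "x $ i \<notin> {a $ i..b $ i}" ..
    then have "F i (\<mu> i) (x $ i) = 0" by (intro assms(2)) auto
    then show ?thesis unfolding tens_def by (intro prod_zero) auto
  qed
  then have "{x. tens F \<mu> x \<noteq> 0} \<subseteq> cbox a b" by auto
  then show "compact (closure {x. tens F \<mu> x \<noteq> 0})"
    using bounded_subset[OF bounded_cbox] by (simp add: compact_closure)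
qed

section \<open>Test functions: derivatives, supports, integrability\<close>

lemma test_function_partial_deriv:
  assumes "test_function \<psi>"
  shows "test_function (partial_deriv i \<psi>)"
  unfolding test_function_def
proof (intro conjI allI)
  fix "is"
  show "foldr partial_deriv is (partial_deriv i \<psi>) differentiable_on UNIV"
    using assms[unfolded test_function_def, THEN conjunct1, THEN spec, of "is @ [i]"] by simp
next
  let ?S = "closure {x. \<psi> x \<noteq> 0}"
  have "partial_deriv i \<psi> x = 0" if "x \<notin> ?S" for x
  proof -
    have "((\<lambda>_. 0) has_derivative (\<lambda>_. 0)) (at x)" by simp
    then have "(\<psi> has_derivative (\<lambda>_. 0)) (at x)"
      by (rule has_derivative_transform_within_open[where s="- closure {x. \<psi> x \<noteq> 0}"])
         (use that closure_subset[of "{x. \<psi> x \<noteq> 0}"] in auto)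
    then show ?thesis by (simp add: partial_deriv_eq)
  qed
  then have "closure {x. partial_deriv i \<psi> x \<noteq> 0} \<subseteq> closure {x. \<psi> x \<noteq> 0}"
    by (intro closure_minimal) auto
  then show "compact (closure {x. partial_deriv i \<psi> x \<noteq> 0})"
    using assms unfolding test_function_def by (meson bounded_subset closed_closure compact_eq_bounded_closed)
qed

lemma test_function_differentiable: "test_function \<psi> \<Longrightarrow> \<psi> differentiable (at x)"
  unfolding test_function_def differentiable_on_def by (drule conjunct1, drule spec[of _ "[]"]) simp

lemma test_function_continuous: "test_function \<psi> \<Longrightarrow> continuous_on S \<psi>"
  by (simp add: differentiable_imp_continuous_within test_function_differentiable continuous_at_imp_continuous_on)

lemma test_function_funpow: "test_function \<psi> \<Longrightarrow> test_function ((partial_deriv i ^^ m) \<psi>)"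
  by (induction m) (auto intro: test_function_partial_deriv)

lemma test_function_foldr:
  "test_function \<psi> \<Longrightarrow> test_function (foldr (\<lambda>i. partial_deriv i ^^ m i) is \<psi>)"
  by (induction "is") (auto intro: test_function_funpow)

lemma test_function_support:
  assumes "test_function \<psi>"
  obtains R where "R > 0" "\<And>x. norm x > R \<Longrightarrow> \<psi> x = 0"
proof -
  have "bounded {x. \<psi> x \<noteq> 0}"
    using assms unfolding test_function_def by (meson bounded_subset closure_subset compact_imp_bounded)
  then obtain R where "R > 0" "\<And>x. \<psi> x \<noteq> 0 \<Longrightarrow> norm x \<le> R"
    unfolding bounded_pos by auto
  then show thesis using that by force
qed

lemma bounded_support_bound:
  fixes w :: "real^'n \<Rightarrow> real"
  assumes "continuous_on UNIV w" "\<And>x. norm x > R \<Longrightarrow> w x = 0"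
  obtains K where "K > 0" "\<And>x. \<bar>w x\<bar> \<le> K"
proof -
  have "bounded (w ` cball 0 R)"
    by (intro compact_imp_bounded compact_continuous_image continuous_on_subset[OF assms(1)]) auto
  then obtain K where K: "K > 0" "\<And>x. x \<in> cball 0 R \<Longrightarrow> \<bar>w x\<bar> \<le> K"
    unfolding bounded_pos by auto
  have "\<bar>w x\<bar> \<le> K" for x
    using K assms(2)[of x] by (cases "norm x > R") auto
  with K(1) show thesis using that by blast
qed

lemma borel_measurable_continuous_lebesgue:
  "continuous_on UNIV (w :: real^'n \<Rightarrow> real) \<Longrightarrow> w \<in> borel_measurable lebesgue"
  by (simp add: borel_measurable_continuous_onI measurable_completion)

lemma integrable_bounded_support:
  fixes w :: "real^'n \<Rightarrow> real"
  assumes [measurable]: "w \<in> borel_measurable lebesgue"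
    and "\<And>x. norm x > R \<Longrightarrow> w x = 0" "\<And>x. \<bar>w x\<bar> \<le> K"
  shows "integrable lebesgue w"
proof (rule Bochner_Integration.integrable_bound)
  show "integrable lebesgue (\<lambda>x. K * indicator (cball 0 R) x :: real)"
    using emeasure_lborel_cball_finite by (intro integrable_mult_right integrable_real_indicator) auto
  show "AE x in lebesgue. norm (w x) \<le> norm (K * indicator (cball 0 R) x :: real)"
  proof (rule AE_I2)
    fix x show "norm (w x) \<le> norm (K * indicator (cball 0 R) x :: real)"
      using assms(2)[of x] assms(3)[of x] by (cases "norm x > R") auto
  qed
qed simp

lemma has_real_derivative_line:
  fixes w :: "real^'n \<Rightarrow> real"
  assumes "\<And>x. w differentiable (at x)"
  shows "((\<lambda>t. w (x + t *\<^sub>R axis i 1)) has_real_derivative partial_deriv i w (x + t *\<^sub>R axis i 1)) (at t)"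
proof -
  let ?x = "x + t *\<^sub>R axis i 1"
  let ?D = "frechet_derivative w (at ?x)"
  have D: "(w has_derivative ?D) (at ?x)"
    using assms by (simp add: frechet_derivative_works)
  have "((\<lambda>t. w (x + t *\<^sub>R axis i 1)) has_derivative (\<lambda>s. ?D (s *\<^sub>R axis i 1))) (at t)"
    by (rule has_derivative_compose[where f = "\<lambda>t. x + t *\<^sub>R axis i 1", OF _ D]) (auto intro!: derivative_eq_intros)
  moreover have "?D (s *\<^sub>R axis i 1) = partial_deriv i w ?x * s" for s
    using linear_cmul[OF has_derivative_linear[OF D], of s] by (simp add: partial_deriv_def)
  ultimately show ?thesis by (simp add: has_field_derivative_def)
qed

lemma integral_translate:
  fixes w :: "real^'n \<Rightarrow> real"
  assumes "continuous_on UNIV w"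
  shows "(LINT x|lebesgue. w (x + v)) = (LINT x|lebesgue. w x)"
proof -
  have [measurable]: "w \<in> borel_measurable borel"
    using assms by (rule borel_measurable_continuous_onI)
  have "(LINT x|lebesgue. w x) = (LINT x|distr lborel borel ((+) v). w x)"
    by (simp add: integral_completion lborel_distr_plus)
  also have "\<dots> = (LINT x|lborel. w (v + x))"
    by (rule integral_distr) auto
  finally show ?thesis by (simp add: integral_completion add.commute)
qed

text \<open>
  Integrating the difference quotient gives zero by translation invariance; this avoids Fubini.
\<close>

lemma integral_partial_deriv_eq_0:
  fixes w :: "real^'n \<Rightarrow> real"
  assumes diff: "\<And>x. w differentiable (at x)" and cont: "continuous_on UNIV (partial_deriv i w)"
    and supp: "\<And>x. norm x > R \<Longrightarrow> w x = 0" "\<And>x. norm x > R \<Longrightarrow> partial_deriv i w x = 0"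
  shows "(LINT x|lebesgue. partial_deriv i w x) = 0"
proof -
  obtain K where K: "K > 0" "\<And>x. \<bar>partial_deriv i w x\<bar> \<le> K"
    using bounded_support_bound[OF cont supp(2)] by blast
  have wc: "continuous_on UNIV w"
    by (simp add: diff differentiable_imp_continuous_within continuous_at_imp_continuous_on)
  obtain K' where K': "\<And>x. \<bar>w x\<bar> \<le> K'"
    using bounded_support_bound[OF wc supp(1)] by blast
  have [measurable]: "w \<in> borel_measurable lebesgue"
    by (rule borel_measurable_continuous_lebesgue[OF wc])
  define h where "h m = inverse (real (Suc m))" for m
  have h: "0 < h m" "h m \<le> 1" for m by (auto simp: h_def field_simps)
  define s where "s m x = (w (x + h m *\<^sub>R axis i 1) - w x) / h m" for m x
  have wt: "continuous_on UNIV (\<lambda>x. w (x + v))" for v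
    by (rule continuous_on_compose2[OF wc]) (auto intro!: continuous_intros)
  have wi: "integrable lebesgue w" by (rule integrable_bounded_support) (use supp K' in auto)
  have wti: "integrable lebesgue (\<lambda>x. w (x + v))" for v
  proof (rule integrable_bounded_support)
    show "w (x + v) = 0" if "norm x > R + norm v" for x
      using that supp(1)[of "x + v"] norm_diff_ineq[of x v] by linarith
  qed (use K' borel_measurable_continuous_lebesgue[OF wt] in auto)
  have int0: "(LINT x|lebesgue. s m x) = 0" for m
    unfolding s_def by (simp add: integral_translate[OF wc] wi wti)
  have "(\<lambda>m. LINT x|lebesgue. s m x) \<longlonglongrightarrow> (LINT x|lebesgue. partial_deriv i w x)"
  \<comment> \<open>The steps \<open>h m\<close> are at most 1, so the quotients vanish outside the
    ball of radius \<open>R + 1\<close>; inside, the mean value theorem bounds them by the bound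
    \<open>K\<close> of the derivative.\<close>
  proof (rule integral_dominated_convergence[where w = "\<lambda>x. K * indicator (cball 0 (R + 1)) x"])
    show "partial_deriv i w \<in> borel_measurable lebesgue"
      by (rule borel_measurable_continuous_lebesgue[OF cont])
    show "s m \<in> borel_measurable lebesgue" for m
      unfolding s_def[abs_def] using borel_measurable_continuous_lebesgue[OF wt] by measurable
    show "integrable lebesgue (\<lambda>x. K * indicator (cball 0 (R + 1)) x :: real)"
      using emeasure_lborel_cball_finite by (intro integrable_mult_right integrable_real_indicator) auto
    show "AE x in lebesgue. (\<lambda>m. s m x) \<longlonglongrightarrow> partial_deriv i w x"
    proof (rule AE_I2)
      fix x
      have "((\<lambda>t. (w (x + t *\<^sub>R axis i 1) - w x) / t) \<longlongrightarrow> partial_deriv i w x) (at 0)"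
        using has_real_derivative_line[OF diff, of x i 0] by (simp add: DERIV_def)
      moreover have "filterlim h (at 0) sequentially"
        unfolding filterlim_at h_def[abs_def] using LIMSEQ_inverse_real_of_nat by auto
      ultimately show "(\<lambda>m. s m x) \<longlonglongrightarrow> partial_deriv i w x"
        unfolding s_def by (rule filterlim_compose)
    qed
    show "AE x in lebesgue. norm (s m x) \<le> K * indicator (cball 0 (R + 1)) x" for m
    proof (rule AE_I2)
      fix x :: "real^'n"
      show "norm (s m x) \<le> K * indicator (cball 0 (R + 1)) x"
      proof (cases "norm x > R + 1")
        case True
        moreover have "norm (h m *\<^sub>R axis i 1 :: real^'n) \<le> 1" using h[of m] by simp
        then have "norm (x + h m *\<^sub>R axis i 1) > R"
          using norm_diff_ineq[of x "h m *\<^sub>R axis i 1"] True by linarith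
        ultimately show ?thesis using supp(1) by (simp add: s_def)
      next
        case False
        obtain z where "w (x + h m *\<^sub>R axis i 1) - w (x + 0 *\<^sub>R axis i 1)
            = (h m - 0) * partial_deriv i w (x + z *\<^sub>R axis i 1)"
          using MVT2[OF h(1)[of m], of "\<lambda>t. w (x + t *\<^sub>R axis i 1)" "\<lambda>t. partial_deriv i w (x + t *\<^sub>R axis i 1)"]
            has_real_derivative_line[OF diff] by auto
        then have "s m x = partial_deriv i w (x + z *\<^sub>R axis i 1)"
          using h(1)[of m] by (simp add: s_def)
        then show ?thesis using False K by simp
      qed
    qed
  qed
  then show ?thesis using int0 LIMSEQ_unique by (simp add: LIMSEQ_const_iff)
qed

lemma partial_deriv_mult:
  assumes "u differentiable (at x)" "v differentiable (at x)"
  shows "partial_deriv i (\<lambda>x. u x * v x) x = partial_deriv i u x * v x + u x * partial_deriv i v x"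
proof -
  have "((\<lambda>x. u x * v x) has_derivative
     (\<lambda>h. u x * frechet_derivative v (at x) h + frechet_derivative u (at x) h * v x)) (at x)"
    using assms by (intro has_derivative_mult) (auto simp: frechet_derivative_works)
  then have "partial_deriv i (\<lambda>x. u x * v x) x
     = u x * frechet_derivative v (at x) (axis i 1) + frechet_derivative u (at x) (axis i 1) * v x"
    by (rule partial_deriv_eq)
  then show ?thesis by (simp add: partial_deriv_def)
qed

lemma integrable_continuous_times_test:
  fixes u \<psi> :: "real^'n \<Rightarrow> real"
  assumes "continuous_on UNIV u" "test_function \<psi>"
  shows "integrable lebesgue (\<lambda>x. u x * \<psi> x)"
proof -
  obtain R where R: "\<And>x. norm x > R \<Longrightarrow> \<psi> x = 0" using test_function_support[OF assms(2)] by blast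
  have c: "continuous_on UNIV (\<lambda>x. u x * \<psi> x)"
    using assms by (intro continuous_intros) (auto simp: test_function_continuous)
  obtain K where "\<And>x. \<bar>u x * \<psi> x\<bar> \<le> K"
  proof (rule bounded_support_bound[OF c, of R])
    show "u x * \<psi> x = 0" if "norm x > R" for x using R[OF that] by simp
  qed blast
  then show ?thesis
    using R by (intro integrable_bounded_support[of _ R] borel_measurable_continuous_lebesgue[OF c]) auto
qed

text \<open>By the product rule the two integrals add up to the integral of a partial derivative of
  \<open>tens F \<mu> x * \<psi> x\<close>. This product has compact support because \<psi> has, so
  the integral is zero.\<close>

lemma integration_by_parts_tens:
  fixes F :: "'n::finite \<Rightarrow> nat \<Rightarrow> real \<Rightarrow> real"
  assumes F: "\<And>i. deriv_seq (F i)" and \<psi>: "test_function \<psi>"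
  shows "(LINT x|lebesgue. tens F \<mu> x * partial_deriv i \<psi> x)
       = - (LINT x|lebesgue. tens F (\<mu>(i := Suc (\<mu> i))) x * \<psi> x)"
proof -
  let ?w = "\<lambda>x. tens F \<mu> x * \<psi> x"
  have pd: "partial_deriv i ?w = (\<lambda>x. tens F (\<mu>(i := Suc (\<mu> i))) x * \<psi> x + tens F \<mu> x * partial_deriv i \<psi> x)"
    by (rule ext) (simp add: partial_deriv_mult tens_differentiable[OF F] test_function_differentiable[OF \<psi>]
        partial_deriv_tens[OF F])
  obtain R where R: "\<And>x. norm x > R \<Longrightarrow> \<psi> x = 0" using test_function_support[OF \<psi>] by blast
  obtain R' where R': "\<And>x. norm x > R' \<Longrightarrow> partial_deriv i \<psi> x = 0"
    using test_function_support[OF test_function_partial_deriv[OF \<psi>]] by blast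
  have "(LINT x|lebesgue. partial_deriv i ?w x) = 0"
  proof (rule integral_partial_deriv_eq_0)
    show "?w differentiable (at x)" for x
      by (intro derivative_intros tens_differentiable[OF F] test_function_differentiable[OF \<psi>])
    show "continuous_on UNIV (partial_deriv i ?w)"
      unfolding pd by (intro continuous_intros tens_continuous[OF F] test_function_continuous[OF \<psi>]
          test_function_continuous[OF test_function_partial_deriv[OF \<psi>]])
    show "?w x = 0" if "norm x > max R R'" for x using that R by simp
    show "partial_deriv i ?w x = 0" if "norm x > max R R'" for x using that R R' by (simp add: pd)
  qed
  then show ?thesis
    unfolding pd
    by (subst (asm) Bochner_Integration.integral_add)
       (auto intro!: integrable_continuous_times_test tens_continuous[OF F] \<psi> test_function_partial_deriv)
qed

lemma integration_by_parts_tens_funpow: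
  fixes F :: "'n::finite \<Rightarrow> nat \<Rightarrow> real \<Rightarrow> real"
  assumes F: "\<And>i. deriv_seq (F i)" and \<psi>: "test_function \<psi>"
  shows "(LINT x|lebesgue. tens F \<mu> x * (partial_deriv i ^^ m) \<psi> x)
       = (-1) ^ m * (LINT x|lebesgue. tens F (\<mu>(i := \<mu> i + m)) x * \<psi> x)"
proof (induction m arbitrary: \<mu>)
  case (Suc m)
  have "(\<mu>(i := Suc (\<mu> i)))(i := (\<mu>(i := Suc (\<mu> i))) i + m) = \<mu>(i := \<mu> i + Suc m)" by simp
  then show ?case
    using Suc[of "\<mu>(i := Suc (\<mu> i))"]
    by (simp add: integration_by_parts_tens[OF F test_function_funpow[OF \<psi>]] del: fun_upd_apply)
qed simp

text \<open>Distinctness makes the exponents add up correctly: the coordinate treated at the head of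
  the list does not occur again in its tail.\<close>

lemma integration_by_parts_tens_foldr:
  fixes F :: "'n::finite \<Rightarrow> nat \<Rightarrow> real \<Rightarrow> real"
  assumes F: "\<And>i. deriv_seq (F i)" and \<psi>: "test_function \<psi>" and "distinct is"
  shows "(LINT x|lebesgue. tens F \<mu> x * foldr (\<lambda>i. partial_deriv i ^^ m i) is \<psi> x)
       = (-1) ^ (\<Sum>i\<in>set is. m i) *
         (LINT x|lebesgue. tens F (\<lambda>i. \<mu> i + (if i \<in> set is then m i else 0)) x * \<psi> x)"
  using \<open>distinct is\<close>
proof (induction "is" arbitrary: \<mu>)
  case (Cons i "is")
  have *: "(\<lambda>j. (\<mu>(i := \<mu> i + m i)) j + (if j \<in> set is then m j else 0))
      = (\<lambda>j. \<mu> j + (if j \<in> set (i # is) then m j else 0))"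
    using Cons.prems by auto
  show ?case
    using Cons.prems
    by (simp add: integration_by_parts_tens_funpow[OF F test_function_foldr[OF \<psi>]] Cons.IH
        *[unfolded fun_upd_def] fun_upd_def power_add mult.assoc)
qed simp

lemma coord_list: "distinct (coord_list :: 'n::finite list)" "set (coord_list :: 'n list) = UNIV"
proof -
  obtain xs :: "'n list" where "distinct xs \<and> set xs = UNIV"
    using finite_distinct_list[of "UNIV :: 'n set"] by auto
  then have "distinct (coord_list :: 'n list) \<and> set (coord_list :: 'n list) = UNIV"
    unfolding coord_list_def by (rule someI)
  then show "distinct (coord_list :: 'n list)" "set (coord_list :: 'n list) = UNIV" by auto
qed

lemma integration_by_parts_multi:
  fixes F :: "'n::finite \<Rightarrow> nat \<Rightarrow> real \<Rightarrow> real"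
  assumes F: "\<And>i. deriv_seq (F i)" and \<psi>: "test_function \<psi>"
  shows "(LINT x|lebesgue. tens F \<mu> x * multi_deriv \<alpha> \<psi> x)
       = (-1) ^ mi_order \<alpha> * (LINT x|lebesgue. tens F (\<lambda>i. \<mu> i + \<alpha> $ i) x * \<psi> x)"
  using integration_by_parts_tens_foldr[where 'n = 'n and \<mu> = \<mu> and m = "\<lambda>i. \<alpha> $ i", OF F \<psi> coord_list(1)]
  by (simp add: multi_deriv_def mi_order_def coord_list(2))

lemma locally_integrable_continuous:
  fixes u :: "real^'n \<Rightarrow> real"
  assumes "continuous_on UNIV u"
  shows "locally_integrable u"
  unfolding locally_integrable_def
proof (intro allI impI)
  fix K :: "(real^'n) set" assume K: "compact K"
  have "integrable lborel (\<lambda>x. indicator K x *\<^sub>R u x)"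
    by (rule borel_integrable_compact[OF K continuous_on_subset[OF assms]]) simp
  then show "u absolutely_integrable_on K"
    unfolding set_integrable_def by (subst integrable_completion) auto
qed

lemma test_function_multi_deriv: "test_function \<psi> \<Longrightarrow> test_function (multi_deriv \<alpha> \<psi>)"
  unfolding multi_deriv_def by (rule test_function_foldr)

lemma has_weak_deriv_sum_tens:
  fixes F :: "'l \<Rightarrow> 'n::finite \<Rightarrow> nat \<Rightarrow> real \<Rightarrow> real"
  assumes F: "\<And>l i. deriv_seq (F l i)" and "finite L"
  shows "has_weak_deriv \<alpha> (\<lambda>x. \<Sum>l\<in>L. A l * tens (F l) (\<lambda>_. 0) x)
           (\<lambda>x. \<Sum>l\<in>L. A l * tens (F l) (\<lambda>i. \<alpha> $ i) x)"
  unfolding has_weak_deriv_def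
proof (intro conjI allI impI)
  have c: "continuous_on UNIV (\<lambda>x. \<Sum>l\<in>L. A l * tens (F l) \<mu> x)" for \<mu>
    by (intro continuous_intros tens_continuous F)
  from c show "locally_integrable (\<lambda>x. \<Sum>l\<in>L. A l * tens (F l) (\<lambda>_. 0) x)"
    "locally_integrable (\<lambda>x. \<Sum>l\<in>L. A l * tens (F l) (\<lambda>i. \<alpha> $ i) x)"
    by (auto intro: locally_integrable_continuous)
  fix \<psi> :: "real^'n \<Rightarrow> real" assume \<psi>: "test_function \<psi>"
  have i: "integrable lebesgue (\<lambda>x. tens (F l) \<mu> x * \<psi>' x)" if "test_function \<psi>'" for l \<mu> \<psi>'
    by (intro integrable_continuous_times_test tens_continuous F that)
  have "(LINT x|lebesgue. (\<Sum>l\<in>L. A l * tens (F l) (\<lambda>_. 0) x) * multi_deriv \<alpha> \<psi> x)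
      = (\<Sum>l\<in>L. A l * (LINT x|lebesgue. tens (F l) (\<lambda>_. 0) x * multi_deriv \<alpha> \<psi> x))"
    by (simp add: sum_distrib_right mult.assoc i[OF test_function_multi_deriv[OF \<psi>]])
  also have "\<dots> = (-1) ^ mi_order \<alpha> * (\<Sum>l\<in>L. A l * (LINT x|lebesgue. tens (F l) (\<lambda>i. \<alpha> $ i) x * \<psi> x))"
    by (subst integration_by_parts_multi[OF F \<psi>]) (simp add: sum_distrib_left mult.left_commute)
  also have "(\<Sum>l\<in>L. A l * (LINT x|lebesgue. tens (F l) (\<lambda>i. \<alpha> $ i) x * \<psi> x))
      = (LINT x|lebesgue. (\<Sum>l\<in>L. A l * tens (F l) (\<lambda>i. \<alpha> $ i) x) * \<psi> x)"
    by (simp add: sum_distrib_right mult.assoc i[OF \<psi>])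
  finally show "(LINT x|lebesgue. (\<Sum>l\<in>L. A l * tens (F l) (\<lambda>_. 0) x) * multi_deriv \<alpha> \<psi> x)
      = (-1) ^ mi_order \<alpha> * (LINT x|lebesgue. (\<Sum>l\<in>L. A l * tens (F l) (\<lambda>i. \<alpha> $ i) x) * \<psi> x)" .
qed

section \<open>Uniqueness of weak derivatives\<close>

text \<open>Lebesgue differentiation: at almost every \<open>x\<close> the value \<open>d x\<close>
  is the limit of the averages of \<open>d\<close> over shrinking cubes with corner
  \<open>x\<close>, and all these averages are zero.\<close>

lemma AE_eq_0_if_integrals_eq_0:
  fixes d :: "real^'n \<Rightarrow> real"
  assumes "\<And>a b. d integrable_on cbox a b" "\<And>a b. integral (cbox a b) d = 0"
  shows "AE x in lebesgue. d x = 0"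
proof -
  obtain N where N: "negligible N"
    "\<And>x e. x \<notin> N \<Longrightarrow> 0 < e \<Longrightarrow> \<exists>\<delta>>0. \<forall>h. 0 < h \<and> h < \<delta> \<longrightarrow>
       norm (integral (cbox x (x + h *\<^sub>R One)) d /\<^sub>R h ^ DIM(real^'n) - d x) < e"
    using integrable_ccontinuous_explicit[OF assms(1)] by metis
  have "d x = 0" if "x \<notin> N" for x
  proof (rule ccontr)
    assume "d x \<noteq> 0"
    then have "\<bar>d x\<bar> > 0" by simp
    from N(2)[OF \<open>x \<notin> N\<close> this] obtain \<delta> where \<delta>: "\<delta> > 0" "\<And>h. 0 < h \<Longrightarrow> h < \<delta> \<Longrightarrow>
       norm (integral (cbox x (x + h *\<^sub>R One)) d /\<^sub>R h ^ DIM(real^'n) - d x) < \<bar>d x\<bar>"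
      by blast
    from \<delta>(2)[of "\<delta> / 2"] \<delta>(1) show False by (simp add: assms(2))
  qed
  moreover have "N \<in> null_sets lebesgue" using N(1) by (simp add: negligible_iff_null_sets)
  ultimately show ?thesis by (intro AE_I'[of N]) auto
qed

text \<open>Products of steep cutoffs are test functions bounded by 1 that converge to the indicator
  of the open box. Dominated convergence, with \<open>d\<close> cut down to the closed box as
  majorant, gives the integral over the open box, and the boundary does not contribute.\<close>

lemma integral_cbox_eq_0_if_test_functions:
  fixes d :: "real^'n \<Rightarrow> real"
  assumes d: "locally_integrable d" and 0: "\<And>\<psi>. test_function \<psi> \<Longrightarrow> (LINT x|lebesgue. d x * \<psi> x) = 0"
  shows "integral (cbox a b) d = 0"
proof -
  define D where "D x = indicator (cbox a b) x *\<^sub>R d x" for x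
  have D: "integrable lebesgue D"
    using d compact_cbox unfolding locally_integrable_def set_integrable_def D_def by blast
  define \<psi> where "\<psi> m = tens (\<lambda>i. cutoff (real (Suc m)) (a $ i) (b $ i)) (\<lambda>_. 0)" for m
  have \<psi>: "test_function (\<psi> m)" for m
    unfolding \<psi>_def by (rule test_function_tens[of _ a b]) (simp_all add: deriv_seq_cutoff cutoff_outside)
  have \<psi>_outside: "\<psi> m x = 0" if "x \<notin> cbox a b" for m x
  proof -
    from that have "\<exists>i. x $ i \<notin> {a $ i<..<b $ i}" by (auto simp: mem_box_cart intro: less_imp_le)
    then obtain i where "x $ i \<notin> {a $ i<..<b $ i}" ..
    then have "cutoff (real (Suc m)) (a $ i) (b $ i) 0 (x $ i) = 0" by (intro cutoff_outside) auto
    then show ?thesis unfolding \<psi>_def tens_def by (intro prod_zero) auto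
  qed
  have \<psi>_bounds: "\<bar>\<psi> m x\<bar> \<le> 1" for m x
    unfolding \<psi>_def tens_def abs_prod using cutoff_0_bounds by (intro prod_le_1) auto
  have \<psi>_lim: "(\<lambda>m. \<psi> m x) \<longlonglongrightarrow> indicator (box a b) x" for x
  proof -
    have "(\<lambda>m. \<psi> m x) \<longlonglongrightarrow> (\<Prod>i\<in>UNIV. indicator {a $ i<..<b $ i} (x $ i))"
      unfolding \<psi>_def tens_def by (intro tendsto_prod cutoff_0_tendsto)
    moreover have "(\<Prod>i\<in>UNIV. indicator {a $ i<..<b $ i} (x $ i)) = (indicator (box a b) x :: real)"
      by (auto simp: indicator_def mem_box_cart)
    ultimately show ?thesis by simp
  qed
  have \<psi>_meas: "\<psi> m \<in> borel_measurable lebesgue" for m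
    by (intro borel_measurable_continuous_lebesgue test_function_continuous \<psi>)
  have "(\<lambda>m. LINT x|lebesgue. D x * \<psi> m x) \<longlonglongrightarrow> (LINT x|lebesgue. D x * indicator (box a b) x)"
  proof (rule integral_dominated_convergence[where w = "\<lambda>x. \<bar>D x\<bar>"])
    show "AE x in lebesgue. (\<lambda>m. D x * \<psi> m x) \<longlonglongrightarrow> D x * indicator (box a b) x"
      by (intro AE_I2 tendsto_intros \<psi>_lim)
    show "AE x in lebesgue. norm (D x * \<psi> m x) \<le> \<bar>D x\<bar>" for m
      using \<psi>_bounds[of m] by (intro AE_I2) (simp add: abs_mult mult_left_le)
    show "(\<lambda>x. D x * indicator (box a b) x) \<in> borel_measurable lebesgue"
      using D by (intro borel_measurable_times borel_measurable_indicator) auto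
    show "(\<lambda>x. D x * \<psi> m x) \<in> borel_measurable lebesgue" for m
      using D by (intro borel_measurable_times \<psi>_meas) auto
    show "integrable lebesgue (\<lambda>x. \<bar>D x\<bar>)" using D by (rule integrable_abs)
  qed
  moreover have "(LINT x|lebesgue. D x * \<psi> m x) = 0" for m
  proof -
    have "D x * \<psi> m x = d x * \<psi> m x" for x
      using \<psi>_outside[of x m] by (auto simp: D_def indicator_def)
    then have "(\<lambda>x. D x * \<psi> m x) = (\<lambda>x. d x * \<psi> m x)" by (rule ext)
    then show ?thesis using 0[OF \<psi>] by simp
  qed
  ultimately have "(LINT x|lebesgue. D x * indicator (box a b) x) = 0"
    by (simp add: LIMSEQ_const_iff)
  moreover have "D x * indicator (box a b) x = indicator (box a b) x *\<^sub>R d x" for x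
    using box_subset_cbox[of a b] by (auto simp: D_def indicator_def)
  ultimately have "(LINT x:box a b|lebesgue. d x) = 0" by (simp add: set_lebesgue_integral_def)
  moreover have "d absolutely_integrable_on box a b"
    using d compact_cbox box_subset_cbox unfolding locally_integrable_def
    by (metis set_integrable_subset lmeasurable_box fmeasurableD)
  ultimately show ?thesis
    by (simp add: set_lebesgue_integral_eq_integral(2) integral_open_interval)
qed

lemma integrable_locally_integrable_times_test:
  assumes g: "locally_integrable g" and \<psi>: "test_function \<psi>"
  shows "integrable lebesgue (\<lambda>x. g x * \<psi> x)"
proof -
  obtain R where R: "\<And>x. norm x > R \<Longrightarrow> \<psi> x = 0" using test_function_support[OF \<psi>] by blast
  obtain K where K: "\<And>x. \<bar>\<psi> x\<bar> \<le> K"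
    using bounded_support_bound[OF test_function_continuous[OF \<psi>] R] by blast
  have D: "integrable lebesgue (\<lambda>x. indicator (cball 0 R) x *\<^sub>R g x)"
    using g compact_cball unfolding locally_integrable_def set_integrable_def by blast
  have "integrable lebesgue (\<lambda>x. (indicator (cball 0 R) x *\<^sub>R g x) * \<psi> x)"
  proof (rule Bochner_Integration.integrable_bound)
    show "integrable lebesgue (\<lambda>x. K * (indicator (cball 0 R) x *\<^sub>R g x))"
      using D by (rule integrable_mult_right)
    show "(\<lambda>x. (indicator (cball 0 R) x *\<^sub>R g x) * \<psi> x) \<in> borel_measurable lebesgue"
      by (rule borel_measurable_times[OF borel_measurable_integrable[OF D]
            borel_measurable_continuous_lebesgue[OF test_function_continuous[OF \<psi>]]])
    show "AE x in lebesgue. norm ((indicator (cball 0 R) x *\<^sub>R g x) * \<psi> x)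
        \<le> norm (K * (indicator (cball 0 R) x *\<^sub>R g x))"
    proof (rule AE_I2)
      fix x
      have "\<bar>\<psi> x\<bar> \<le> \<bar>K\<bar>" using K[of x] by linarith
      then show "norm ((indicator (cball 0 R) x *\<^sub>R g x) * \<psi> x) \<le> norm (K * (indicator (cball 0 R) x *\<^sub>R g x))"
        using mult_right_mono[of "\<bar>\<psi> x\<bar>" "\<bar>K\<bar>" "\<bar>indicator (cball 0 R) x *\<^sub>R g x\<bar>"]
        by (simp only: real_norm_def abs_mult mult.commute abs_ge_zero)
    qed
  qed
  moreover have "(indicator (cball 0 R) x *\<^sub>R g x) * \<psi> x = g x * \<psi> x" for x
    using R[of x] by (cases "norm x > R") auto
  then have "(\<lambda>x. (indicator (cball 0 R) x *\<^sub>R g x) * \<psi> x) = (\<lambda>x. g x * \<psi> x)" by (rule ext)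
  ultimately show ?thesis by simp
qed

lemma has_weak_deriv_unique:
  assumes "has_weak_deriv \<alpha> f g1" "has_weak_deriv \<alpha> f g2"
  shows "AE x in lebesgue. g1 x = g2 x"
proof -
  have li: "locally_integrable g1" "locally_integrable g2"
    using assms by (auto simp: has_weak_deriv_def)
  define d where "d x = g1 x - g2 x" for x
  have d: "locally_integrable d"
    using li unfolding locally_integrable_def d_def by (simp add: set_integral_diff(1))
  have "(LINT x|lebesgue. d x * \<psi> x) = 0" if \<psi>: "test_function \<psi>" for \<psi>
  proof -
    have "(-1) ^ mi_order \<alpha> * (LINT x|lebesgue. g1 x * \<psi> x) = (-1) ^ mi_order \<alpha> * (LINT x|lebesgue. g2 x * \<psi> x)"
      using assms \<psi> unfolding has_weak_deriv_def by metis
    then show ?thesis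
      by (simp add: d_def left_diff_distrib integrable_locally_integrable_times_test li \<psi>)
  qed
  then have "integral (cbox a b) d = 0" for a b
    by (rule integral_cbox_eq_0_if_test_functions[OF d])
  moreover have "d integrable_on cbox a b" for a b
    using d compact_cbox set_lebesgue_integral_eq_integral(1) unfolding locally_integrable_def by blast
  ultimately have "AE x in lebesgue. d x = 0" by (intro AE_eq_0_if_integrals_eq_0)
  then show ?thesis by (simp add: d_def)
qed

text \<open>Allows the explicit tensor product derivatives to replace the representative selected by
  \<open>SOME\<close>.\<close>

lemma weak_deriv_AE_eq:
  assumes "has_weak_deriv \<alpha> f g"
  shows "AE x in lebesgue. weak_deriv \<alpha> f x = g x"
  using has_weak_deriv_unique[OF someI[of "has_weak_deriv \<alpha> f", OF assms] assms]
  by (simp add: weak_deriv_def)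

lemma finite_mi_order: "finite {\<alpha> :: nat^'n. mi_order \<alpha> = k}"
proof (rule finite_imageD)
  have "vec_nth ` {\<alpha> :: nat^'n. mi_order \<alpha> = k} \<subseteq> Pi\<^sub>E UNIV (\<lambda>_. {..k})"
    by (auto simp: mi_order_def intro!: member_le_sum)
  then show "finite (vec_nth ` {\<alpha> :: nat^'n. mi_order \<alpha> = k})"
    by (rule finite_subset) (simp add: finite_PiE)
  show "inj_on vec_nth {\<alpha> :: nat^'n. mi_order \<alpha> = k}"
    by (auto simp: inj_on_def vec_eq_iff)
qed

lemma abs_grad_AE_eq:
  assumes "\<And>\<alpha>. mi_order \<alpha> = k \<Longrightarrow> has_weak_deriv \<alpha> f (g \<alpha>)"
  shows "AE x in lebesgue. abs_grad k f x = sqrt (\<Sum>\<alpha> | mi_order \<alpha> = k. (g \<alpha> x)\<^sup>2)"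
proof -
  have "AE x in lebesgue. \<forall>\<alpha>\<in>{\<alpha>. mi_order \<alpha> = k}. weak_deriv \<alpha> f x = g \<alpha> x"
    using assms by (intro AE_finite_allI finite_mi_order weak_deriv_AE_eq) auto
  then show ?thesis
    by eventually_elim (simp add: abs_grad_def)
qed

text \<open>The selected representatives agree with measurable functions only almost everywhere;
  completeness of Lebesgue measure makes the gradient measurable nevertheless.\<close>

lemma abs_grad_L0:
  assumes "\<And>\<alpha>. mi_order \<alpha> = k \<Longrightarrow> has_weak_deriv \<alpha> f (g \<alpha>)"
    and "\<And>\<alpha>. mi_order \<alpha> = k \<Longrightarrow> g \<alpha> \<in> L0"
  shows "abs_grad k f \<in> L0"
  unfolding L0_def
proof (rule borel_measurable_AE)
  show "AE x in lebesgue. sqrt (\<Sum>\<alpha> | mi_order \<alpha> = k. (g \<alpha> x)\<^sup>2) = abs_grad k f x"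
    using abs_grad_AE_eq[OF assms(1)] by (simp add: eq_commute)
  show "(\<lambda>x. sqrt (\<Sum>\<alpha> | mi_order \<alpha> = k. (g \<alpha> x)\<^sup>2)) \<in> borel_measurable lebesgue"
    using assms(2) unfolding L0_def
    by (intro measurable_compose[OF _ borel_measurable_sqrt] borel_measurable_sum borel_measurable_power) auto
qed

section \<open>Rearranging step functions\<close>

text \<open>Lebesgue measure has no atoms: cut \<open>E\<close> with the half-spaces below level
  \<open>t\<close> in one coordinate. The measure of the cut depends continuously on
  \<open>t\<close>, as hyperplanes are null sets, and the intermediate value theorem yields the
  level.\<close>

lemma exists_subset_of_measure:
  fixes E :: "(real^'n) set"
  assumes E: "E \<in> lmeasurable" and c: "0 \<le> c" "c \<le> measure lebesgue E"
  obtains F where "F \<subseteq> E" "F \<in> lmeasurable" "measure lebesgue F = c"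
proof -
  obtain i :: 'n where True by auto
  define H where "H t = {x :: real^'n. x $ i \<le> t}" for t
  have Hm: "H t \<in> sets lebesgue" for t
    unfolding H_def using borel_closed[OF closed_halfspace_component_le_cart[of i t]] by simp
  have EH: "E \<inter> H t \<in> lmeasurable" for t
    using fmeasurable_Int_fmeasurable[OF E Hm] by simp
  define m where "m t = measure lebesgue (E \<inter> H t)" for t
  have mono: "mono m"
    unfolding m_def by (intro monoI measure_mono_fmeasurable fmeasurableD EH) (auto simp: H_def)
  have lim_up: "(\<lambda>n. m (real n)) \<longlonglongrightarrow> measure lebesgue E"
  proof -
    have "(\<lambda>n. measure lebesgue (E \<inter> H (real n))) \<longlonglongrightarrow> measure lebesgue (\<Union>n. E \<inter> H (real n))"
    proof (rule Lim_measure_incseq)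
      show "incseq (\<lambda>n. E \<inter> H (real n))" by (auto simp: incseq_def H_def)
      have eq: "(\<Union>n. E \<inter> H (real n)) = E" using real_arch_simple by (auto simp: H_def)
      show "emeasure lebesgue (\<Union>n. E \<inter> H (real n)) \<noteq> \<infinity>" 
        unfolding eq using E by (auto simp: fmeasurable_def)
    qed (use EH in \<open>auto intro: fmeasurableD\<close>)
    moreover have "(\<Union>n. E \<inter> H (real n)) = E" using real_arch_simple by (auto simp: H_def)
    ultimately show ?thesis by (simp add: m_def)
  qed
  have lim_down: "(\<lambda>n. m (- real n)) \<longlonglongrightarrow> 0"
  proof -
    have "(\<lambda>n. measure lebesgue (E \<inter> H (- real n))) \<longlonglongrightarrow> measure lebesgue (\<Inter>n. E \<inter> H (- real n))"
    proof (rule Lim_measure_decseq)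
      show "decseq (\<lambda>n. E \<inter> H (- real n))" by (auto simp: decseq_def H_def)
      show "emeasure lebesgue (E \<inter> H (- real n)) \<noteq> \<infinity>" for n
        using EH[of "- real n"] by (auto simp: fmeasurable_def)
    qed (use EH in \<open>auto intro: fmeasurableD\<close>)
    moreover have "(\<Inter>n. E \<inter> H (- real n)) = {}"
    proof -
      have "\<exists>n. \<not> x $ i \<le> - real n" for x :: "real^'n"
      proof -
        obtain n where "- x $ i < real n" using reals_Archimedean2 by blast
        then show ?thesis by (intro exI[of _ n]) linarith
      qed
      then show ?thesis by (auto simp: H_def)
    qed
    ultimately show ?thesis by (simp add: m_def)
  qed
  have cont: "isCont m t" for t
  proof -
    \<comment> \<open>The oscillation of \<open>m\<close> around \<open>t\<close> is the measure of
      a slab in \<open>E\<close>, and the slabs shrink to a part of a hyperplane.\<close>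
    have lip: "m (t + s) - m (t - s) = measure lebesgue (E \<inter> H (t + s) - E \<inter> H (t - s))" if "s > 0" for s
      unfolding m_def using that
      by (intro measurable_measure_Diff[symmetric] fmeasurableD EH) (auto simp: H_def)
    have "(\<lambda>n. measure lebesgue (E \<inter> H (t + 1 / Suc n) - E \<inter> H (t - 1 / Suc n)))
      \<longlonglongrightarrow> measure lebesgue (\<Inter>n. E \<inter> H (t + 1 / Suc n) - E \<inter> H (t - 1 / Suc n))"
    proof (rule Lim_measure_decseq)
      show "range (\<lambda>n. E \<inter> H (t + 1 / Suc n) - E \<inter> H (t - 1 / Suc n)) \<subseteq> sets lebesgue"
        using EH by (auto intro!: sets.Diff fmeasurableD)
      have le: "1 / real (Suc b) \<le> 1 / real (Suc a)" if "a \<le> b" for a b using that by (simp add: field_simps)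
      show "decseq (\<lambda>n. E \<inter> H (t + 1 / Suc n) - E \<inter> H (t - 1 / Suc n))"
        unfolding decseq_def H_def using le by (force simp del: of_nat_Suc)
      show "emeasure lebesgue (E \<inter> H (t + 1 / Suc n) - E \<inter> H (t - 1 / Suc n)) \<noteq> \<infinity>" for n
        using fmeasurableD2[OF fmeasurable_Diff[OF EH fmeasurableD[OF EH]]] by simp
    qed
    moreover have "(\<Inter>n. E \<inter> H (t + 1 / Suc n) - E \<inter> H (t - 1 / Suc n)) \<subseteq> {x. x $ i = t}"
    proof (rule subsetI, rule ccontr)
      fix x assume x: "x \<in> (\<Inter>n. E \<inter> H (t + 1 / Suc n) - E \<inter> H (t - 1 / Suc n))"
      assume "x \<notin> {x. x $ i = t}"
      then obtain n where n: "inverse (real (Suc n)) < \<bar>x $ i - t\<bar>" using reals_Archimedean[of "\<bar>x $ i - t\<bar>"] by auto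
      from x have "x $ i \<le> t + 1 / Suc n" "x $ i > t - 1 / Suc n"
        by (auto simp: H_def not_le simp del: of_nat_Suc)
      with n show False by (auto simp: inverse_eq_divide)
    qed
    then have "negligible (\<Inter>n. E \<inter> H (t + 1 / Suc n) - E \<inter> H (t - 1 / Suc n))"
      by (rule negligible_subset[rotated])
         (use negligible_standard_hyperplane[of "axis i 1 :: real^'n" t] in \<open>simp add: inner_axis axis_in_Basis_iff\<close>)
    then have "measure lebesgue (\<Inter>n. E \<inter> H (t + 1 / Suc n) - E \<inter> H (t - 1 / Suc n)) = 0"
      by (rule negligible_imp_measure0)
    ultimately have lim0: "(\<lambda>n. m (t + 1 / Suc n) - m (t - 1 / Suc n)) \<longlonglongrightarrow> 0"
      using lip by simp
    show ?thesis
      unfolding isCont_def LIM_def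
    proof (intro allI impI)
      fix e :: real assume "e > 0"
      with lim0 obtain n where n: "\<bar>m (t + 1 / Suc n) - m (t - 1 / Suc n)\<bar> < e"
        unfolding lim_sequentially dist_real_def by fastforce
      show "\<exists>\<delta>>0. \<forall>x. x \<noteq> t \<and> dist x t < \<delta> \<longrightarrow> dist (m x) (m t) < e"
      proof (intro exI[of _ "1 / Suc n"] conjI allI impI)
        fix x assume "x \<noteq> t \<and> dist x t < 1 / Suc n"
        then have "t - 1 / Suc n \<le> x" "x \<le> t + 1 / Suc n" "t - 1 / Suc n \<le> t" "t \<le> t + 1 / Suc n"
          by (auto simp: dist_real_def)
        then have "m (t - 1 / Suc n) \<le> m x" "m x \<le> m (t + 1 / Suc n)"
           "m (t - 1 / Suc n) \<le> m t" "m t \<le> m (t + 1 / Suc n)"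
          by (auto intro: monoD[OF mono])
        with n show "dist (m x) (m t) < e" unfolding dist_real_def by linarith
      qed simp
    qed
  qed
  \<comment> \<open>The two extreme values are limits of \<open>m\<close> and need not be attained,
    so they get their own witnesses.\<close>
  consider "c = 0" | "c = measure lebesgue E" | "0 < c" "c < measure lebesgue E" using c by linarith
  then show thesis
  proof cases
    case 1 then show thesis using that[of "{}"] by auto
  next
    case 2 then show thesis using that[of E] E by auto
  next
    case 3
    obtain p where p: "m (real p) > c"
      using order_tendstoD(1)[OF lim_up 3(2)] by (auto simp: eventually_sequentially)
    obtain q where q: "m (- real q) < c"
      using order_tendstoD(2)[OF lim_down 3(1)] by (auto simp: eventually_sequentially)
    have "\<exists>t. - real q \<le> t \<and> t \<le> real p \<and> m t = c"
      by (rule IVT) (use p q cont in auto)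
    then obtain t where "m t = c" by blast
    then show thesis using that[of "E \<inter> H t"] EH by (auto simp: m_def)
  qed
qed

text \<open>Pieces of measure \<open>c\<close> are carved off one at a time. What remains after the
  last one is a null set, not necessarily empty, so the indicators add up only almost
  everywhere.\<close>

lemma exists_equipartition:
  fixes E :: "(real^'n) set"
  assumes "E \<in> lmeasurable" "measure lebesgue E = real M * c" "c \<ge> 0"
  shows "\<exists>P. (\<forall>m<M. P m \<in> lmeasurable \<and> P m \<subseteq> E \<and> measure lebesgue (P m) = c) \<and>
             (AE x in lebesgue. indicator E x = (\<Sum>m<M. indicator (P m) x :: real))"
  using assms
proof (induction M arbitrary: E)
  case 0
  then have "E \<in> null_sets lebesgue"
    by (simp add: null_setsI fmeasurableD emeasure_eq_measure2)
  then show ?case by (auto intro: AE_I'[where N=E] simp: indicator_def)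
next
  case (Suc M)
  have "c \<le> measure lebesgue E" using Suc.prems by (simp add: algebra_simps)
  then obtain F where F: "F \<subseteq> E" "F \<in> lmeasurable" "measure lebesgue F = c"
    using exists_subset_of_measure[OF Suc.prems(1,3)] by blast
  have "E - F \<in> lmeasurable" using Suc.prems(1) F by (intro fmeasurable_Diff fmeasurableD)
  moreover have "measure lebesgue (E - F) = real M * c"
    using measurable_measure_Diff[OF Suc.prems(1) fmeasurableD[OF F(2)] F(1)] Suc.prems F by (simp add: algebra_simps)
  ultimately obtain P where P: "\<forall>m<M. P m \<in> lmeasurable \<and> P m \<subseteq> E - F \<and> measure lebesgue (P m) = c"
     "AE x in lebesgue. indicator (E - F) x = (\<Sum>m<M. indicator (P m) x :: real)"
    using Suc.IH Suc.prems(3) by blast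
  show ?case
  proof (intro exI[of _ "P(M := F)"] conjI allI impI)
    fix m assume "m < Suc M"
    then show "(P(M := F)) m \<in> lmeasurable" "(P(M := F)) m \<subseteq> E" "measure lebesgue ((P(M := F)) m) = c"
      using P(1) F by (auto simp: less_Suc_eq)
  next
    have "(indicator E x :: real) = indicator (E - F) x + indicator F x" for x
      using F(1) by (auto simp: indicator_def)
    then show "AE x in lebesgue. indicator E x = (\<Sum>m<Suc M. indicator ((P(M := F)) m) x :: real)"
      using P(2) by (auto elim!: eventually_mono)
  qed
qed

section \<open>Norms of step functions\<close>

context banach_function_space
begin

lemma norm_zero: "N (\<lambda>_. 0) = 0"
  using norm_scale[of "\<lambda>_. 0" 0] by (simp add: L0_def)

lemma norm_AE_cong:
  "f \<in> L0 \<Longrightarrow> g \<in> L0 \<Longrightarrow> AE x in lebesgue. f x = g x \<Longrightarrow> N f = N g"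
  by (intro antisym norm_mono) (auto elim: eventually_mono)

lemma norm_sum:
  assumes "finite M" "\<And>m. m \<in> M \<Longrightarrow> f m \<in> L0"
  shows "N (\<lambda>x. \<Sum>m\<in>M. f m x) \<le> (\<Sum>m\<in>M. N (f m))"
  using assms
proof (induction M)
  case (insert m M)
  have "(\<lambda>x. \<Sum>m\<in>M. f m x) \<in> L0" using insert.prems unfolding L0_def by (intro borel_measurable_sum) auto
  then have "N (\<lambda>x. f m x + (\<Sum>m\<in>M. f m x)) \<le> N (f m) + N (\<lambda>x. \<Sum>m\<in>M. f m x)"
    using insert.prems by (intro norm_triangle) auto
  also have "\<dots> \<le> N (f m) + (\<Sum>m\<in>M. N (f m))" using insert by (intro add_left_mono) auto
  finally show ?case using insert by simp
qed (simp add: norm_zero)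

lemma step_L0:
  "(\<And>i. i \<in> I \<Longrightarrow> E i \<in> lmeasurable) \<Longrightarrow> (\<lambda>x. \<Sum>i\<in>I. a i * indicator (E i) x) \<in> L0"
  unfolding L0_def by (intro borel_measurable_sum borel_measurable_times borel_measurable_indicator) auto

lemma step_fspace:
  assumes "finite I" "\<And>i. i \<in> I \<Longrightarrow> E i \<in> lmeasurable"
  shows "(\<lambda>x. \<Sum>i\<in>I. a i * indicator (E i) x) \<in> fspace N"
proof -
  have L0: "(\<lambda>x. a i * indicator (E i) x) \<in> L0" if "i \<in> I" for i
    using assms(2)[OF that] unfolding L0_def by (intro borel_measurable_times borel_measurable_indicator) auto
  have "N (\<lambda>x. \<Sum>i\<in>I. a i * indicator (E i) x) \<le> (\<Sum>i\<in>I. N (\<lambda>x. a i * indicator (E i) x))"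
    by (intro norm_sum assms L0)
  also have "\<dots> < \<infinity>"
  proof -
    have "N (\<lambda>x. a i * indicator (E i) x) < top" if "i \<in> I" for i
    proof -
      have "indicator (E i) \<in> fspace N"
        using fmeasurableD[OF assms(2)[OF that]] fmeasurableD2[OF assms(2)[OF that]]
        by (intro indicator_in_space) (auto simp: less_top)
      then show ?thesis
        by (simp add: fspace_def norm_scale ennreal_mult_less_top)
    qed
    then show ?thesis using assms(1) by (simp add: less_top)
  qed
  finally show ?thesis using step_L0[of I E a] assms by (simp add: fspace_def)
qed

end

lemma step_value:
  fixes E :: "'i \<Rightarrow> 'a set" and a :: "'i \<Rightarrow> real"
  assumes "finite I" "disjoint_family_on E I" "i \<in> I" "x \<in> E i"
  shows "(\<Sum>i\<in>I. a i * indicator (E i) x) = a i"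
proof -
  have "indicator (E j) x = (0::real)" if "j \<in> I - {i}" for j
    using that assms by (auto simp: disjoint_family_on_def indicator_def)
  then have "(\<Sum>j\<in>I - {i}. a j * indicator (E j) x) = 0" by (intro sum.neutral) auto
  then show ?thesis using assms by (subst sum.remove[of _ i]) auto
qed

lemma step_value_outside:
  fixes E :: "'i \<Rightarrow> 'a set" and a :: "'i \<Rightarrow> real"
  shows "(\<And>i. i \<in> I \<Longrightarrow> x \<notin> E i) \<Longrightarrow> (\<Sum>i\<in>I. a i * indicator (E i) x) = 0"
  by (intro sum.neutral) auto

lemma step_distribution:
  fixes E :: "'i \<Rightarrow> (real^'n) set" and a :: "'i \<Rightarrow> real"
  assumes "finite I" "disjoint_family_on E I" "\<And>i. i \<in> I \<Longrightarrow> E i \<in> lmeasurable" "\<alpha> > 0"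
  shows "emeasure lebesgue {x. \<alpha> < \<bar>\<Sum>i\<in>I. a i * indicator (E i) x\<bar>}
       = (\<Sum>i | i \<in> I \<and> \<alpha> < \<bar>a i\<bar>. emeasure lebesgue (E i))"
proof -
  note val = step_value[OF assms(1,2)]
  have "{x. \<alpha> < \<bar>\<Sum>i\<in>I. a i * indicator (E i) x\<bar>} = (\<Union>i\<in>{i\<in>I. \<alpha> < \<bar>a i\<bar>}. E i)"
  proof (intro set_eqI iffI)
    fix x assume x: "x \<in> {x. \<alpha> < \<bar>\<Sum>i\<in>I. a i * indicator (E i) x\<bar>}"
    then have "(\<Sum>i\<in>I. a i * indicator (E i) x) \<noteq> 0" using assms(4) by (intro notI) simp
    then obtain i where i: "i \<in> I" "x \<in> E i" using step_value_outside[of I x E a] by blast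
    then show "x \<in> (\<Union>i\<in>{i\<in>I. \<alpha> < \<bar>a i\<bar>}. E i)" using x val[OF i] by auto
  next
    fix x assume "x \<in> (\<Union>i\<in>{i\<in>I. \<alpha> < \<bar>a i\<bar>}. E i)"
    then obtain i where i: "i \<in> I" "x \<in> E i" "\<alpha> < \<bar>a i\<bar>" by blast
    then show "x \<in> {x. \<alpha> < \<bar>\<Sum>i\<in>I. a i * indicator (E i) x\<bar>}"
      unfolding mem_Collect_eq val[OF i(1,2)] by simp
  qed
  also have "emeasure lebesgue \<dots> = (\<Sum>i | i \<in> I \<and> \<alpha> < \<bar>a i\<bar>. emeasure lebesgue (E i))"
    using assms by (intro sum_emeasure[symmetric]) (auto simp: disjoint_family_on_def)
  finally show ?thesis .
qed

context ri_banach_function_space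
begin

text \<open>The distribution function of a step function on disjoint sets depends only on the
  coefficients and on the measures of the sets, so rearrangement invariance applies.\<close>

lemma step_norm_cong:
  fixes E F :: "'i \<Rightarrow> (real^'n) set"
  assumes "finite I" "disjoint_family_on E I" "disjoint_family_on F I"
    and E: "\<And>i. i \<in> I \<Longrightarrow> E i \<in> lmeasurable" and F: "\<And>i. i \<in> I \<Longrightarrow> F i \<in> lmeasurable"
    and eq: "\<And>i. i \<in> I \<Longrightarrow> measure lebesgue (E i) = measure lebesgue (F i)"
  shows "N (\<lambda>x. \<Sum>i\<in>I. a i * indicator (E i) x) = N (\<lambda>x. \<Sum>i\<in>I. a i * indicator (F i) x)"
proof -
  have "emeasure lebesgue {x. \<alpha> < \<bar>\<Sum>i\<in>I. a i * indicator (E i) x\<bar>}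
      = emeasure lebesgue {x. \<alpha> < \<bar>\<Sum>i\<in>I. a i * indicator (F i) x\<bar>}" if "\<alpha> > 0" for \<alpha>
  proof -
    have "(\<Sum>i | i \<in> I \<and> \<alpha> < \<bar>a i\<bar>. emeasure lebesgue (E i)) = (\<Sum>i | i \<in> I \<and> \<alpha> < \<bar>a i\<bar>. emeasure lebesgue (F i))"
      by (intro sum.cong) (auto simp: emeasure_eq_measure2 E F eq)
    then show ?thesis
      using that by (simp only: step_distribution[OF assms(1,2) E] step_distribution[OF assms(1,3) F])
  qed
  then show ?thesis
    by (intro rearrangement_invariant[THEN conjunct2] step_L0 step_fspace assms(1) E F) auto
qed

text \<open>
  Cut each \<open>E i\<close> into \<open>M\<close> pieces of equal measure; each of the \<open>M\<close> resulting step functions is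
  equimeasurable with one supported inside the sets \<open>F i\<close>.
\<close>

lemma step_norm_le:
  fixes E F :: "'i \<Rightarrow> (real^'n) set"
  assumes fin: "finite I" and disj: "disjoint_family_on E I" "disjoint_family_on F I"
    and E: "\<And>i. i \<in> I \<Longrightarrow> E i \<in> lmeasurable" and F: "\<And>i. i \<in> I \<Longrightarrow> F i \<in> lmeasurable"
    and le: "\<And>i. i \<in> I \<Longrightarrow> measure lebesgue (E i) \<le> real M * measure lebesgue (F i)"
    and a: "\<And>i. i \<in> I \<Longrightarrow> 0 \<le> a i"
  shows "N (\<lambda>x. \<Sum>i\<in>I. a i * indicator (E i) x) \<le> of_nat M * N (\<lambda>x. \<Sum>i\<in>I. a i * indicator (F i) x)"
proof -
  have "\<exists>P. (\<forall>m<M. P m \<in> lmeasurable \<and> P m \<subseteq> E i \<and> measure lebesgue (P m) = measure lebesgue (E i) / real M) \<and>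
             (AE x in lebesgue. indicator (E i) x = (\<Sum>m<M. indicator (P m) x :: real))" if "i \<in> I" for i
  proof (rule exists_equipartition[OF E[OF that]])
    \<comment> \<open>If \<open>M = 0\<close>, the hypothesis \<open>le\<close> forces
      \<open>E i\<close> to have measure zero, so the division by zero does no harm.\<close>
    show "measure lebesgue (E i) = real M * (measure lebesgue (E i) / real M)"
      using le[OF that] by (cases "M = 0") (auto simp: measure_le_0_iff)
  qed auto
  then have "\<exists>P. \<forall>i\<in>I. (\<forall>m<M. P i m \<in> lmeasurable \<and> P i m \<subseteq> E i \<and>
               measure lebesgue (P i m) = measure lebesgue (E i) / real M) \<and>
             (AE x in lebesgue. indicator (E i) x = (\<Sum>m<M. indicator (P i m) x :: real))"
    by (intro bchoice ballI)
  then obtain P where P: "\<And>i m. i \<in> I \<Longrightarrow> m < M \<Longrightarrow> P i m \<in> lmeasurable"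
    "\<And>i m. i \<in> I \<Longrightarrow> m < M \<Longrightarrow> P i m \<subseteq> E i"
    "\<And>i m. i \<in> I \<Longrightarrow> m < M \<Longrightarrow> measure lebesgue (P i m) = measure lebesgue (E i) / real M"
    "\<And>i. i \<in> I \<Longrightarrow> AE x in lebesgue. indicator (E i) x = (\<Sum>m<M. indicator (P i m) x :: real)"
    by blast
  have "\<exists>G\<subseteq>F i. G \<in> lmeasurable \<and> measure lebesgue G = measure lebesgue (E i) / real M" if "i \<in> I" "M > 0" for i
  proof -
    have "measure lebesgue (E i) / real M \<le> measure lebesgue (F i)"
      using le[OF that(1)] that(2) by (simp add: divide_le_eq mult.commute)
    moreover have "0 \<le> measure lebesgue (E i) / real M" by simp
    ultimately show ?thesis using exists_subset_of_measure[OF F[OF \<open>i \<in> I\<close>]] by metis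
  qed
  then obtain G where G: "\<And>i. i \<in> I \<Longrightarrow> M > 0 \<Longrightarrow> G i \<subseteq> F i" "\<And>i. i \<in> I \<Longrightarrow> M > 0 \<Longrightarrow> G i \<in> lmeasurable"
    "\<And>i. i \<in> I \<Longrightarrow> M > 0 \<Longrightarrow> measure lebesgue (G i) = measure lebesgue (E i) / real M"
    by metis
  have "AE x in lebesgue. \<forall>i\<in>I. indicator (E i) x = (\<Sum>m<M. indicator (P i m) x :: real)"
    by (intro AE_finite_allI fin P)
  then have "AE x in lebesgue. (\<Sum>i\<in>I. a i * indicator (E i) x) = (\<Sum>m<M. \<Sum>i\<in>I. a i * indicator (P i m) x)"
  proof eventually_elim
    case (elim x)
    have "(\<Sum>i\<in>I. a i * indicator (E i) x) = (\<Sum>i\<in>I. \<Sum>m<M. a i * indicator (P i m) x)"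
      using elim by (intro sum.cong) (auto simp: sum_distrib_left)
    also have "\<dots> = (\<Sum>m<M. \<Sum>i\<in>I. a i * indicator (P i m) x)" by (rule sum.swap)
    finally show ?case .
  qed
  moreover have "(\<lambda>x. \<Sum>m<M. \<Sum>i\<in>I. a i * indicator (P i m) x) \<in> L0"
  proof -
    have "(\<lambda>x. \<Sum>i\<in>I. a i * indicator (P i m) x) \<in> borel_measurable lebesgue" if "m < M" for m
      using step_L0[of I "\<lambda>i. P i m" a] P(1) that by (simp add: L0_def)
    then show ?thesis unfolding L0_def by (rule borel_measurable_sum) simp
  qed
  ultimately have "N (\<lambda>x. \<Sum>i\<in>I. a i * indicator (E i) x) = N (\<lambda>x. \<Sum>m<M. \<Sum>i\<in>I. a i * indicator (P i m) x)"
    by (intro norm_AE_cong step_L0 E)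
  also have "\<dots> \<le> (\<Sum>m<M. N (\<lambda>x. \<Sum>i\<in>I. a i * indicator (P i m) x))"
    using P(1) by (intro norm_sum step_L0) auto
  also have "\<dots> \<le> (\<Sum>m<M. N (\<lambda>x. \<Sum>i\<in>I. a i * indicator (F i) x))"
  proof (rule sum_mono)
    fix m assume m: "m \<in> {..<M}"
    then have "M > 0" by auto
    have "N (\<lambda>x. \<Sum>i\<in>I. a i * indicator (P i m) x) = N (\<lambda>x. \<Sum>i\<in>I. a i * indicator (G i) x)"
    proof (rule step_norm_cong[OF fin])
      show "disjoint_family_on (\<lambda>i. P i m) I" "disjoint_family_on G I"
        using disj P(2) G(1) m \<open>M > 0\<close> unfolding disjoint_family_on_def by blast+
    qed (use P G m \<open>M > 0\<close> in auto)
    also have "\<dots> \<le> N (\<lambda>x. \<Sum>i\<in>I. a i * indicator (F i) x)"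
    proof (intro norm_mono step_L0 F G AE_I2 \<open>M > 0\<close>)
      fix x
      have "(\<Sum>i\<in>I. a i * indicator (G i) x) \<le> (\<Sum>i\<in>I. a i * indicator (F i) x)"
        using G(1)[OF _ \<open>M > 0\<close>] a by (intro sum_mono mult_left_mono) (auto simp: indicator_def)
      moreover have "0 \<le> (\<Sum>i\<in>I. a i * indicator (G i) x)" using a by (intro sum_nonneg) auto
      ultimately show "\<bar>\<Sum>i\<in>I. a i * indicator (G i) x\<bar> \<le> \<bar>\<Sum>i\<in>I. a i * indicator (F i) x\<bar>" by simp
    qed
    finally show "N (\<lambda>x. \<Sum>i\<in>I. a i * indicator (P i m) x) \<le> N (\<lambda>x. \<Sum>i\<in>I. a i * indicator (F i) x)" .
  qed
  finally show ?thesis by simp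
qed

end

section \<open>From cells to the embedding\<close>

lemma ennpowr_mono: "a \<le> b \<Longrightarrow> 0 \<le> p \<Longrightarrow> ennpowr a p \<le> ennpowr b p"
  unfolding ennpowr_def
  by (auto simp: top_unique less_top intro!: powr_mono2 enn2real_mono)

lemma ennpowr_cmult:
  assumes "c > 0"
  shows "ennpowr (ennreal c * a) p = ennreal (c powr p) * ennpowr a p"
proof (cases "a = top")
  case True
  then show ?thesis using assms by (simp add: ennpowr_def ennreal_mult_top)
next
  case False
  then have "ennreal c * a \<noteq> top" by (simp add: ennreal_mult_eq_top_iff)
  with False show ?thesis using assms
    by (simp add: ennpowr_def enn2real_mult powr_mult ennreal_mult)
qed

lemma ennpowr_less_top: "a < top \<Longrightarrow> ennpowr a p < top"
  by (auto simp: ennpowr_def)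

text \<open>The set \<open>S\<close>, meant to lie in the open unit cube, is shrunk by
  \<open>r\<close> and moved to the diagonal point with all coordinates \<open>p\<close>. For
  \<open>r \<le> 1\<close> every coordinate of its points lies between \<open>p\<close> and
  \<open>p + 1\<close>, so cells with different \<open>p\<close> are separated in each
  coordinate.\<close>

definition cell :: "nat \<Rightarrow> real \<Rightarrow> (real^'n) set \<Rightarrow> (real^'n) set"
  where "cell p r S = (\<lambda>y. r *\<^sub>R y + vec (real p)) ` S"

lemma cell_lmeasurable:
  assumes "S \<in> lmeasurable"
  shows "cell p r S \<in> lmeasurable"
proof -
  have "(*\<^sub>R) r ` S \<in> sets lebesgue"
  proof (cases "r = 0")
    case True
    then have "(*\<^sub>R) r ` S \<subseteq> {0}" by auto
    then show ?thesis by (metis negligible_sing negligible_subset negligible_imp_sets)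
  next
    case False
    then have "(*\<^sub>R) r ` S = (*\<^sub>R) (1 / r) -` S \<inter> space lebesgue"
      by (auto simp: image_iff intro!: bexI[of _ "(1 / r) *\<^sub>R _"])
    also have "\<dots> \<in> sets lebesgue"
      using assms by (intro measurable_sets[OF lebesgue_measurable_scaling]) auto
    finally show ?thesis .
  qed
  moreover have "emeasure lebesgue ((*\<^sub>R) r ` S) < \<infinity>"
    using emeasure_lebesgue_affine[of r 0 S] fmeasurableD2[OF assms] by (simp add: ennreal_mult_less_top less_top)
  ultimately have "(+) (vec (real p)) ` (*\<^sub>R) r ` S \<in> lmeasurable"
    by (intro measurable_translation fmeasurableI)
  then show ?thesis by (simp add: cell_def image_image add.commute)
qed

lemma measure_cell: "r > 0 \<Longrightarrow> measure lebesgue (cell p r S :: (real^'n) set) = r ^ CARD('n) * measure lebesgue S"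
  by (simp add: cell_def measure_lebesgue_affine)

lemma cell_in_unit_cube:
  assumes "x \<in> cell p r S" "S \<subseteq> box 0 1" "0 < r" "r \<le> 1"
  shows "real p < x $ i" "x $ i < real p + r"
proof -
  from assms obtain y where y: "y \<in> box 0 1" "x = r *\<^sub>R y + vec (real p)" by (auto simp: cell_def)
  then have "0 < y $ i" "y $ i < 1" by (auto simp: mem_box_cart)
  then show "real p < x $ i" "x $ i < real p + r" using y assms by auto
qed

lemma cell_disjoint:
  fixes S :: "(real^'n) set"
  assumes "S \<subseteq> box 0 1" "S' \<subseteq> box 0 1" "0 < r" "r \<le> 1" "0 < r'" "r' \<le> 1" "p \<noteq> p'"
  shows "cell p r S \<inter> cell p' r' S' = {}"
proof (rule ccontr)
  assume "cell p r S \<inter> cell p' r' S' \<noteq> {}"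
  then obtain x where x: "x \<in> cell p r S" "x \<in> cell p' r' S'" by blast
  obtain i :: 'n where True by auto
  have "real p < real p' + 1" "real p' < real p + 1"
    using cell_in_unit_cube[OF x(1) assms(1,3,4), of i] cell_in_unit_cube[OF x(2) assms(2,5,6), of i] assms by linarith+
  then show False using assms by linarith
qed

text \<open>The injective code \<open>to_nat (i, c)\<close> reserves a diagonal position of its own
  for the \<open>c\<close>-th cube of kind \<open>i\<close>, so that cubes never collide whatever
  the multiplicities are.\<close>

definition cells :: "'i::countable \<Rightarrow> nat \<Rightarrow> real \<Rightarrow> (real^'n) set \<Rightarrow> (real^'n) set"
  where "cells i M r S = (\<Union>c<M. cell (to_nat (i, c)) r S)"

lemma disjoint_family_cell:
  assumes "S \<subseteq> box 0 1" "0 < r" "r \<le> 1"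
  shows "disjoint_family_on (\<lambda>c. cell (to_nat (i, c)) r S) A"
  unfolding disjoint_family_on_def using assms
  by (intro ballI impI cell_disjoint) (auto dest: injD[OF inj_to_nat])

lemma cells_lmeasurable: "S \<in> lmeasurable \<Longrightarrow> cells i M r S \<in> lmeasurable"
  unfolding cells_def by (intro fmeasurable.finite_UN cell_lmeasurable) auto

lemma measure_cells:
  fixes S :: "(real^'n) set"
  assumes "S \<in> lmeasurable" "S \<subseteq> box 0 1" "0 < r" "r \<le> 1"
  shows "measure lebesgue (cells i M r S) = real M * (r ^ CARD('n) * measure lebesgue S)"
proof -
  have "measure lebesgue (cells i M r S) = (\<Sum>c<M. measure lebesgue (cell (to_nat (i, c)) r S))"
    unfolding cells_def
    by (rule measure_finite_Union)
       (use disjoint_family_cell[OF assms(2-4)] in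
         \<open>auto intro: fmeasurableD cell_lmeasurable simp: fmeasurableD2 cell_lmeasurable assms(1)\<close>)
  then show ?thesis using assms by (simp add: measure_cell)
qed

lemma disjoint_family_cells:
  assumes "S \<subseteq> box 0 1" "\<And>i. i \<in> I \<Longrightarrow> 0 < r i \<and> r i \<le> 1"
  shows "disjoint_family_on (\<lambda>i. cells i (M i) (r i) S) I"
  unfolding disjoint_family_on_def
proof (intro ballI impI)
  fix i j assume ij: "i \<in> I" "j \<in> I" "i \<noteq> j"
  have "cell (to_nat (i, c)) (r i) S \<inter> cell (to_nat (j, d)) (r j) S = {}" for c d :: nat
    using ij assms by (intro cell_disjoint) (auto dest: injD[OF inj_to_nat])
  then show "cells i (M i) (r i) S \<inter> cells j (M j) (r j) S = {}" unfolding cells_def by blast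
qed

text \<open>Connects two descriptions of the same step function: by individual cells, as in
  \<open>cell_ineq\<close>, and by kinds \<open>i\<close>, as required for the comparison with step
  functions on the sets \<open>E i\<close>.\<close>

lemma sum_cells:
  fixes I :: "'i::countable set" and a :: "'i \<Rightarrow> real"
  assumes "finite I" "S \<subseteq> box 0 1" "\<And>i. i \<in> I \<Longrightarrow> 0 < r i \<and> r i \<le> 1"
  shows "(\<Sum>p\<in>to_nat ` (SIGMA i:I. {..<M i}). a (fst (from_nat p :: 'i \<times> nat)) *
            indicator (cell p (r (fst (from_nat p :: 'i \<times> nat))) S) x)
       = (\<Sum>i\<in>I. a i * indicator (cells i (M i) (r i) S) x)"
proof -
  have "(\<Sum>p\<in>to_nat ` (SIGMA i:I. {..<M i}). a (fst (from_nat p :: 'i \<times> nat)) *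
            indicator (cell p (r (fst (from_nat p :: 'i \<times> nat))) S) x)
     = (\<Sum>(i,c)\<in>(SIGMA i:I. {..<M i}). a i * indicator (cell (to_nat (i, c)) (r i) S) x)"
    by (subst sum.reindex) (auto simp: inj_on_def intro!: sum.cong)
  also have "\<dots> = (\<Sum>i\<in>I. \<Sum>c<M i. a i * indicator (cell (to_nat (i, c)) (r i) S) x)"
    by (subst sum.Sigma) (use assms in auto)
  also have "\<dots> = (\<Sum>i\<in>I. a i * indicator (cells i (M i) (r i) S) x)"
  proof (rule sum.cong[OF refl])
    fix i assume "i \<in> I"
    have "indicator (cells i (M i) (r i) S) x = (\<Sum>c<M i. indicator (cell (to_nat (i, c)) (r i) S) x :: real)"
      unfolding cells_def
      by (rule indicator_UN_disjoint) (use disjoint_family_cell[OF assms(2)] assms(3)[OF \<open>i \<in> I\<close>] in auto)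
    then show "(\<Sum>c<M i. a i * indicator (cell (to_nat (i, c)) (r i) S) x) = a i * indicator (cells i (M i) (r i) S) x"
      by (simp only: sum_distrib_left)
  qed
  finally show ?thesis .
qed

text \<open>The common core of both assertions. \<open>cell_ineq\<close> is what the assumed
  interpolation inequality says about a sum of bumps of heights \<open>A p\<close> on cubes of sides
  \<open>r p\<close>: \<open>G\<close> is the piece of the unit cube on which the left-hand side is
  bounded below, and \<open>r0\<close> restricts the sides for the sake of finite
  differences.\<close>

locale cell_inequality =
  X: ri_banach_function_space X + Y: ri_banach_function_space Y + B: ri_banach_function_space B
  for X Y B :: "(real^'n \<Rightarrow> real) \<Rightarrow> ennreal" +
  fixes \<theta> C r0 :: real and k :: nat and G :: "(real^'n) set"
  assumes \<theta>: "0 < \<theta>" "\<theta> < 1" and k: "1 \<le> k" and r0: "0 < r0" "r0 \<le> 1" and C: "0 < C"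
    and G: "G \<in> lmeasurable" "G \<subseteq> box 0 1" "0 < measure lebesgue G"
    and cell_ineq: "\<And>(L :: nat set) A r. finite L \<Longrightarrow> (\<And>p. p \<in> L \<Longrightarrow> 0 < A p \<and> 0 < r p \<and> r p \<le> r0) \<Longrightarrow>
       B (\<lambda>x. \<Sum>p\<in>L. A p * r p powr (- (\<theta> * real k)) * indicator (cell p (r p) G) x)
         \<le> ennreal C * ennpowr (X (\<lambda>x. \<Sum>p\<in>L. A p * indicator (cell p (r p) (box 0 1)) x)) (1 - \<theta>)
                     * ennpowr (Y (\<lambda>x. \<Sum>p\<in>L. A p / r p ^ k * indicator (cell p (r p) (box 0 1)) x)) \<theta>"
begin

text \<open>The 2 pays for rounding down the number of cubes, the quotient by the measure of
  \<open>G\<close> for passing from a cube to its piece.\<close>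

definition "G_count = nat \<lceil>2 / measure lebesgue G\<rceil>"

lemma G_count: "real G_count * measure lebesgue G \<ge> 2" "G_count > 0"
proof -
  have "real G_count \<ge> 2 / measure lebesgue G" unfolding G_count_def using real_nat_ceiling_ge .
  then show "real G_count * measure lebesgue G \<ge> 2" using G(3) by (simp add: divide_le_eq)
  then show "G_count > 0" by (cases "G_count = 0") auto
qed

text \<open>
  The two sides of the inequality scale in the same way under \<open>b \<mapsto> b / \<delta>\<close>; a small \<open>\<delta>\<close> makes all the
  cells small, so that they fill the prescribed measures up to a factor of two.
\<close>

lemma step_inequality:
  fixes I :: "'i::countable set" and E :: "'i \<Rightarrow> (real^'n) set"
  assumes I: "finite I" and E: "disjoint_family_on E I" "\<And>i. i \<in> I \<Longrightarrow> E i \<in> lmeasurable"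
    and ab: "\<And>i. i \<in> I \<Longrightarrow> 0 < a i" "\<And>i. i \<in> I \<Longrightarrow> 0 < b i"
  shows "B (\<lambda>x. \<Sum>i\<in>I. a i powr (1 - \<theta>) * b i powr \<theta> * indicator (E i) x)
      \<le> ennreal (real G_count * C) * ennpowr (X (\<lambda>x. \<Sum>i\<in>I. a i * indicator (E i) x)) (1 - \<theta>)
          * ennpowr (Y (\<lambda>x. \<Sum>i\<in>I. b i * indicator (E i) x)) \<theta>"
proof -
  define n where "n = CARD('n)"
  have n: "n \<noteq> 0" by (simp add: n_def)
  define rad where "rad \<delta> i = (\<delta> * (a i / b i)) powr (1 / real k)" for \<delta> i
  have rad0: "((\<lambda>\<delta>. rad \<delta> i) \<longlongrightarrow> 0) (at_right 0)" if "i \<in> I" for i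
    unfolding rad_def
  proof (rule tendsto_zero_powrI[OF _ tendsto_const])
    show "((\<lambda>\<delta>. \<delta> * (a i / b i)) \<longlongrightarrow> 0) (at_right 0)"
      by (rule tendsto_mult_left_zero) (rule tendsto_ident_at)
    have "\<forall>\<^sub>F \<delta> in at_right (0::real). 0 < \<delta>" by (rule eventually_at_right_less)
    then show "\<forall>\<^sub>F \<delta> in at_right 0. 0 \<le> \<delta> * (a i / b i)"
      by eventually_elim (use ab[OF that] in simp)
  qed (use k in auto)
  \<comment> \<open>The second condition lets at least one cube fit into every \<open>E i\<close> of
    positive measure. Only then does rounding down the number of cubes cost at most a factor of two,
    because \<open>x \<le> 2 * \<lfloor>x\<rfloor>\<close> for \<open>x \<ge> 1\<close>.\<close>
  have "\<forall>\<^sub>F \<delta> in at_right 0. \<forall>i\<in>I. rad \<delta> i < r0 \<and> (0 < measure lebesgue (E i) \<longrightarrow> rad \<delta> i ^ n < measure lebesgue (E i))"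
  proof (intro eventually_ball_finite I ballI eventually_conj)
    fix i assume i: "i \<in> I"
    show "\<forall>\<^sub>F \<delta> in at_right 0. rad \<delta> i < r0" by (rule order_tendstoD(2)[OF rad0[OF i] r0(1)])
    have "((\<lambda>\<delta>. rad \<delta> i ^ n) \<longlongrightarrow> 0 ^ n) (at_right 0)" by (intro tendsto_power rad0 i)
    then have l: "((\<lambda>\<delta>. rad \<delta> i ^ n) \<longlongrightarrow> 0) (at_right 0)" using n by (simp only: power_0_left if_False)
    show "\<forall>\<^sub>F \<delta> in at_right 0. 0 < measure lebesgue (E i) \<longrightarrow> rad \<delta> i ^ n < measure lebesgue (E i)"
      by (cases "0 < measure lebesgue (E i)") (auto intro: order_tendstoD(2)[OF l])
  qed
  moreover have "\<forall>\<^sub>F \<delta> in at_right (0::real). 0 < \<delta>" by (rule eventually_at_right_less)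
  ultimately have "\<forall>\<^sub>F \<delta> in at_right 0. 0 < \<delta> \<and> (\<forall>i\<in>I. rad \<delta> i < r0 \<and> (0 < measure lebesgue (E i) \<longrightarrow> rad \<delta> i ^ n < measure lebesgue (E i)))"
    by eventually_elim auto
  then obtain \<delta> where \<delta>: "\<delta> > 0" "\<And>i. i \<in> I \<Longrightarrow> rad \<delta> i < r0"
     "\<And>i. i \<in> I \<Longrightarrow> 0 < measure lebesgue (E i) \<Longrightarrow> rad \<delta> i ^ n < measure lebesgue (E i)"
    using eventually_happens'[OF trivial_limit_at_right_real] by blast
  define r where "r = rad \<delta>"
  have r: "0 < r i" "r i \<le> r0" "r i \<le> 1" if "i \<in> I" for i
  proof -
    show "0 < r i" using ab[OF that] \<delta>(1) by (simp add: r_def rad_def)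
    show "r i \<le> r0" "r i \<le> 1" using \<delta>(2)[OF that] r0 by (auto simp: r_def)
  qed
  have rk: "r i ^ k = \<delta> * (a i / b i)" if "i \<in> I" for i
  proof -
    have "r i ^ k = r i powr real k" using r(1)[OF that] by (simp add: powr_realpow)
    also have "\<dots> = (\<delta> * (a i / b i)) powr (1 / real k * real k)" by (simp add: r_def rad_def powr_powr)
    also have "\<dots> = \<delta> * (a i / b i)" using k ab[OF that] \<delta>(1) by simp
    finally show ?thesis .
  qed
  have scaleY: "a i / r i ^ k = (1 / \<delta>) * b i" if "i \<in> I" for i
    unfolding rk[OF that] using ab[OF that] \<delta>(1) by (simp add: field_simps)
  have scaleB: "a i * r i powr (- (\<theta> * real k)) = \<delta> powr (- \<theta>) * (a i powr (1 - \<theta>) * b i powr \<theta>)" if "i \<in> I" for i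
  proof -
    have "r i powr (- (\<theta> * real k)) = (r i powr real k) powr (- \<theta>)"
      by (simp add: powr_powr mult.commute)
    also have "\<dots> = (\<delta> * (a i / b i)) powr (- \<theta>)" using r(1)[OF that] rk[OF that] by (simp add: powr_realpow)
    also have "\<dots> = \<delta> powr (- \<theta>) * (a i powr (- \<theta>) * b i powr \<theta>)"
      using ab[OF that] \<delta>(1) by (simp add: powr_mult powr_divide powr_minus field_simps)
    finally have "a i * r i powr (- (\<theta> * real k)) = \<delta> powr (- \<theta>) * ((a i powr 1 * a i powr (- \<theta>)) * b i powr \<theta>)"
      using ab[OF that] by simp
    then show ?thesis by (simp only: powr_add[symmetric]) simp
  qed
  define M where "M i = nat \<lfloor>measure lebesgue (E i) / r i ^ n\<rfloor>" for i
  have M_le: "real (M i) * r i ^ n \<le> measure lebesgue (E i)" if "i \<in> I" for i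
  proof -
    have "real (M i) \<le> measure lebesgue (E i) / r i ^ n"
      unfolding M_def using r(1)[OF that] by (intro of_nat_floor) auto
    then show ?thesis using r(1)[OF that] by (simp add: le_divide_eq)
  qed
  have M_ge: "measure lebesgue (E i) \<le> 2 * (real (M i) * r i ^ n)" if "i \<in> I" for i
  proof (cases "0 < measure lebesgue (E i)")
    case True
    have "1 \<le> measure lebesgue (E i) / r i ^ n"
      using \<delta>(3)[OF that True] r(1)[OF that] by (simp add: r_def)
    moreover from this have "1 \<le> \<lfloor>measure lebesgue (E i) / r i ^ n\<rfloor>" by simp
    then have "1 \<le> real (M i)" "real (M i) = \<lfloor>measure lebesgue (E i) / r i ^ n\<rfloor>" by (simp_all add: M_def)
    ultimately have "measure lebesgue (E i) / r i ^ n \<le> 2 * real (M i)" by linarith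
    then show ?thesis using r(1)[OF that] by (simp add: divide_le_eq)
  qed (use r(1)[OF that] in \<open>simp add: not_less measure_le_0_iff\<close>)
  let ?Q = "box 0 1 :: (real^'n) set"
  have "measure lborel ?Q = measure lborel (cbox 0 1 :: (real^'n) set)"
    by (simp add: measure_lborel_box_eq measure_lborel_cbox_eq)
  also have "\<dots> = 1" by (subst content_cbox_cart) (auto simp: interval_ne_empty_cart)
  finally have Q: "?Q \<in> lmeasurable" "measure lebesgue ?Q = 1" by simp_all
  define U where "U S i = cells i (M i) (r i) S" for S :: "(real^'n) set" and i :: 'i
  have U_meas: "U S i \<in> lmeasurable" if "S \<in> lmeasurable" for S i
    unfolding U_def by (intro cells_lmeasurable that)
  have U_disj: "disjoint_family_on (U S) I" if "S \<subseteq> ?Q" for S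
    unfolding U_def by (intro disjoint_family_cells that) (use r in auto)
  have U_measure: "measure lebesgue (U S i) = real (M i) * (r i ^ n * measure lebesgue S)"
    if "i \<in> I" "S \<in> lmeasurable" "S \<subseteq> ?Q" for S i
    unfolding U_def n_def using that r by (intro measure_cells) auto
  define L where "L = to_nat ` (SIGMA i:I. {..<M i})"
  define \<iota> where "\<iota> p = fst (from_nat p :: 'i \<times> nat)" for p
  have L: "finite L" "\<And>p. p \<in> L \<Longrightarrow> \<iota> p \<in> I" using I by (auto simp: L_def \<iota>_def)
  have sum_L: "(\<Sum>p\<in>L. c (\<iota> p) * indicator (cell p (r (\<iota> p)) S) x) = (\<Sum>i\<in>I. c i * indicator (U S i) x)"
    if "S \<subseteq> ?Q" for c :: "'i \<Rightarrow> real" and S x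
    unfolding L_def \<iota>_def U_def by (rule sum_cells[OF I that]) (use r in auto)
  let ?X = "X (\<lambda>x. \<Sum>i\<in>I. a i * indicator (E i) x)" and ?Y = "Y (\<lambda>x. \<Sum>i\<in>I. b i * indicator (E i) x)"
  \<comment> \<open>On the left-hand side \<open>E i\<close> is replaced by the pieces
    \<open>U G i\<close>, whose measure is smaller by at most the factor
    \<open>G_count\<close>.\<close>
  have "B (\<lambda>x. \<Sum>i\<in>I. a i powr (1 - \<theta>) * b i powr \<theta> * indicator (E i) x)
     \<le> of_nat G_count * B (\<lambda>x. \<Sum>i\<in>I. a i powr (1 - \<theta>) * b i powr \<theta> * indicator (U G i) x)"
  proof (rule B.step_norm_le[OF I E(1) U_disj[OF G(2)] E(2) U_meas[OF G(1)]])
    fix i assume i: "i \<in> I"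
    have "measure lebesgue (E i) \<le> (real G_count * measure lebesgue G) * (real (M i) * r i ^ n)"
      using M_ge[OF i] G_count(1) r(1)[OF i]
      by (intro order_trans[OF M_ge[OF i]] mult_right_mono) auto
    then show "measure lebesgue (E i) \<le> real G_count * measure lebesgue (U G i)"
      using U_measure[OF i G(1,2)] by (simp add: algebra_simps)
  qed auto
  also have "B (\<lambda>x. \<Sum>i\<in>I. a i powr (1 - \<theta>) * b i powr \<theta> * indicator (U G i) x)
      \<le> ennreal C * ennpowr ?X (1 - \<theta>) * ennpowr ?Y \<theta>"
  proof -
    \<comment> \<open>By \<open>scaleB\<close> the coefficients in \<open>cell_ineq\<close> carry a
      factor \<open>\<delta> powr (- \<theta>)\<close>; the factor in front compensates it and
      cancels later against the power that comes out of \<open>Y\<close>.\<close>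
    have "B (\<lambda>x. \<Sum>i\<in>I. a i powr (1 - \<theta>) * b i powr \<theta> * indicator (U G i) x)
        = B (\<lambda>x. \<delta> powr \<theta> * (\<Sum>p\<in>L. a (\<iota> p) * r (\<iota> p) powr (- (\<theta> * real k)) * indicator (cell p (r (\<iota> p)) G) x))"
    proof (rule arg_cong[of _ _ B], rule ext)
      fix x
      have "\<delta> powr \<theta> * \<delta> powr (- \<theta>) = 1" using \<delta>(1) by (simp add: powr_minus)
      then have cancel: "\<delta> powr \<theta> * (\<delta> powr (- \<theta>) * c) = c" for c by (metis mult.assoc mult_1)
      show "(\<Sum>i\<in>I. a i powr (1 - \<theta>) * b i powr \<theta> * indicator (U G i) x)
        = \<delta> powr \<theta> * (\<Sum>p\<in>L. a (\<iota> p) * r (\<iota> p) powr (- (\<theta> * real k)) * indicator (cell p (r (\<iota> p)) G) x)"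
        unfolding sum_L[OF G(2), of "\<lambda>i. a i * r i powr (- (\<theta> * real k))"]
        by (simp add: sum_distrib_left scaleB mult.assoc cancel cong: sum.cong)
    qed
    also have "\<dots> = ennreal (\<delta> powr \<theta>) * B (\<lambda>x. \<Sum>p\<in>L. a (\<iota> p) * r (\<iota> p) powr (- (\<theta> * real k)) * indicator (cell p (r (\<iota> p)) G) x)"
      by (subst B.norm_scale) (auto intro!: B.step_L0 cell_lmeasurable G)
    also have "\<dots> \<le> ennreal (\<delta> powr \<theta>) * (ennreal C * ennpowr (X (\<lambda>x. \<Sum>p\<in>L. a (\<iota> p) * indicator (cell p (r (\<iota> p)) ?Q) x)) (1 - \<theta>)
          * ennpowr (Y (\<lambda>x. \<Sum>p\<in>L. a (\<iota> p) / r (\<iota> p) ^ k * indicator (cell p (r (\<iota> p)) ?Q) x)) \<theta>)"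
      by (intro mult_left_mono cell_ineq L(1)) (use L(2) ab r in auto)
    also have "(\<lambda>x. \<Sum>p\<in>L. a (\<iota> p) * indicator (cell p (r (\<iota> p)) ?Q) x) = (\<lambda>x. \<Sum>i\<in>I. a i * indicator (U ?Q i) x)"
      by (rule ext, rule sum_L) simp
    also have "(\<lambda>x. \<Sum>p\<in>L. a (\<iota> p) / r (\<iota> p) ^ k * indicator (cell p (r (\<iota> p)) ?Q) x)
       = (\<lambda>x. 1 / \<delta> * (\<Sum>i\<in>I. b i * indicator (U ?Q i) x))"
    proof
      fix x
      have "(\<Sum>p\<in>L. a (\<iota> p) / r (\<iota> p) ^ k * indicator (cell p (r (\<iota> p)) ?Q) x)
        = (\<Sum>p\<in>L. (1 / \<delta> * b (\<iota> p)) * indicator (cell p (r (\<iota> p)) ?Q) x)"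
        by (intro sum.cong refl arg_cong2[where f = "(*)"] scaleY L(2))
      also have "\<dots> = (\<Sum>i\<in>I. (1 / \<delta> * b i) * indicator (U ?Q i) x)" by (rule sum_L) simp
      finally show "(\<Sum>p\<in>L. a (\<iota> p) / r (\<iota> p) ^ k * indicator (cell p (r (\<iota> p)) ?Q) x)
        = 1 / \<delta> * (\<Sum>i\<in>I. b i * indicator (U ?Q i) x)" by (simp only: sum_distrib_left mult.assoc)
    qed
    also have "Y (\<lambda>x. 1 / \<delta> * (\<Sum>i\<in>I. b i * indicator (U ?Q i) x)) = ennreal (1 / \<delta>) * Y (\<lambda>x. \<Sum>i\<in>I. b i * indicator (U ?Q i) x)"
      using \<delta>(1) by (subst Y.norm_scale) (auto intro!: Y.step_L0 U_meas Q)
    also have "ennpowr \<dots> \<theta> = ennreal (\<delta> powr (- \<theta>)) * ennpowr (Y (\<lambda>x. \<Sum>i\<in>I. b i * indicator (U ?Q i) x)) \<theta>"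
      using \<delta>(1) by (subst ennpowr_cmult) (auto simp: powr_divide powr_minus_divide)
    also have "ennreal (\<delta> powr \<theta>) * (ennreal C * ennpowr (X (\<lambda>x. \<Sum>i\<in>I. a i * indicator (U ?Q i) x)) (1 - \<theta>) *
        (ennreal (\<delta> powr (- \<theta>)) * ennpowr (Y (\<lambda>x. \<Sum>i\<in>I. b i * indicator (U ?Q i) x)) \<theta>))
       = (ennreal (\<delta> powr \<theta>) * ennreal (\<delta> powr (- \<theta>))) * (ennreal C * ennpowr (X (\<lambda>x. \<Sum>i\<in>I. a i * indicator (U ?Q i) x)) (1 - \<theta>) *
         ennpowr (Y (\<lambda>x. \<Sum>i\<in>I. b i * indicator (U ?Q i) x)) \<theta>)"
      by (simp only: mult_ac)
    also have "ennreal (\<delta> powr \<theta>) * ennreal (\<delta> powr (- \<theta>)) = 1"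
      using \<delta>(1) by (simp add: powr_minus flip: ennreal_mult)
    also have "1 * (ennreal C * ennpowr (X (\<lambda>x. \<Sum>i\<in>I. a i * indicator (U ?Q i) x)) (1 - \<theta>) *
         ennpowr (Y (\<lambda>x. \<Sum>i\<in>I. b i * indicator (U ?Q i) x)) \<theta>)
       \<le> ennreal C * ennpowr ?X (1 - \<theta>) * ennpowr ?Y \<theta>"
    proof -
      \<comment> \<open>The full cubes of kind \<open>i\<close> together have at most the measure of
        \<open>E i\<close>, so on the right-hand side the comparison costs only the factor
        1.\<close>
      have le: "measure lebesgue (U ?Q i) \<le> real 1 * measure lebesgue (E i)" if "i \<in> I" for i
        using M_le[OF that] U_measure[OF that Q(1)] by (simp add: Q(2))
      have "X (\<lambda>x. \<Sum>i\<in>I. a i * indicator (U ?Q i) x) \<le> of_nat 1 * ?X"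
        using ab by (intro X.step_norm_le I E U_disj U_meas Q le) (auto intro: less_imp_le)
      moreover have "Y (\<lambda>x. \<Sum>i\<in>I. b i * indicator (U ?Q i) x) \<le> of_nat 1 * ?Y"
        using ab by (intro Y.step_norm_le I E U_disj U_meas Q le) (auto intro: less_imp_le)
      ultimately show ?thesis using \<theta> by (simp only: mult_1 of_nat_1) (intro mult_mono ennpowr_mono, auto)
    qed
    finally show ?thesis .
  qed
  finally show ?thesis using C by (simp add: ennreal_mult ennreal_of_nat_eq_real_of_nat mult.assoc mult_left_mono)
qed

text \<open>Dyadic discretisation: on \<open>E m (z, w)\<close> the absolute values of
  \<open>f\<close> and \<open>g\<close> lie within a factor 2 above \<open>2 powr z\<close> and
  \<open>2 powr w\<close>, so the product loses at most
  \<open>2 powr (1 - \<theta>) * 2 powr \<theta> = 2\<close>. Restricting to a ball and to finitely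
  many exponents gives finitely many sets of finite measure, and the Fatou property removes the
  restriction.\<close>

lemma product_inequality:
  assumes f: "f \<in> L0" and g: "g \<in> L0"
  shows "B (\<lambda>x. \<bar>f x\<bar> powr (1 - \<theta>) * \<bar>g x\<bar> powr \<theta>)
     \<le> ennreal (2 * (real G_count * C)) * ennpowr (X f) (1 - \<theta>) * ennpowr (Y g) \<theta>"
proof -
  define h where "h x = \<bar>f x\<bar> powr (1 - \<theta>) * \<bar>g x\<bar> powr \<theta>" for x
  have [measurable]: "f \<in> borel_measurable lebesgue" "g \<in> borel_measurable lebesgue"
    using f g by (auto simp: L0_def)
  define D where "D m = {x. norm x \<le> real m \<and> f x \<noteq> 0 \<and> g x \<noteq> 0 \<and>
      \<bar>\<lfloor>log 2 \<bar>f x\<bar>\<rfloor>\<bar> \<le> int m \<and> \<bar>\<lfloor>log 2 \<bar>g x\<bar>\<rfloor>\<bar> \<le> int m}" for m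
  define E where "E m = (\<lambda>(z, w). {x. norm x \<le> real m \<and> f x \<noteq> 0 \<and> g x \<noteq> 0 \<and>
      \<lfloor>log 2 \<bar>f x\<bar>\<rfloor> = z \<and> \<lfloor>log 2 \<bar>g x\<bar>\<rfloor> = w})" for m :: nat
  define I where "I m = {- int m..int m} \<times> {- int m..int m}" for m
  have I: "finite (I m)" for m by (simp add: I_def)
  have E_meas: "E m zw \<in> lmeasurable" for m zw
  proof (rule bounded_set_imp_lmeasurable)
    show "bounded (E m zw)"
      by (rule bounded_subset[OF bounded_cball[of 0 "real m"]]) (auto simp: E_def split: prod.splits)
    have [measurable]: "(\<lambda>x :: real^'n. x) \<in> borel_measurable lebesgue"
      by (intro measurable_completion) simp
    have [measurable]: "(\<lambda>x. \<lfloor>log 2 \<bar>f x\<bar>\<rfloor>) \<in> measurable lebesgue (count_space UNIV)"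
      "(\<lambda>x. \<lfloor>log 2 \<bar>g x\<bar>\<rfloor>) \<in> measurable lebesgue (count_space UNIV)"
      by measurable
    have "{x \<in> space lebesgue. norm x \<le> real m \<and> f x \<noteq> 0 \<and> g x \<noteq> 0 \<and>
      \<lfloor>log 2 \<bar>f x\<bar>\<rfloor> = fst zw \<and> \<lfloor>log 2 \<bar>g x\<bar>\<rfloor> = snd zw} \<in> sets lebesgue"
      by measurable
    then show "E m zw \<in> sets lebesgue" by (simp add: E_def case_prod_unfold)
  qed
  have E_disj: "disjoint_family_on (E m) (I m)" for m
    by (auto simp: disjoint_family_on_def E_def)
  have D_eq: "D m = (\<Union>zw\<in>I m. E m zw)" for m
    by (auto simp: D_def E_def I_def abs_le_iff)
  have D_meas: "D m \<in> sets lebesgue" for m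
    unfolding D_eq using E_meas by (intro sets.finite_UN I fmeasurableD)
  define a where "a zw = 2 powr real_of_int (fst zw)" for zw :: "int \<times> int"
  define b where "b zw = 2 powr real_of_int (snd zw)" for zw :: "int \<times> int"
  have E_bounds: "a zw \<le> \<bar>f x\<bar>" "\<bar>f x\<bar> \<le> 2 * a zw" "b zw \<le> \<bar>g x\<bar>" "\<bar>g x\<bar> \<le> 2 * b zw" if "x \<in> E m zw" for m zw x
  proof -
    obtain z w where zw: "zw = (z, w)" by (cases zw)
    have "f x \<noteq> 0" "g x \<noteq> 0" "\<lfloor>log 2 \<bar>f x\<bar>\<rfloor> = z" "\<lfloor>log 2 \<bar>g x\<bar>\<rfloor> = w" using that by (auto simp: E_def zw)
    then have "2 powr z \<le> \<bar>f x\<bar> \<and> \<bar>f x\<bar> < 2 powr (z + 1)" "2 powr w \<le> \<bar>g x\<bar> \<and> \<bar>g x\<bar> < 2 powr (w + 1)"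
      by (auto simp: floor_log_eq_powr_iff)
    then show "a zw \<le> \<bar>f x\<bar>" "\<bar>f x\<bar> \<le> 2 * a zw" "b zw \<le> \<bar>g x\<bar>" "\<bar>g x\<bar> \<le> 2 * b zw"
      by (auto simp: a_def b_def zw powr_add)
  qed
  have step_le: "(\<Sum>zw\<in>I m. c zw * indicator (E m zw) x) \<le> u" if "\<And>zw. x \<in> E m zw \<Longrightarrow> c zw \<le> u" "0 \<le> u"
    for c :: "int \<times> int \<Rightarrow> real" and m x u
  proof (cases "\<exists>zw\<in>I m. x \<in> E m zw")
    case True
    then obtain zw where "zw \<in> I m" "x \<in> E m zw" by blast
    then show ?thesis using step_value[OF I E_disj] that by simp
  next
    case False
    then show ?thesis using that step_value_outside[of "I m" x "E m" c] by simp
  qed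
  let ?R = "ennreal (2 * (real G_count * C)) * ennpowr (X f) (1 - \<theta>) * ennpowr (Y g) \<theta>"
  have h_meas: "h \<in> L0" unfolding L0_def h_def by measurable
  have hD_meas: "(\<lambda>x. h x * indicator (D m) x) \<in> L0" for m
    using h_meas D_meas unfolding L0_def by (intro borel_measurable_times borel_measurable_indicator)
  have bound: "B (\<lambda>x. h x * indicator (D m) x) \<le> ?R" for m
  proof -
    let ?s = "\<lambda>x. \<Sum>zw\<in>I m. a zw powr (1 - \<theta>) * b zw powr \<theta> * indicator (E m zw) x"
    have s: "?s \<in> L0" by (rule B.step_L0[OF E_meas])
    have s_nonneg: "0 \<le> ?s x" for x by (intro sum_nonneg) auto
    have "B (\<lambda>x. h x * indicator (D m) x) \<le> B (\<lambda>x. 2 * ?s x)"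
    proof (intro B.norm_mono hD_meas AE_I2)
      show "(\<lambda>x. 2 * ?s x) \<in> L0"
        using s unfolding L0_def by (rule borel_measurable_times[OF borel_measurable_const])
      fix x
      show "\<bar>h x * indicator (D m) x\<bar> \<le> \<bar>2 * ?s x\<bar>"
      proof (cases "x \<in> D m")
        case True
        then obtain zw where zw: "zw \<in> I m" "x \<in> E m zw" unfolding D_eq by blast
        have "h x \<le> (2 * a zw) powr (1 - \<theta>) * (2 * b zw) powr \<theta>"
          unfolding h_def using E_bounds[OF zw(2)] \<theta> by (intro mult_mono powr_mono2) auto
        also have "\<dots> = (2 powr (1 - \<theta>) * 2 powr \<theta>) * (a zw powr (1 - \<theta>) * b zw powr \<theta>)"
          by (simp add: powr_mult a_def b_def)
        also have "2 powr (1 - \<theta>) * 2 powr \<theta> = (2::real)" by (simp flip: powr_add)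
        also have "a zw powr (1 - \<theta>) * b zw powr \<theta> = ?s x" using step_value[OF I E_disj zw] by simp
        finally have "h x \<le> 2 * ?s x" .
        moreover have "0 \<le> h x" by (simp add: h_def)
        ultimately show ?thesis using True by simp
      qed (use s_nonneg in simp)
    qed
    also have "\<dots> = 2 * B ?s" using B.norm_scale[OF s, of 2] by simp
    also have "B ?s \<le> ennreal (real G_count * C) * ennpowr (X (\<lambda>x. \<Sum>zw\<in>I m. a zw * indicator (E m zw) x)) (1 - \<theta>)
          * ennpowr (Y (\<lambda>x. \<Sum>zw\<in>I m. b zw * indicator (E m zw) x)) \<theta>"
      by (rule step_inequality[OF I E_disj E_meas]) (auto simp: a_def b_def)
    also have "\<dots> \<le> ennreal (real G_count * C) * ennpowr (X f) (1 - \<theta>) * ennpowr (Y g) \<theta>"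
    proof (intro mult_mono ennpowr_mono order_refl)
      have le: "(\<Sum>zw\<in>I m. a zw * indicator (E m zw) x) \<le> \<bar>f x\<bar>"
        "(\<Sum>zw\<in>I m. b zw * indicator (E m zw) x) \<le> \<bar>g x\<bar>" for x
        by (rule step_le[OF E_bounds(1)], assumption, simp) (rule step_le[OF E_bounds(3)], assumption, simp)
      have nonneg: "0 \<le> (\<Sum>zw\<in>I m. a zw * indicator (E m zw) x)"
        "0 \<le> (\<Sum>zw\<in>I m. b zw * indicator (E m zw) x)" for x
        by (intro sum_nonneg; simp add: a_def b_def)+
      show "X (\<lambda>x. \<Sum>zw\<in>I m. a zw * indicator (E m zw) x) \<le> X f"
        using le nonneg by (intro X.norm_mono f X.step_L0 E_meas AE_I2) simp
      show "Y (\<lambda>x. \<Sum>zw\<in>I m. b zw * indicator (E m zw) x) \<le> Y g"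
        using le nonneg by (intro Y.norm_mono g Y.step_L0 E_meas AE_I2) simp
    qed (use \<theta> in auto)
    finally show ?thesis
      using C by (simp add: ennreal_mult mult.assoc mult_left_mono)
  qed
  have "incseq (\<lambda>m. B (\<lambda>x. h x * indicator (D m) x)) \<and> (\<lambda>m. B (\<lambda>x. h x * indicator (D m) x)) \<longlonglongrightarrow> B h"
  proof (intro B.norm_Fatou hD_meas h_meas AE_I2 conjI allI)
    fix x m
    have h0: "0 \<le> h x" by (simp add: h_def)
    then show "0 \<le> h x * indicator (D m) x" by simp
    have D_mono: "D m \<subseteq> D m'" if "m \<le> m'" for m m' unfolding D_def using that by auto
    then show "incseq (\<lambda>m. h x * indicator (D m) x)"
      unfolding incseq_def using h0 by (auto simp: indicator_def)
    show "(\<lambda>m. h x * indicator (D m) x) \<longlonglongrightarrow> h x"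
    proof (cases "f x = 0 \<or> g x = 0")
      case True
      \<comment> \<open>The sets \<open>D m\<close> omit the zeros of \<open>f\<close> and
        \<open>g\<close>; there the product vanishes because \<open>0 powr p = 0\<close>.\<close>
      then have "h x = 0" by (auto simp: h_def)
      then show ?thesis by simp
    next
      case False
      define m0 where "m0 = nat \<lceil>norm x\<rceil> + (nat \<bar>\<lfloor>log 2 \<bar>f x\<bar>\<rfloor>\<bar> + nat \<bar>\<lfloor>log 2 \<bar>g x\<bar>\<rfloor>\<bar>)"
      have "norm x \<le> real (nat \<lceil>norm x\<rceil>)" by (rule real_nat_ceiling_ge)
      also have "\<dots> \<le> real m0" unfolding m0_def of_nat_add by simp
      finally have "norm x \<le> real m0" .
      moreover have "\<bar>\<lfloor>log 2 \<bar>f x\<bar>\<rfloor>\<bar> \<le> int m0" "\<bar>\<lfloor>log 2 \<bar>g x\<bar>\<rfloor>\<bar> \<le> int m0"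
        unfolding m0_def of_nat_add by simp_all
      ultimately have "x \<in> D m0" using False unfolding D_def by blast
      then have "x \<in> D m" if "m0 \<le> m" for m by (rule subsetD[OF D_mono[OF that]])
      then have "\<forall>m\<ge>m0. h x * indicator (D m) x = h x" by simp
      then have "\<forall>\<^sub>F m in sequentially. h x * indicator (D m) x = h x"
        unfolding eventually_sequentially by (rule exI)
      then show ?thesis by (rule tendsto_eventually)
    qed
  qed
  then have "B h \<le> ?R"
    by (rule LIMSEQ_le_const2[OF conjunct2]) (simp only: bound, simp)
  then show ?thesis unfolding h_def .
qed

lemma continuous_embedding:
  "continuously_embedded (CL_space X Y \<theta>) (CL_norm X Y \<theta>) (fspace B) B"
proof -
  define K where "K = 2 * (real G_count * C)"
  have K: "K > 0" using C G_count by (simp add: K_def)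
  have bound: "B h \<le> ennreal K * (ennpowr (X f) (1 - \<theta>) * ennpowr (Y g) \<theta>)"
    if "h \<in> L0" "(f, g) \<in> CL_pairs X Y \<theta> h" for h f g
  proof -
    have fg: "f \<in> L0" "g \<in> L0" "AE x in lebesgue. \<bar>h x\<bar> \<le> \<bar>f x\<bar> powr (1 - \<theta>) * \<bar>g x\<bar> powr \<theta>"
      using that(2) by (auto simp: CL_pairs_def fspace_def)
    have "B h \<le> B (\<lambda>x. \<bar>f x\<bar> powr (1 - \<theta>) * \<bar>g x\<bar> powr \<theta>)"
    proof (rule B.norm_mono)
      show "(\<lambda>x. \<bar>f x\<bar> powr (1 - \<theta>) * \<bar>g x\<bar> powr \<theta>) \<in> L0" using fg(1,2) unfolding L0_def by measurable
    qed (use that fg in auto)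
    also have "\<dots> \<le> ennreal K * (ennpowr (X f) (1 - \<theta>) * ennpowr (Y g) \<theta>)"
      using product_inequality[OF fg(1,2)] by (simp add: K_def mult.assoc)
    finally show ?thesis .
  qed
  show ?thesis
    unfolding continuously_embedded_def
  proof (intro conjI exI[of _ K] ballI subsetI K)
    fix h assume h: "h \<in> CL_space X Y \<theta>"
    then obtain f g where fg: "(f, g) \<in> CL_pairs X Y \<theta> h" by (auto simp: CL_space_def)
    have L0: "h \<in> L0" using h by (simp add: CL_space_def)
    have "X f < top" "Y g < top" using fg by (auto simp: CL_pairs_def fspace_def)
    then have "ennreal K * (ennpowr (X f) (1 - \<theta>) * ennpowr (Y g) \<theta>) < top"
      by (simp add: ennreal_mult_less_top ennpowr_less_top)
    with bound[OF L0 fg] show "h \<in> fspace B" using L0 by (auto simp: fspace_def)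
  next
    fix h assume "h \<in> CL_space X Y \<theta>"
    then have L0: "h \<in> L0" by (simp add: CL_space_def)
    \<comment> \<open>With the constant moved to the left, the bound for each admissible pair is a
      lower bound for the infimum that defines the norm.\<close>
    have "B h / ennreal K \<le> CL_norm X Y \<theta> h"
      unfolding CL_norm_def using K bound[OF L0]
      by (intro INF_greatest) (auto intro!: divide_le_posI_ennreal)
    then have "ennreal K * (B h / ennreal K) \<le> ennreal K * CL_norm X Y \<theta> h" by (rule mult_left_mono) simp
    then show "B h \<le> ennreal K * CL_norm X Y \<theta> h"
      using K by (simp add: ennreal_mult_divide_eq ennreal_times_divide mult.commute[of "ennreal K"])
  qed
qed

end

section \<open>Sums of rescaled bumps\<close>

lemma mem_cell_iff:
  assumes "r > 0"
  shows "x \<in> cell p r S \<longleftrightarrow> (1 / r) *\<^sub>R (x - vec (real p)) \<in> S"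
proof
  assume "(1 / r) *\<^sub>R (x - vec (real p)) \<in> S"
  moreover have "x = r *\<^sub>R ((1 / r) *\<^sub>R (x - vec (real p))) + vec (real p)" using assms by simp
  ultimately show "x \<in> cell p r S" unfolding cell_def by blast
qed (use assms in \<open>auto simp: cell_def\<close>)

text \<open>\<open>bump 0\<close> is the fixed bump on the unit cube, and
  \<open>bump \<alpha>\<close> is its partial derivative with multi-index \<alpha> in closed
  form.\<close>

definition bump :: "nat^'n \<Rightarrow> real^'n \<Rightarrow> real"
  where "bump \<alpha> = tens (\<lambda>_. cutoff 1 0 1) (\<lambda>i. \<alpha> $ i)"

lemma bump_outside: "y \<notin> box 0 1 \<Longrightarrow> bump \<alpha> y = 0"
proof -
  assume "y \<notin> box 0 1"
  then have "\<exists>i. y $ i \<notin> {0<..<1}" by (auto simp: mem_box_cart)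
  then obtain i where "y $ i \<notin> {0<..<1}" ..
  then have "cutoff 1 0 1 (\<alpha> $ i) (y $ i) = 0" by (intro cutoff_outside) auto
  then show ?thesis unfolding bump_def tens_def by (intro prod_zero) auto
qed

lemma bump_0_bounds: "\<bar>bump 0 y\<bar> \<le> 1"
  unfolding bump_def tens_def abs_prod using cutoff_0_bounds by (intro prod_le_1) auto

lemma mi_order_ge: "\<alpha> $ i \<le> mi_order \<alpha>"
  unfolding mi_order_def by (rule member_le_sum) auto

lemma bump_bounded:
  obtains K where "K \<ge> 1" "\<And>(\<alpha> :: nat^'n) y. mi_order \<alpha> = k \<Longrightarrow> \<bar>bump \<alpha> y\<bar> \<le> K"
proof -
  obtain K where K: "K \<ge> 1" "\<And>m t. m \<le> k \<Longrightarrow> \<bar>cutoff 1 0 1 m t\<bar> \<le> K"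
    using cutoff_bounded by metis
  show thesis
  proof
    show "K ^ CARD('n) \<ge> 1" using K(1) by (rule one_le_power)
    fix \<alpha> :: "nat^'n" and y assume "mi_order \<alpha> = k"
    then have "\<alpha> $ i \<le> k" for i using mi_order_ge[of \<alpha> i] by simp
    then have "\<bar>bump \<alpha> y\<bar> \<le> (\<Prod>i\<in>(UNIV :: 'n set). K)"
      unfolding bump_def tens_def abs_prod by (intro prod_mono conjI K(2)) auto
    then show "\<bar>bump \<alpha> y\<bar> \<le> K ^ CARD('n)" by simp
  qed
qed

text \<open>All \<open>j\<close> differentiations go into a single coordinate. The derivative is
  then nonzero at some point, since the remaining factors are undifferentiated and positive at 1/2.
  Half its absolute value there serves as level, and the superlevel set is open and nonempty, hence
  of positive measure.\<close>

lemma bump_level_set: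
  obtains \<alpha> :: "nat^'n" and c :: real where "mi_order \<alpha> = j" "c > 0"
    "{y. c < \<bar>bump \<alpha> y\<bar>} \<in> lmeasurable" "{y. c < \<bar>bump \<alpha> y\<bar>} \<subseteq> box 0 1"
    "0 < measure lebesgue {y. c < \<bar>bump \<alpha> y\<bar>}"
proof -
  obtain i0 :: 'n where True by auto
  define \<alpha> :: "nat^'n" where "\<alpha> = (\<chi> i. if i = i0 then j else 0)"
  have \<alpha>: "mi_order \<alpha> = j" by (simp add: mi_order_def \<alpha>_def)
  obtain t where t: "cutoff 1 0 1 j t \<noteq> 0" using cutoff_deriv_nonzero by blast
  define y :: "real^'n" where "y = (\<chi> i. if i = i0 then t else 1 / 2)"
  have "cutoff 1 0 1 0 (1 / 2) \<noteq> 0" by (simp add: cutoff_0 flat_0)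
  then have y: "bump \<alpha> y \<noteq> 0"
    unfolding bump_def tens_def using t by (auto simp: y_def \<alpha>_def)
  define c where "c = \<bar>bump \<alpha> y\<bar> / 2"
  have c: "c > 0" using y by (simp add: c_def)
  let ?G = "{y. c < \<bar>bump \<alpha> y\<bar>}"
  have "continuous_on UNIV (bump \<alpha>)" unfolding bump_def by (intro tens_continuous deriv_seq_cutoff)
  then have op: "open ?G" by (intro open_Collect_less continuous_intros)
  have sub: "?G \<subseteq> box 0 1"
  proof
    fix y assume "y \<in> ?G"
    then have "bump \<alpha> y \<noteq> 0" using c by auto
    then show "y \<in> box 0 1" using bump_outside by blast
  qed
  have meas: "?G \<in> lmeasurable"
    using bounded_subset[OF bounded_box sub] op by (rule lmeasurable_open)
  have "y \<in> ?G" using y by (simp add: c_def)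
  then have "\<not> negligible ?G" using op open_not_negligible by blast
  then have "0 < measure lebesgue ?G"
    using meas by (metis negligible_iff_measure zero_less_measure_iff)
  with \<alpha> c meas sub show thesis by (rule that)
qed

text \<open>For \<open>r > 0\<close>, the derivative sequence of the profile transplanted to the
  interval from \<open>p\<close> to \<open>p + r\<close>, the same in every coordinate; the power of
  \<open>1 / r\<close> comes from the chain rule.\<close>

definition bump_seq :: "nat \<Rightarrow> real \<Rightarrow> 'n \<Rightarrow> nat \<Rightarrow> real \<Rightarrow> real"
  where "bump_seq p r = (\<lambda>i m t. (1 / r) ^ m * cutoff 1 0 1 m (1 / r * t + - (real p / r)))"

lemma deriv_seq_bump_seq: "deriv_seq (bump_seq p r i)"
  unfolding bump_seq_def by (rule deriv_seq_affine[OF deriv_seq_cutoff])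

lemma tens_bump_seq:
  "tens (bump_seq p r) (\<lambda>i. \<alpha> $ i) x = (1 / r) ^ mi_order \<alpha> * bump \<alpha> ((1 / r) *\<^sub>R (x - vec (real p)))"
  unfolding tens_def bump_seq_def bump_def mi_order_def prod.distrib power_sum
  by (simp add: diff_divide_distrib)

text \<open>With multi-index 0 this is the function inserted into the interpolation inequality; the
  other multi-indices give its derivatives.\<close>

definition bumps :: "nat set \<Rightarrow> (nat \<Rightarrow> real) \<Rightarrow> (nat \<Rightarrow> real) \<Rightarrow> nat^'n \<Rightarrow> real^'n \<Rightarrow> real"
  where "bumps L A r \<alpha> x = (\<Sum>p\<in>L. A p * tens (bump_seq p (r p)) (\<lambda>i. \<alpha> $ i) x)"

lemma bumps_continuous: "continuous_on S (bumps L A r \<alpha>)"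
  unfolding bumps_def by (intro continuous_intros tens_continuous deriv_seq_bump_seq)

lemma bumps_L0: "bumps L A r \<alpha> \<in> L0"
  unfolding L0_def by (intro borel_measurable_continuous_lebesgue bumps_continuous)

lemma has_weak_deriv_bumps:
  fixes \<alpha> :: "nat^'n"
  shows "finite L \<Longrightarrow> has_weak_deriv \<alpha> (bumps L A r 0) (bumps L A r \<alpha>)"
proof -
  have 0: "(\<lambda>i. (0 :: nat^'n) $ i) = (\<lambda>_. 0)" by (rule ext) simp
  show "finite L \<Longrightarrow> has_weak_deriv \<alpha> (bumps L A r 0) (bumps L A r \<alpha>)"
    unfolding bumps_def[abs_def] 0 by (rule has_weak_deriv_sum_tens[OF deriv_seq_bump_seq])
qed

section \<open>Pointwise and norm estimates for one sum of bumps\<close>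

locale bump_family =
  fixes L :: "nat set" and A r :: "nat \<Rightarrow> real" and r0 :: real
  assumes L: "finite L" and Ar: "\<And>p. p \<in> L \<Longrightarrow> 0 < A p \<and> 0 < r p \<and> r p \<le> r0" and r0: "r0 \<le> 1"
begin

lemma r_pos: "p \<in> L \<Longrightarrow> 0 < r p" and r_le: "p \<in> L \<Longrightarrow> r p \<le> r0" "p \<in> L \<Longrightarrow> r p \<le> 1"
  and A_pos: "p \<in> L \<Longrightarrow> 0 < A p"
  using Ar[of p] r0 by auto

lemma bumps_le:
  fixes x :: "real^'n"
  assumes "\<And>y :: real^'n. \<bar>bump \<alpha> y\<bar> \<le> K"
  shows "\<bar>bumps L A r \<alpha> x\<bar> \<le> K * (\<Sum>p\<in>L. A p / r p ^ mi_order \<alpha> * indicator (cell p (r p) (box 0 1)) x)"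
proof -
  have "\<bar>A p * tens (bump_seq p (r p)) (\<lambda>i. \<alpha> $ i) x\<bar>
      \<le> K * (A p / r p ^ mi_order \<alpha> * indicator (cell p (r p) (box 0 1)) x)" if p: "p \<in> L" for p
  proof (cases "x \<in> cell p (r p) (box 0 1)")
    case True
    have "A p / r p ^ mi_order \<alpha> * \<bar>bump \<alpha> ((1 / r p) *\<^sub>R (x - vec (real p)))\<bar> \<le> A p / r p ^ mi_order \<alpha> * K"
      using assms r_pos[OF p] A_pos[OF p] by (intro mult_left_mono) auto
    then show ?thesis using True r_pos[OF p] A_pos[OF p]
      by (simp add: tens_bump_seq abs_mult power_one_over field_simps)
  next
    case False
    then show ?thesis using r_pos[OF p] by (simp add: mem_cell_iff tens_bump_seq bump_outside)
  qed
  then have "\<bar>bumps L A r \<alpha> x\<bar> \<le> (\<Sum>p\<in>L. K * (A p / r p ^ mi_order \<alpha> * indicator (cell p (r p) (box 0 1)) x))"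
    unfolding bumps_def by (intro order_trans[OF sum_abs] sum_mono)
  then show ?thesis by (simp only: sum_distrib_left)
qed

lemma bumps_in_cell:
  fixes x :: "real^'n"
  assumes p: "p \<in> L" and x: "x \<in> cell p (r p) (box 0 1)"
  shows "bumps L A r \<alpha> x = A p / r p ^ mi_order \<alpha> * bump \<alpha> ((1 / r p) *\<^sub>R (x - vec (real p)))"
proof -
  have "A q * tens (bump_seq q (r q)) (\<lambda>i. \<alpha> $ i) x = 0" if q: "q \<in> L - {p}" for q
  proof -
    have "x \<notin> cell q (r q) (box 0 1)"
      using cell_disjoint[of "box 0 1" "box 0 1" "r p" "r q" p q] p q x r_pos r_le by blast
    then show ?thesis using r_pos[of q] q by (simp add: mem_cell_iff tens_bump_seq bump_outside)
  qed
  then have "(\<Sum>q\<in>L - {p}. A q * tens (bump_seq q (r q)) (\<lambda>i. \<alpha> $ i) x) = 0" by (intro sum.neutral ballI)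
  then have "bumps L A r \<alpha> x = A p * tens (bump_seq p (r p)) (\<lambda>i. \<alpha> $ i) x"
    unfolding bumps_def using L p by (subst sum.remove[of L p]) auto
  then show ?thesis by (simp add: tens_bump_seq power_one_over)
qed

lemma bumps_outside_cells:
  fixes x :: "real^'n"
  assumes "\<And>p. p \<in> L \<Longrightarrow> x \<notin> cell p (r p) (box 0 1)"
  shows "bumps L A r \<alpha> x = 0"
  unfolding bumps_def
  using assms r_pos by (intro sum.neutral) (auto simp: mem_cell_iff tens_bump_seq bump_outside)

lemma disjoint_cells:
  fixes S :: "(real^'n) set"
  assumes "S \<subseteq> box 0 1"
  shows "disjoint_family_on (\<lambda>p. cell p (r p) S) L"
  unfolding disjoint_family_on_def using assms r_pos r_le by (intro ballI impI cell_disjoint) auto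

text \<open>The cells are disjoint, so at most one summand is nonzero at \<open>x\<close> and a
  bound on its coefficient bounds the whole sum.\<close>

lemma cell_sum_le:
  fixes x :: "real^'n" and c :: "nat \<Rightarrow> real"
  assumes "S \<subseteq> box 0 1" "0 \<le> u" "\<And>p. p \<in> L \<Longrightarrow> x \<in> cell p (r p) S \<Longrightarrow> c p \<le> u"
  shows "(\<Sum>p\<in>L. c p * indicator (cell p (r p) S) x) \<le> u"
proof (cases "\<exists>p\<in>L. x \<in> cell p (r p) S")
  case True
  then obtain p where "p \<in> L" "x \<in> cell p (r p) S" by blast
  then show ?thesis using step_value[OF L disjoint_cells[OF assms(1)]] assms(3) by simp
next
  case False
  then show ?thesis using assms(2) by (subst step_value_outside) auto
qed

lemma X_bumps_le:
  assumes "ri_banach_function_space X"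
  shows "X (bumps L A r 0) \<le> X (\<lambda>x :: real^'n. \<Sum>p\<in>L. A p * indicator (cell p (r p) (box 0 1)) x)"
proof -
  interpret X: ri_banach_function_space X by fact
  show ?thesis
  proof (intro X.norm_mono X.step_L0 cell_lmeasurable lmeasurable_box bumps_L0 AE_I2)
    fix x :: "real^'n"
    have "\<bar>bumps L A r 0 x\<bar> \<le> (\<Sum>p\<in>L. A p * indicator (cell p (r p) (box 0 1)) x)"
      using bumps_le[OF bump_0_bounds, of x] by (simp add: mi_order_def)
    then show "\<bar>bumps L A r 0 x\<bar> \<le> \<bar>\<Sum>p\<in>L. A p * indicator (cell p (r p) (box 0 1)) x\<bar>" by linarith
  qed
qed

lemma bumps_fspace:
  assumes "ri_banach_function_space X"
  shows "(bumps L A r \<alpha> :: real^'n \<Rightarrow> real) \<in> fspace X"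
proof -
  interpret X: ri_banach_function_space X by fact
  obtain K where K: "\<And>y :: real^'n. \<bar>bump \<alpha> y\<bar> \<le> K" using bump_bounded[of "mi_order \<alpha>"] by metis
  let ?s = "\<lambda>x :: real^'n. \<Sum>p\<in>L. (K * (A p / r p ^ mi_order \<alpha>)) * indicator (cell p (r p) (box 0 1)) x"
  have "X (bumps L A r \<alpha>) \<le> X ?s"
  proof (intro X.norm_mono X.step_L0 cell_lmeasurable lmeasurable_box bumps_L0 AE_I2)
    fix x :: "real^'n"
    have "\<bar>bumps L A r \<alpha> x\<bar> \<le> ?s x"
      using bumps_le[OF K, of x] by (simp only: sum_distrib_left mult.assoc)
    then show "\<bar>bumps L A r \<alpha> x\<bar> \<le> \<bar>?s x\<bar>" by linarith
  qed
  also have "?s \<in> fspace X"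
    by (rule X.step_fspace[OF L]) (intro cell_lmeasurable lmeasurable_box)
  then have "X ?s < \<infinity>" by (simp only: fspace_def mem_Collect_eq)
  finally show ?thesis using bumps_L0 by (auto simp: fspace_def)
qed

lemma bumps_hom_sobolev:
  assumes "ri_banach_function_space Y"
  shows "(bumps L A r 0 :: real^'n \<Rightarrow> real) \<in> hom_sobolev k Y"
  unfolding hom_sobolev_def
  using has_weak_deriv_bumps[OF L] bumps_fspace[OF assms] locally_integrable_continuous[OF bumps_continuous]
  by blast

lemma abs_grad_bumps_L0: "abs_grad k (bumps L A r 0) \<in> L0"
  by (rule abs_grad_L0[OF has_weak_deriv_bumps[OF L] bumps_L0])

lemma abs_grad_bumps_AE:
  "AE x in lebesgue. abs_grad k (bumps L A r 0) x = sqrt (\<Sum>\<alpha> | mi_order \<alpha> = k. (bumps L A r \<alpha> x)\<^sup>2)"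
  by (rule abs_grad_AE_eq[OF has_weak_deriv_bumps[OF L]])

text \<open>The Euclidean length of the vector of derivatives is at most the sum of their absolute
  values, which brings in the number of multi-indices of order \<open>k\<close>.\<close>

lemma Y_abs_grad_bumps_le:
  fixes Y :: "(real^'n \<Rightarrow> real) \<Rightarrow> ennreal"
  assumes "ri_banach_function_space Y" and K: "\<And>(\<alpha> :: nat^'n) y. mi_order \<alpha> = k \<Longrightarrow> \<bar>bump \<alpha> y\<bar> \<le> K" "0 \<le> K"
  shows "Y (abs_grad k (bumps L A r 0))
    \<le> ennreal (real (card {\<alpha> :: nat^'n. mi_order \<alpha> = k}) * K) *
        Y (\<lambda>x. \<Sum>p\<in>L. A p / r p ^ k * indicator (cell p (r p) (box 0 1)) x)"
proof -
  interpret Y: ri_banach_function_space Y by fact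
  let ?M = "real (card {\<alpha> :: nat^'n. mi_order \<alpha> = k}) * K"
  let ?s = "\<lambda>x :: real^'n. \<Sum>p\<in>L. A p / r p ^ k * indicator (cell p (r p) (box 0 1)) x"
  have s: "?s \<in> L0" by (intro Y.step_L0 cell_lmeasurable lmeasurable_box)
  have "Y (abs_grad k (bumps L A r 0)) \<le> Y (\<lambda>x. ?M * ?s x)"
  proof (intro Y.norm_mono abs_grad_bumps_L0)
    show "(\<lambda>x. ?M * ?s x) \<in> L0"
      using s unfolding L0_def by (rule borel_measurable_times[OF borel_measurable_const])
    show "AE x in lebesgue. \<bar>abs_grad k (bumps L A r 0) x\<bar> \<le> \<bar>?M * ?s x\<bar>"
      using abs_grad_bumps_AE[of k]
    proof eventually_elim
      case (elim x)
      have "sqrt (\<Sum>\<alpha> | mi_order \<alpha> = k. (bumps L A r \<alpha> x)\<^sup>2) \<le> (\<Sum>\<alpha> | mi_order \<alpha> = k. \<bar>bumps L A r \<alpha> x\<bar>)"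
        using L2_set_le_sum_abs[of "\<lambda>\<alpha>. bumps L A r \<alpha> x" "{\<alpha>. mi_order \<alpha> = k}"]
        by (simp add: L2_set_def)
      also have "\<dots> \<le> (\<Sum>\<alpha> :: nat^'n | mi_order \<alpha> = k. K * ?s x)"
      proof (rule sum_mono)
        fix \<alpha> :: "nat^'n" assume "\<alpha> \<in> {\<alpha>. mi_order \<alpha> = k}"
        then have "mi_order \<alpha> = k" by simp
        then show "\<bar>bumps L A r \<alpha> x\<bar> \<le> K * ?s x" using bumps_le[OF K(1), of \<alpha> x] by simp
      qed
      also have "\<dots> = ?M * ?s x" by simp
      finally have "sqrt (\<Sum>\<alpha> | mi_order \<alpha> = k. (bumps L A r \<alpha> x)\<^sup>2) \<le> ?M * ?s x" .
      moreover have "0 \<le> sqrt (\<Sum>\<alpha> | mi_order \<alpha> = k. (bumps L A r \<alpha> x)\<^sup>2)"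
        by (intro real_sqrt_ge_zero sum_nonneg) simp
      ultimately show ?case using elim by linarith
    qed
  qed
  also have "\<dots> = ennreal ?M * Y ?s" using Y.norm_scale[OF s, of ?M] K(2) by simp
  finally show ?thesis .
qed

end

text \<open>The shared last step towards \<open>cell_ineq\<close>: \<open>T\<close> stands for the
  left-hand side of the interpolation inequality at the sum of bumps, in either assertion, and
  \<open>lower\<close> for the lower bound specific to it.\<close>

lemma combine_cell_bounds:
  assumes "ri_banach_function_space X" "ri_banach_function_space Y"
    and \<theta>: "0 < \<theta>" "\<theta> < 1" and c: "0 < c" and C: "0 < C" and K: "1 \<le> K"
    and "bump_family L A r r0"
    and bump_K: "\<And>(\<alpha> :: nat^'n) y. mi_order \<alpha> = k \<Longrightarrow> \<bar>bump \<alpha> y\<bar> \<le> K"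
    and lower: "ennreal c * b \<le> T"
    and T: "T \<le> ennreal C * ennpowr (X (bumps L A r 0)) (1 - \<theta>) * ennpowr (Y (abs_grad k (bumps L A r (0 :: nat^'n)))) \<theta>"
  shows "b \<le> ennreal (C * (real (card {\<alpha> :: nat^'n. mi_order \<alpha> = k}) * K + 1) powr \<theta> / c) *
     ennpowr (X (\<lambda>x. \<Sum>p\<in>L. A p * indicator (cell p (r p) (box 0 1)) x)) (1 - \<theta>) *
     ennpowr (Y (\<lambda>x. \<Sum>p\<in>L. A p / r p ^ k * indicator (cell p (r p) (box 0 1)) x)) \<theta>"
proof -
  interpret bump_family L A r r0 by fact
  define M where "M = real (card {\<alpha> :: nat^'n. mi_order \<alpha> = k}) * K"
  have M: "0 \<le> M" using K by (simp add: M_def)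
  let ?X = "X (\<lambda>x. \<Sum>p\<in>L. A p * indicator (cell p (r p) (box 0 1)) x)"
  let ?Y = "Y (\<lambda>x. \<Sum>p\<in>L. A p / r p ^ k * indicator (cell p (r p) (box 0 1)) x)"
  have "Y (abs_grad k (bumps L A r 0)) \<le> ennreal M * ?Y"
    using Y_abs_grad_bumps_le[OF assms(2) bump_K] K by (simp add: M_def)
  \<comment> \<open>The added 1 makes the factor visibly positive, as \<open>ennpowr_cmult\<close>
    requires.\<close>
  also have "\<dots> \<le> ennreal (M + 1) * ?Y" using M by (intro mult_right_mono ennreal_leI) auto
  finally have "ennpowr (Y (abs_grad k (bumps L A r 0))) \<theta> \<le> ennpowr (ennreal (M + 1) * ?Y) \<theta>"
    using \<theta> by (intro ennpowr_mono) auto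
  also have "\<dots> = ennreal ((M + 1) powr \<theta>) * ennpowr ?Y \<theta>" using M by (intro ennpowr_cmult) auto
  finally have Y: "ennpowr (Y (abs_grad k (bumps L A r 0))) \<theta> \<le> ennreal ((M + 1) powr \<theta>) * ennpowr ?Y \<theta>" .
  have X: "ennpowr (X (bumps L A r 0)) (1 - \<theta>) \<le> ennpowr ?X (1 - \<theta>)"
    using \<theta> by (intro ennpowr_mono X_bumps_le assms(1)) auto
  have "ennreal c * b \<le> ennreal C * ennpowr ?X (1 - \<theta>) * (ennreal ((M + 1) powr \<theta>) * ennpowr ?Y \<theta>)"
    by (intro order_trans[OF lower] order_trans[OF T] mult_mono X Y) auto
  then have "ennreal (1 / c) * (ennreal c * b) \<le> ennreal (1 / c) * (ennreal C * ennpowr ?X (1 - \<theta>) * (ennreal ((M + 1) powr \<theta>) * ennpowr ?Y \<theta>))"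
    by (rule mult_left_mono) simp
  also have "ennreal (1 / c) * (ennreal c * b) = b"
    using c by (simp add: mult.assoc[symmetric] ennreal_mult[symmetric])
  also have "ennreal (1 / c) * (ennreal C * ennpowr ?X (1 - \<theta>) * (ennreal ((M + 1) powr \<theta>) * ennpowr ?Y \<theta>))
    = (ennreal (1 / c) * ennreal C * ennreal ((M + 1) powr \<theta>)) * ennpowr ?X (1 - \<theta>) * ennpowr ?Y \<theta>"
    by (simp only: mult_ac)
  also have "ennreal (1 / c) * ennreal C * ennreal ((M + 1) powr \<theta>) = ennreal (C * (M + 1) powr \<theta> / c)"
    using c C by (simp add: ennreal_mult[symmetric])
  finally show ?thesis unfolding M_def .
qed

text \<open>The gradient dominates the single derivative with multi-index \<alpha>, which in cell
  \<open>p\<close> is a rescaled copy of \<open>bump \<alpha>\<close> multiplied by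
  \<open>A p / r p ^ j\<close>. On the copy of the level set it exceeds \<open>c\<close> times that
  factor.\<close>

lemma gradient_lower_bound:
  assumes "bump_family L A r r0" "ri_banach_function_space B"
    and \<alpha>: "mi_order (\<alpha> :: nat^'n) = j" and c: "0 < c"
    and G: "{y. c < \<bar>bump \<alpha> y\<bar>} \<in> lmeasurable" "{y. c < \<bar>bump \<alpha> y\<bar>} \<subseteq> box 0 1"
  shows "ennreal c * B (\<lambda>x. \<Sum>p\<in>L. A p / r p ^ j * indicator (cell p (r p) {y. c < \<bar>bump \<alpha> y\<bar>}) x)
     \<le> B (abs_grad j (bumps L A r (0 :: nat^'n)))"
proof -
  interpret bump_family L A r r0 by fact
  interpret B: ri_banach_function_space B by fact
  let ?G = "{y. c < \<bar>bump \<alpha> y\<bar>}"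
  let ?s = "\<lambda>x. \<Sum>p\<in>L. A p / r p ^ j * indicator (cell p (r p) ?G) x"
  have s: "?s \<in> L0" by (intro B.step_L0 cell_lmeasurable G)
  have "ennreal c * B ?s = B (\<lambda>x. c * ?s x)" using B.norm_scale[OF s, of c] c by simp
  also have "\<dots> \<le> B (abs_grad j (bumps L A r 0))"
  proof (intro B.norm_mono abs_grad_bumps_L0)
    show "(\<lambda>x. c * ?s x) \<in> L0"
      using s unfolding L0_def by (rule borel_measurable_times[OF borel_measurable_const])
    show "AE x in lebesgue. \<bar>c * ?s x\<bar> \<le> \<bar>abs_grad j (bumps L A r 0) x\<bar>"
      using abs_grad_bumps_AE[of j]
    proof eventually_elim
      case (elim x)
      have "(\<Sum>p\<in>L. (c * (A p / r p ^ j)) * indicator (cell p (r p) ?G) x) \<le> \<bar>bumps L A r \<alpha> x\<bar>"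
      proof (rule cell_sum_le[OF G(2)])
        fix p assume p: "p \<in> L" "x \<in> cell p (r p) ?G"
        then have "x \<in> cell p (r p) (box 0 1)" using G(2) by (auto simp: cell_def)
        then have "\<bar>bumps L A r \<alpha> x\<bar> = A p / r p ^ j * \<bar>bump \<alpha> ((1 / r p) *\<^sub>R (x - vec (real p)))\<bar>"
          using bumps_in_cell[OF p(1), of x \<alpha>] A_pos[OF p(1)] r_pos[OF p(1)] by (simp add: abs_mult \<alpha>)
        moreover have "c < \<bar>bump \<alpha> ((1 / r p) *\<^sub>R (x - vec (real p)))\<bar>"
          using p by (simp add: mem_cell_iff r_pos)
        then have "A p / r p ^ j * c \<le> A p / r p ^ j * \<bar>bump \<alpha> ((1 / r p) *\<^sub>R (x - vec (real p)))\<bar>"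
          using A_pos[OF p(1)] r_pos[OF p(1)] by (intro mult_left_mono) auto
        ultimately show "c * (A p / r p ^ j) \<le> \<bar>bumps L A r \<alpha> x\<bar>"
          by (simp only: mult.commute[of c])
      qed auto
      then have "c * ?s x \<le> \<bar>bumps L A r \<alpha> x\<bar>" by (simp only: sum_distrib_left mult.assoc)
      also have "\<bar>bumps L A r \<alpha> x\<bar> = sqrt ((bumps L A r \<alpha> x)\<^sup>2)" by simp
      also have "\<dots> \<le> sqrt (\<Sum>\<alpha> | mi_order \<alpha> = j. (bumps L A r \<alpha> x)\<^sup>2)"
        using \<alpha> by (intro real_sqrt_le_mono member_le_sum[of \<alpha>] finite_mi_order) auto
      finally have "c * ?s x \<le> abs_grad j (bumps L A r 0) x" using elim by simp
      moreover have "0 \<le> ?s x"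
        using A_pos r_pos by (intro sum_nonneg mult_nonneg_nonneg divide_nonneg_nonneg) (auto intro: less_imp_le)
      ultimately show ?case using c by simp
    qed
  qed
  finally show ?thesis .
qed

text \<open>Derivatives are local, so disjoint cells suffice and the sides may go up to
  \<open>r0 = 1\<close>. The lower bound has the right power of the side because
  \<open>\<theta> * k = j\<close>.\<close>

lemma embedding_from_gradient_inequality:
  fixes X Y B :: "(real^'n \<Rightarrow> real) \<Rightarrow> ennreal"
  assumes X: "ri_banach_function_space X" and Y: "ri_banach_function_space Y" and B: "ri_banach_function_space B"
    and jk: "1 \<le> j" "j < k" and C: "0 < C"
    and ineq: "\<And>f. f \<in> fspace X \<inter> hom_sobolev k Y \<Longrightarrow>
       B (abs_grad j f) \<le> ennreal C * ennpowr (X f) (1 - real j / real k) * ennpowr (Y (abs_grad k f)) (real j / real k)"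
  shows "continuously_embedded (CL_space X Y (real j / real k)) (CL_norm X Y (real j / real k)) (fspace B) B"
proof -
  obtain \<alpha> :: "nat^'n" and c where G: "mi_order \<alpha> = j" "c > 0"
    "{y. c < \<bar>bump \<alpha> y\<bar>} \<in> lmeasurable" "{y. c < \<bar>bump \<alpha> y\<bar>} \<subseteq> box 0 1"
    "0 < measure lebesgue {y. c < \<bar>bump \<alpha> y\<bar>}"
    using bump_level_set by metis
  obtain K where K: "K \<ge> 1" "\<And>(\<alpha> :: nat^'n) y. mi_order \<alpha> = k \<Longrightarrow> \<bar>bump \<alpha> y\<bar> \<le> K"
    using bump_bounded by metis
  define \<theta> where "\<theta> = real j / real k"
  have \<theta>: "0 < \<theta>" "\<theta> < 1" "\<theta> * real k = real j" using jk by (auto simp: \<theta>_def)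
  let ?C = "C * (real (card {\<alpha> :: nat^'n. mi_order \<alpha> = k}) * K + 1) powr \<theta> / c"
  have "cell_inequality X Y B \<theta> ?C 1 k {y. c < \<bar>bump \<alpha> y\<bar>}"
  proof (intro cell_inequality.intro X Y B cell_inequality_axioms.intro)
    have "real (card {\<alpha> :: nat^'n. mi_order \<alpha> = k}) * K + 1 > 0" using K(1) by (simp add: add_nonneg_pos)
    then show "0 < ?C" using C G(2) by simp
    fix L :: "nat set" and A r :: "nat \<Rightarrow> real"
    assume L: "finite L" and Ar: "\<And>p. p \<in> L \<Longrightarrow> 0 < A p \<and> 0 < r p \<and> r p \<le> 1"
    interpret bump_family L A r 1 by unfold_locales (use L Ar in auto)
    have eq: "(\<lambda>x. \<Sum>p\<in>L. A p * r p powr (- (\<theta> * real k)) * indicator (cell p (r p) {y. c < \<bar>bump \<alpha> y\<bar>}) x)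
        = (\<lambda>x. \<Sum>p\<in>L. A p / r p ^ j * indicator (cell p (r p) {y. c < \<bar>bump \<alpha> y\<bar>}) x)"
      using r_pos by (intro ext sum.cong refl) (simp add: \<theta>(3) powr_minus powr_realpow divide_inverse)
    show "B (\<lambda>x. \<Sum>p\<in>L. A p * r p powr (- (\<theta> * real k)) * indicator (cell p (r p) {y. c < \<bar>bump \<alpha> y\<bar>}) x)
       \<le> ennreal ?C * ennpowr (X (\<lambda>x. \<Sum>p\<in>L. A p * indicator (cell p (r p) (box 0 1)) x)) (1 - \<theta>) *
          ennpowr (Y (\<lambda>x. \<Sum>p\<in>L. A p / r p ^ k * indicator (cell p (r p) (box 0 1)) x)) \<theta>"
      unfolding eq
    proof (rule combine_cell_bounds[OF X Y \<theta>(1,2) G(2) C K(1) bump_family_axioms K(2)])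
      show "ennreal c * B (\<lambda>x. \<Sum>p\<in>L. A p / r p ^ j * indicator (cell p (r p) {y. c < \<bar>bump \<alpha> y\<bar>}) x)
         \<le> B (abs_grad j (bumps L A r 0))"
        by (rule gradient_lower_bound[OF bump_family_axioms B G(1-4)])
      show "B (abs_grad j (bumps L A r 0)) \<le> ennreal C * ennpowr (X (bumps L A r 0)) (1 - \<theta>) *
         ennpowr (Y (abs_grad k (bumps L A r 0))) \<theta>"
        unfolding \<theta>_def by (intro ineq IntI bumps_fspace bumps_hom_sobolev X Y)
    qed
  qed (use \<theta> G jk in auto)
  then show ?thesis unfolding \<theta>_def by (rule cell_inequality.continuous_embedding)
qed

section \<open>Lower bound for the difference functional\<close>

lemma diff_functional_measurable:
  fixes u :: "real^'n \<Rightarrow> real"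
  assumes "continuous_on UNIV u"
  shows "diff_functional s k q u \<in> borel_measurable borel"
proof -
  have [measurable]: "u \<in> borel_measurable borel"
    using assms by (rule borel_measurable_continuous_onI)
  \<comment> \<open>Over \<open>lborel\<close> the integrand is jointly Borel measurable in
    \<open>x\<close> and \<open>h\<close>, which gives measurability of the inner integral; passing
    to the completion does not change its value.\<close>
  have "(\<lambda>x. \<integral>\<^sup>+h. ennreal (\<bar>fin_diff k h u x\<bar> powr q / norm h powr (real CARD('n) + s * real k * q)) \<partial>lborel)
      \<in> borel_measurable borel"
    unfolding fin_diff_def by measurable
  then show ?thesis
    unfolding diff_functional_def[abs_def] nn_integral_completion ennpowr_def by measurable
qed

text \<open>
  For \<open>h\<close> with all coordinates between \<open>r p\<close> and \<open>2 * r p\<close>, the points \<open>x + m h\<close> with \<open>1 \<le> m \<le> k\<close>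
  have left the cell of \<open>x\<close> without reaching any other cell.
\<close>

lemma (in bump_family) fin_diff_bumps:
  fixes x h :: "real^'n"
  assumes r0k: "(2 * real k + 1) * r0 \<le> 1" and p: "p \<in> L" and x: "x \<in> cell p (r p) (box 0 1)"
    and h: "h \<in> cbox (vec (r p)) (vec (2 * r p))"
  shows "\<bar>fin_diff k h (bumps L A r 0) x\<bar> = \<bar>bumps L A r 0 x\<bar>"
proof -
  have out: "bumps L A r 0 (x + real m *\<^sub>R h) = 0" if m: "1 \<le> m" "m \<le> k" for m
  proof (rule bumps_outside_cells)
    fix q assume q: "q \<in> L"
    obtain i :: 'n where True by auto
    have x_i: "real p < x $ i" "x $ i < real p + r p"
      using cell_in_unit_cube[OF x order_refl] r_pos[OF p] r_le[OF p] by auto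
    have h_i: "r p \<le> h $ i" "h $ i \<le> 2 * r p" using h by (auto simp: mem_box_cart)
    \<comment> \<open>A single step already moves each coordinate by at least the side of the cell,
      so \<open>x + m h\<close> is beyond the cell of \<open>x\<close>.\<close>
    have "1 * r p \<le> real m * h $ i" using m h_i r_pos[OF p] by (intro mult_mono) auto
    then have lo: "real p + r p < (x + real m *\<^sub>R h) $ i" using x_i by simp
    have "real m * h $ i \<le> real k * (2 * r p)" using m h_i r_pos[OF p] by (intro mult_mono) auto
    \<comment> \<open>The side itself plus \<open>k\<close> steps of at most \<open>2 * r p\<close>
      stay within one unit, so position \<open>p + 1\<close> on the diagonal is not reached.\<close>
    moreover have "(2 * real k + 1) * r p \<le> 1"
      using r_le(1)[OF p] r0k mult_left_mono[of "r p" r0 "2 * real k + 1"] by linarith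
    ultimately have hi: "(x + real m *\<^sub>R h) $ i < real p + 1" using x_i by (simp add: algebra_simps)
    show "x + real m *\<^sub>R h \<notin> cell q (r q) (box 0 1)"
    proof
      assume "x + real m *\<^sub>R h \<in> cell q (r q) (box 0 1)"
      then have q_i: "real q < (x + real m *\<^sub>R h) $ i" "(x + real m *\<^sub>R h) $ i < real q + r q"
        using cell_in_unit_cube[OF _ order_refl] r_pos[OF q] r_le[OF q] by blast+
      have "real q < real p + 1" "real p < real q + 1" using lo hi q_i r_le(2)[OF q] r_pos[OF p] by linarith+
      then have "q = p" by linarith
      then show False using lo q_i by simp
    qed
  qed
  \<comment> \<open>Only the term at \<open>x\<close> itself survives, with coefficient 1 up to
    sign.\<close>
  have "fin_diff k h (bumps L A r 0) x
      = (\<Sum>m\<in>{0}. (-1) ^ (k - m) * real (k choose m) * bumps L A r 0 (x + real m *\<^sub>R h))"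
    unfolding fin_diff_def by (rule sum.mono_neutral_right) (use out in auto)
  then show ?thesis by (simp add: abs_mult power_abs)
qed

text \<open>Restrict the integral to the cube of those \<open>h\<close> with coordinates between
  \<open>r p\<close> and \<open>2 * r p\<close>. It has volume \<open>r p ^ n\<close>, the
  difference there is at least \<open>c * A p\<close> in absolute value, and the norm of
  \<open>h\<close> is at most \<open>2 * n * r p\<close>. After taking the q-th root, the volume
  cancels the \<open>n\<close> in the exponent of the weight and \<open>r p powr (- (s * k))\<close>
  remains.\<close>

lemma (in bump_family) diff_functional_lower_bound:
  fixes x :: "real^'n"
  assumes r0k: "(2 * real k + 1) * r0 \<le> 1" and p: "p \<in> L" and x: "x \<in> cell p (r p) {y. c < \<bar>bump 0 y\<bar>}"
    and c: "0 < c" and q: "1 \<le> q" and s: "0 < s"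
  defines "n \<equiv> real CARD('n)"
  shows "ennreal (c * (2 * n) powr (- ((n + s * real k * q) / q)) * (A p * r p powr (- (s * real k))))
     \<le> diff_functional s k q (bumps L A r 0) x"
proof -
  let ?u = "bumps L A r (0 :: nat^'n)"
  define e where "e = n + s * real k * q"
  have n: "n \<ge> 1" by (simp add: n_def Suc_le_eq)
  have e: "e > 0" using n q s by (simp add: e_def add_pos_nonneg)
  define \<rho> where "\<rho> = r p"
  have \<rho>: "\<rho> > 0" using r_pos[OF p] by (simp add: \<rho>_def)
  have y: "c < \<bar>bump 0 ((1 / r p) *\<^sub>R (x - vec (real p)))\<bar>" using x r_pos[OF p] by (simp add: mem_cell_iff)
  then have "(1 / r p) *\<^sub>R (x - vec (real p)) \<in> box 0 1" using bump_outside c by (metis abs_zero less_asym)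
  then have xQ: "x \<in> cell p (r p) (box 0 1)" using r_pos[OF p] by (simp add: mem_cell_iff)
  have "\<bar>?u x\<bar> = A p * \<bar>bump 0 ((1 / r p) *\<^sub>R (x - vec (real p)))\<bar>"
    using bumps_in_cell[OF p xQ, of 0] A_pos[OF p] by (simp add: abs_mult mi_order_def)
  then have u: "c * A p \<le> \<bar>?u x\<bar>" using y A_pos[OF p] by (simp add: mult.commute[of c] mult_left_mono)
  \<comment> \<open>The claimed bound; its q-th power is exactly the pointwise bound
    \<open>?v\<close> times the volume of \<open>?H\<close>.\<close>
  define z where "z = c * (2 * n) powr (- (e / q)) * (A p * \<rho> powr (- (s * real k)))"
  have z: "z > 0" using c n A_pos[OF p] \<rho> by (simp add: z_def)
  let ?H = "cbox (vec \<rho>) (vec (2 * \<rho>)) :: (real^'n) set"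
  have H: "emeasure lebesgue ?H = ennreal (\<rho> powr n)"
  proof -
    have "measure lborel ?H = (\<Prod>i\<in>(UNIV :: 'n set). \<rho>)"
      using \<rho> by (subst content_cbox_cart) (auto simp: interval_ne_empty_cart)
    then have "measure lebesgue ?H = \<rho> powr n" using \<rho> by (simp add: n_def powr_realpow)
    then show ?thesis by (metis emeasure_eq_measure2 lmeasurable_cbox)
  qed
  let ?v = "(c * A p) powr q / (2 * n * \<rho>) powr e"
  have "ennreal (z powr q) = ennreal ?v * ennreal (\<rho> powr n)"
  proof -
    have "\<rho> powr e = \<rho> powr n * \<rho> powr (s * real k * q)" by (simp add: e_def powr_add)
    then have "?v * \<rho> powr n = (c * A p) powr q * (2 * n) powr (- e) * \<rho> powr (- (s * real k * q))"
      using n \<rho> by (simp add: powr_mult powr_minus field_simps)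
    moreover have "z powr q = (c * A p) powr q * (2 * n) powr (- e) * \<rho> powr (- (s * real k * q))"
      using n \<rho> c q A_pos[OF p] by (simp add: z_def powr_mult powr_powr)
    ultimately show ?thesis by (simp add: ennreal_mult[symmetric])
  qed
  also have "\<dots> = (\<integral>\<^sup>+h\<in>?H. ennreal ?v \<partial>lebesgue)"
    unfolding H[symmetric] by (rule nn_integral_cmult_indicator[symmetric]) simp
  also have "\<dots> \<le> (\<integral>\<^sup>+h. ennreal (\<bar>fin_diff k h ?u x\<bar> powr q / norm h powr (n + s * real k * q)) \<partial>lebesgue)"
  proof (rule nn_integral_mono)
    fix h :: "real^'n"
    show "ennreal ?v * indicator ?H h \<le> ennreal (\<bar>fin_diff k h ?u x\<bar> powr q / norm h powr (n + s * real k * q))"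
    proof (cases "h \<in> ?H")
      case True
      obtain i :: 'n where True by auto
      have "\<rho> \<le> h $ i" using True by (auto simp: mem_box_cart)
      then have "h \<noteq> 0" using \<rho> by auto
      \<comment> \<open>Estimating the norm by the sum of the \<open>n\<close> coordinates, each at
        most \<open>2 * \<rho>\<close>, is the origin of \<open>2 * n\<close> in the
        constant.\<close>
      have "norm h \<le> (\<Sum>i\<in>UNIV. \<bar>h $ i\<bar>)" by (rule norm_le_l1_cart)
      also have "\<dots> \<le> (\<Sum>i\<in>(UNIV :: 'n set). 2 * \<rho>)"
      proof (rule sum_mono)
        fix i :: 'n
        have "\<rho> \<le> h $ i" "h $ i \<le> 2 * \<rho>" using \<open>h \<in> ?H\<close> by (auto simp: mem_box_cart)
        then show "\<bar>h $ i\<bar> \<le> 2 * \<rho>" using \<rho> by simp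
      qed
      finally have norm_h: "norm h \<le> 2 * n * \<rho>" by (simp add: n_def mult_ac)
      have "(c * A p) powr q \<le> \<bar>fin_diff k h ?u x\<bar> powr q"
        using u c q A_pos[OF p] fin_diff_bumps[OF r0k p xQ, of h] True by (intro powr_mono2) (auto simp: \<rho>_def)
      moreover have "norm h powr e \<le> (2 * n * \<rho>) powr e" using norm_h e by (intro powr_mono2) auto
      ultimately have "?v \<le> \<bar>fin_diff k h ?u x\<bar> powr q / norm h powr e"
        using \<open>h \<noteq> 0\<close> by (intro frac_le) auto
      then show ?thesis using True by (simp add: e_def ennreal_leI)
    qed simp
  qed
  finally have "ennpowr (ennreal (z powr q)) (1 / q) \<le> diff_functional s k q ?u x"
    unfolding diff_functional_def n_def using q by (intro ennpowr_mono) auto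
  moreover have "ennpowr (ennreal (z powr q)) (1 / q) = ennreal z"
    using z q by (simp add: ennpowr_def powr_powr)
  ultimately show ?thesis unfolding z_def e_def \<rho>_def by simp
qed

text \<open>Unless the difference functional is finite almost everywhere, the right-hand side is
  infinite. In the finite case the pointwise bound survives \<open>enn2real\<close> and monotonicity
  of the norm applies.\<close>

lemma (in bump_family) ext_norm_lower_bound:
  fixes B :: "(real^'n \<Rightarrow> real) \<Rightarrow> ennreal"
  assumes "ri_banach_function_space B" and r0k: "(2 * real k + 1) * r0 \<le> 1"
    and c: "0 < c" and q: "1 \<le> q" and s: "0 < s"
    and G: "{y :: real^'n. c < \<bar>bump 0 y\<bar>} \<in> lmeasurable" "{y :: real^'n. c < \<bar>bump 0 y\<bar>} \<subseteq> box 0 1"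
  defines "n \<equiv> real CARD('n)"
  shows "ennreal (c * (2 * n) powr (- ((n + s * real k * q) / q))) *
       B (\<lambda>x. \<Sum>p\<in>L. A p * r p powr (- (s * real k)) * indicator (cell p (r p) {y. c < \<bar>bump 0 y\<bar>}) x)
     \<le> ext_norm B (diff_functional s k q (bumps L A r 0))"
proof (cases "AE x in lebesgue. diff_functional s k q (bumps L A r (0 :: nat^'n)) x < \<infinity>")
  case True
  interpret B: ri_banach_function_space B by fact
  let ?G = "{y :: real^'n. c < \<bar>bump 0 y\<bar>}" and ?D = "diff_functional s k q (bumps L A r (0 :: nat^'n))"
  let ?s = "\<lambda>x. \<Sum>p\<in>L. A p * r p powr (- (s * real k)) * indicator (cell p (r p) ?G) x"
  define c' where "c' = c * (2 * n) powr (- ((n + s * real k * q) / q))"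
  have c': "c' \<ge> 0" using c by (simp add: c'_def)
  have L0: "?s \<in> L0" by (intro B.step_L0 cell_lmeasurable G)
  have "ennreal c' * B ?s = B (\<lambda>x. c' * ?s x)" using B.norm_scale[OF L0, of c'] c' by simp
  also have "\<dots> \<le> B (\<lambda>x. enn2real (?D x))"
  proof (rule B.norm_mono)
    show "(\<lambda>x. c' * ?s x) \<in> L0"
      using L0 unfolding L0_def by (rule borel_measurable_times[OF borel_measurable_const])
    have "(\<lambda>x. enn2real (?D x)) \<in> borel_measurable borel"
      by (rule measurable_compose[OF diff_functional_measurable[OF bumps_continuous]]) simp
    then show "(\<lambda>x. enn2real (?D x)) \<in> L0"
      unfolding L0_def by (intro measurable_completion) simp
    show "AE x in lebesgue. \<bar>c' * ?s x\<bar> \<le> \<bar>enn2real (?D x)\<bar>"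
      using True
    proof eventually_elim
      case (elim x)
      have "(\<Sum>p\<in>L. (c' * (A p * r p powr (- (s * real k)))) * indicator (cell p (r p) ?G) x) \<le> enn2real (?D x)"
      proof (rule cell_sum_le[OF G(2)])
        fix p assume p: "p \<in> L" "x \<in> cell p (r p) ?G"
        have "ennreal (c' * (A p * r p powr (- (s * real k)))) \<le> ?D x"
          using diff_functional_lower_bound[OF r0k p c q s] by (simp add: c'_def n_def)
        then have "enn2real (ennreal (c' * (A p * r p powr (- (s * real k))))) \<le> enn2real (?D x)"
          using elim by (intro enn2real_mono) auto
        then show "c' * (A p * r p powr (- (s * real k))) \<le> enn2real (?D x)"
          using c' A_pos[OF p(1)] by simp
      qed simp
      then have "c' * ?s x \<le> enn2real (?D x)" by (simp only: sum_distrib_left mult.assoc)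
      moreover have "0 \<le> ?s x"
        using A_pos by (intro sum_nonneg mult_nonneg_nonneg) (auto intro: less_imp_le)
      ultimately show ?case using c' by simp
    qed
  qed
  finally show ?thesis using True by (simp add: ext_norm_def c'_def)
qed (simp add: ext_norm_def)

lemma embedding_from_difference_inequality:
  fixes X Y B :: "(real^'n \<Rightarrow> real) \<Rightarrow> ennreal"
  assumes X: "ri_banach_function_space X" and Y: "ri_banach_function_space Y" and B: "ri_banach_function_space B"
    and k: "1 \<le> k" and s: "0 < s" "s < 1" and q: "1 \<le> q" and C: "0 < C"
    and ineq: "\<And>f. f \<in> fspace X \<inter> hom_sobolev k Y \<Longrightarrow>
       ext_norm B (diff_functional s k q f) \<le> ennreal C * ennpowr (X f) (1 - s) * ennpowr (Y (abs_grad k f)) s"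
  shows "continuously_embedded (CL_space X Y s) (CL_norm X Y s) (fspace B) B"
proof -
  obtain \<alpha> :: "nat^'n" and c where \<alpha>: "mi_order \<alpha> = 0" and c: "c > 0" and G:
    "{y. c < \<bar>bump \<alpha> y\<bar>} \<in> lmeasurable" "{y. c < \<bar>bump \<alpha> y\<bar>} \<subseteq> box 0 1"
    "0 < measure lebesgue {y. c < \<bar>bump \<alpha> y\<bar>}"
    using bump_level_set by metis
  \<comment> \<open>The difference functional sees values of the bump rather than derivatives, so
    the level set of order 0 is used, and order 0 leaves only the zero multi-index.\<close>
  have "\<alpha> = 0" using \<alpha> by (simp add: mi_order_def vec_eq_iff)
  note G = G[unfolded this]
  obtain K where K: "K \<ge> 1" "\<And>(\<alpha> :: nat^'n) y. mi_order \<alpha> = k \<Longrightarrow> \<bar>bump \<alpha> y\<bar> \<le> K"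
    using bump_bounded by metis
  define n where "n = real CARD('n)"
  define c' where "c' = c * (2 * n) powr (- ((n + s * real k * q) / q))"
  have c': "c' > 0" using c by (simp add: c'_def n_def)
  \<comment> \<open>One side length plus \<open>k\<close> steps of at most two side lengths in each
    coordinate have to fit into a unit interval, as in \<open>fin_diff_bumps\<close>.\<close>
  define r0 where "r0 = 1 / (2 * real k + 1)"
  have rad: "0 < r0" "r0 \<le> 1" "(2 * real k + 1) * r0 \<le> 1" by (simp_all add: r0_def field_simps)
  let ?C = "C * (real (card {\<alpha> :: nat^'n. mi_order \<alpha> = k}) * K + 1) powr s / c'"
  have "cell_inequality X Y B s ?C r0 k {y. c < \<bar>bump 0 y\<bar>}"
  proof (intro cell_inequality.intro X Y B cell_inequality_axioms.intro)
    have "real (card {\<alpha> :: nat^'n. mi_order \<alpha> = k}) * K + 1 > 0" using K(1) by (simp add: add_nonneg_pos)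
    then show "0 < ?C" using C c' by simp
    fix L :: "nat set" and A r :: "nat \<Rightarrow> real"
    assume L: "finite L" and Ar: "\<And>p. p \<in> L \<Longrightarrow> 0 < A p \<and> 0 < r p \<and> r p \<le> r0"
    interpret bump_family L A r r0 by unfold_locales (use L Ar rad in auto)
    show "B (\<lambda>x. \<Sum>p\<in>L. A p * r p powr (- (s * real k)) * indicator (cell p (r p) {y. c < \<bar>bump 0 y\<bar>}) x)
       \<le> ennreal ?C * ennpowr (X (\<lambda>x. \<Sum>p\<in>L. A p * indicator (cell p (r p) (box 0 1)) x)) (1 - s) *
          ennpowr (Y (\<lambda>x. \<Sum>p\<in>L. A p / r p ^ k * indicator (cell p (r p) (box 0 1)) x)) s"
    proof (rule combine_cell_bounds[OF X Y s c' C K(1) bump_family_axioms K(2)])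
      show "ennreal c' * B (\<lambda>x. \<Sum>p\<in>L. A p * r p powr (- (s * real k)) * indicator (cell p (r p) {y. c < \<bar>bump 0 y\<bar>}) x)
         \<le> ext_norm B (diff_functional s k q (bumps L A r 0))"
        unfolding c'_def n_def by (rule ext_norm_lower_bound[OF B rad(3) c q s(1) G(1,2)])
      show "ext_norm B (diff_functional s k q (bumps L A r 0))
         \<le> ennreal C * ennpowr (X (bumps L A r 0)) (1 - s) * ennpowr (Y (abs_grad k (bumps L A r 0))) s"
        by (intro ineq IntI bumps_fspace bumps_hom_sobolev X Y)
    qed
  qed (use s G k rad in auto)
  then show ?thesis by (rule cell_inequality.continuous_embedding)
qed

theorem theorem4p1:
  fixes X Y B :: "(real^'n \<Rightarrow> real) \<Rightarrow> ennreal"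
  assumes "ri_banach_function_space X"
    and "ri_banach_function_space Y"
    and "ri_banach_function_space B"
  shows "(\<forall>(k::nat) (s::real) (q::real). 1 \<le> k \<and> 0 < s \<and> s < 1 \<and> 1 \<le> q \<longrightarrow>
            (\<exists>C>0. \<forall>f \<in> fspace X \<inter> hom_sobolev k Y.
               ext_norm B (diff_functional s k q f)
                 \<le> ennreal C * ennpowr (X f) (1 - s) * ennpowr (Y (abs_grad k f)) s) \<longrightarrow>
            continuously_embedded (CL_space X Y s) (CL_norm X Y s) (fspace B) B)
       \<and> (\<forall>(j::nat) (k::nat). 1 \<le> j \<and> j < k \<longrightarrow>
            (\<exists>C>0. \<forall>f \<in> fspace X \<inter> hom_sobolev k Y.
               B (abs_grad j f)
                 \<le> ennreal C * ennpowr (X f) (1 - real j / real k)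
                     * ennpowr (Y (abs_grad k f)) (real j / real k)) \<longrightarrow>
            continuously_embedded (CL_space X Y (real j / real k)) (CL_norm X Y (real j / real k))
              (fspace B) B)"
proof (intro conjI allI impI)
  fix k :: nat and s q :: real
  assume k: "1 \<le> k \<and> 0 < s \<and> s < 1 \<and> 1 \<le> q"
    and "\<exists>C>0. \<forall>f\<in>fspace X \<inter> hom_sobolev k Y. ext_norm B (diff_functional s k q f)
          \<le> ennreal C * ennpowr (X f) (1 - s) * ennpowr (Y (abs_grad k f)) s"
  then obtain C where "C > 0" "\<forall>f\<in>fspace X \<inter> hom_sobolev k Y. ext_norm B (diff_functional s k q f)
          \<le> ennreal C * ennpowr (X f) (1 - s) * ennpowr (Y (abs_grad k f)) s"
    by blast
  with k show "continuously_embedded (CL_space X Y s) (CL_norm X Y s) (fspace B) B"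
    by (intro embedding_from_difference_inequality[OF assms, of k s q C]) auto
next
  fix j k :: nat
  assume jk: "1 \<le> j \<and> j < k"
    and "\<exists>C>0. \<forall>f\<in>fspace X \<inter> hom_sobolev k Y. B (abs_grad j f)
          \<le> ennreal C * ennpowr (X f) (1 - real j / real k) * ennpowr (Y (abs_grad k f)) (real j / real k)"
  then obtain C where "C > 0" "\<forall>f\<in>fspace X \<inter> hom_sobolev k Y. B (abs_grad j f)
          \<le> ennreal C * ennpowr (X f) (1 - real j / real k) * ennpowr (Y (abs_grad k f)) (real j / real k)"
    by blast
  with jk show "continuously_embedded (CL_space X Y (real j / real k)) (CL_norm X Y (real j / real k)) (fspace B) B"
    by (intro embedding_from_gradient_inequality[OF assms, of j k C]) auto
qed

end
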